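(* Let $X$ be a strong Fatou scheme. Then the presheaf of rings $U\mapsto W_{\mathrm{rat}}(\mathcal{O}(U))$ on the open subsets of $X$ is a sheaf for the Zariski topology of $X$. Moreover $W_{\mathrm{rat}}(\mathcal{O}(U))=W_J(\mathcal{O}(U))$ as rings for all open $U\subset X$.
   Context: All rings are commutative and unital. For a ring $A$, $W(A)=1+TA[[T]]$ is the big Witt ring: addition is multiplication of power series (zero element $1$), multiplication is the unique functorial, $T$-adically continuous one with $(1-aT)\cdot(1-bT)=1-abT$, unit $1-T$. $W_{\mathrm{rat}}(A)\subset W(A)$ is the subring of elements $P/Q$ with $P,Q\in A[T]$, $P(0)=1=Q(0)$. For $f=1+a_1T+a_2T^2+\cdots\in W(A)$ put $a_0=1$ and $H(f)=(a_{i+j})_{i,j\ge0}$ (Hankel matrix). $W_J(A)\subset W(A)$ is the set of $f$ for which there is some $n\ge1$ such that all $(n+1)\times(n+1)$-minors of $H(f)$ vanish; it is a subring of $W(A)$ containing $W_{\mathrm{rat}}(A)$. An integral domain $A$ with quotient field $K$ is a strong Fatou domain if for every $f\in K(T)\cap A[[T]]$ (intersection in $K((T))$) the unique representation $f=P/Q$ with coprime $P,Q\in K[T]$, $Q(0)=1$, satisfies $P,Q\in A[T]$. Equivalently, $A$ is completely integrally closed: every $x\in K$ for which there is $0\ne d\in A$ with $dx^n\in A$ for all $n\ge1$ lies in $A$. An integral scheme $X$ is called strong Fatou if for all non-empty open affine subschemes $U=\operatorname{Spec}A$ of $X$ the ring $A$ is a strong Fatou domain. *)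

theory Defs
  imports
    "HOL-Computational_Algebra.Formal_Power_Series"
    "HOL-Library.Poly_Mapping"
    "HOL-Library.Multiset"
    "HOL-Combinatorics.Permutations"
    "HOL-Analysis.Abstract_Topology"
    "HOL-Algebra.Divisibility"
    "HOL-Algebra.UnivPoly"
    "HOL-Algebra.QuotRing"
begin

section \<open>Localisations and fraction fields\<close>

definition loc_rel ::
    "('a, 'm) ring_scheme \<Rightarrow> 'a set \<Rightarrow> (('a \<times> 'a) \<times> ('a \<times> 'a)) set" where
  "loc_rel A S =
     {((a, s), (b, t)). a \<in> carrier A \<and> b \<in> carrier A \<and> s \<in> S \<and> t \<in> S \<and>
        (\<exists>u \<in> S. u \<otimes>\<^bsub>A\<^esub> (a \<otimes>\<^bsub>A\<^esub> t) = u \<otimes>\<^bsub>A\<^esub> (b \<otimes>\<^bsub>A\<^esub> s))}"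

definition loc_frac :: "('a, 'm) ring_scheme \<Rightarrow> 'a set \<Rightarrow> 'a \<Rightarrow> 'a \<Rightarrow> ('a \<times> 'a) set" where
  "loc_frac A S a s = loc_rel A S `` {(a, s)}"

definition localization :: "('a, 'm) ring_scheme \<Rightarrow> 'a set \<Rightarrow> ('a \<times> 'a) set ring" where
  "localization A S = \<lparr>
     carrier = (carrier A \<times> S) // loc_rel A S,
     mult = (\<lambda>x y. \<Union>(a, s)\<in>x. \<Union>(b, t)\<in>y. loc_frac A S (a \<otimes>\<^bsub>A\<^esub> b) (s \<otimes>\<^bsub>A\<^esub> t)),
     one = loc_frac A S \<one>\<^bsub>A\<^esub> \<one>\<^bsub>A\<^esub>,
     zero = loc_frac A S \<zero>\<^bsub>A\<^esub> \<one>\<^bsub>A\<^esub>,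
     add = (\<lambda>x y. \<Union>(a, s)\<in>x. \<Union>(b, t)\<in>y.
              loc_frac A S (a \<otimes>\<^bsub>A\<^esub> t \<oplus>\<^bsub>A\<^esub> b \<otimes>\<^bsub>A\<^esub> s) (s \<otimes>\<^bsub>A\<^esub> t))\<rparr>"

definition fraction_field :: "('a, 'm) ring_scheme \<Rightarrow> ('a \<times> 'a) set ring" where
  "fraction_field A = localization A (carrier A - {\<zero>\<^bsub>A\<^esub>})"

definition to_fraction :: "('a, 'm) ring_scheme \<Rightarrow> 'a \<Rightarrow> ('a \<times> 'a) set" where
  "to_fraction A a = loc_frac A (carrier A - {\<zero>\<^bsub>A\<^esub>}) a \<one>\<^bsub>A\<^esub>"


section \<open>Power series\<close>

text \<open>A power series is its coefficient sequence, so that the polynomials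
  \<^term>\<open>carrier (UP A)\<close> of the library are literally power series.\<close>

definition ps_ring :: "('a, 'm) ring_scheme \<Rightarrow> (nat \<Rightarrow> 'a) ring" where
  "ps_ring A = \<lparr>
     carrier = UNIV \<rightarrow> carrier A,
     mult = (\<lambda>f g n. \<Oplus>\<^bsub>A\<^esub>i\<in>{..n}. f i \<otimes>\<^bsub>A\<^esub> g (n - i)),
     one = (\<lambda>n. if n = 0 then \<one>\<^bsub>A\<^esub> else \<zero>\<^bsub>A\<^esub>),
     zero = (\<lambda>n. \<zero>\<^bsub>A\<^esub>),
     add = (\<lambda>f g n. f n \<oplus>\<^bsub>A\<^esub> g n)\<rparr>"


section \<open>The big Witt ring\<close>

definition witt_set :: "('a, 'm) ring_scheme \<Rightarrow> (nat \<Rightarrow> 'a) set" where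
  "witt_set A = {f \<in> carrier (ps_ring A). f 0 = \<one>\<^bsub>A\<^esub>}"

text \<open>The power series \<open>1 - a T\<^sup>n\<close> (for \<open>n \<ge> 1\<close>).\<close>

definition one_minus :: "('a, 'm) ring_scheme \<Rightarrow> 'a \<Rightarrow> nat \<Rightarrow> nat \<Rightarrow> 'a" where
  "one_minus A a n = (\<lambda>k. if k = 0 then \<one>\<^bsub>A\<^esub> else if k = n then \<ominus>\<^bsub>A\<^esub> a else \<zero>\<^bsub>A\<^esub>)"

text \<open>Every \<open>f\<close> in \<^term>\<open>witt_set A\<close> is uniquely an infinite product of factors
  \<open>1 - a\<^sub>k T\<^sup>k\<close> with \<open>k \<ge> 1\<close>; \<open>witt_partial A f n\<close> is the product over
  \<open>k \<le> n\<close> and \<open>witt_coord A f k\<close> is \<open>a\<^sub>k\<close>.\<close>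

primrec witt_partial :: "('a, 'm) ring_scheme \<Rightarrow> (nat \<Rightarrow> 'a) \<Rightarrow> nat \<Rightarrow> nat \<Rightarrow> 'a" where
  "witt_partial A f 0 = \<one>\<^bsub>ps_ring A\<^esub>"
| "witt_partial A f (Suc n) =
     witt_partial A f n \<otimes>\<^bsub>ps_ring A\<^esub>
     one_minus A (witt_partial A f n (Suc n) \<ominus>\<^bsub>A\<^esub> f (Suc n)) (Suc n)"

definition witt_coord :: "('a, 'm) ring_scheme \<Rightarrow> (nat \<Rightarrow> 'a) \<Rightarrow> nat \<Rightarrow> 'a" where
  "witt_coord A f n = witt_partial A f (n - 1) n \<ominus>\<^bsub>A\<^esub> f n"

text \<open>The multiplication of \<open>W(A)\<close>. Functoriality and the rule
  \<open>(1 - a T) * (1 - b T) = 1 - a b T\<close> force, on adjoining an \<open>m\<close>-th root of \<open>a\<close>, an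
  \<open>n\<close>-th root of \<open>b\<close> and roots of unity,
  \<open>(1 - a T\<^sup>m) * (1 - b T\<^sup>n) = (1 - a\<^sup>n\<^sup>/\<^sup>d b\<^sup>m\<^sup>/\<^sup>d T\<^sup>l)\<^sup>d\<close>
  with \<open>d = gcd m n\<close> and \<open>l = lcm m n\<close>; biadditivity and continuity then give the
  product of arbitrary elements. The factors with \<open>m > N\<close> or \<open>n > N\<close> do not affect the
  coefficient of \<open>T\<^sup>N\<close>. The last section proves that this multiplication has the
  characterising properties.\<close>

definition witt_factor :: "('a, 'm) ring_scheme \<Rightarrow> 'a \<Rightarrow> nat \<Rightarrow> 'a \<Rightarrow> nat \<Rightarrow> nat \<Rightarrow> 'a" where
  "witt_factor A a m b n =
     one_minus A (a [^]\<^bsub>A\<^esub> (n div gcd m n) \<otimes>\<^bsub>A\<^esub> b [^]\<^bsub>A\<^esub> (m div gcd m n)) (lcm m n)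
       [^]\<^bsub>ps_ring A\<^esub> gcd m n"

definition witt_mult ::
    "('a, 'm) ring_scheme \<Rightarrow> (nat \<Rightarrow> 'a) \<Rightarrow> (nat \<Rightarrow> 'a) \<Rightarrow> nat \<Rightarrow> 'a" where
  "witt_mult A f g = (\<lambda>N.
     (\<Otimes>\<^bsub>ps_ring A\<^esub>m\<in>{1..N}. \<Otimes>\<^bsub>ps_ring A\<^esub>n\<in>{1..N}.
        witt_factor A (witt_coord A f m) m (witt_coord A g n) n) N)"

definition witt_ring :: "('a, 'm) ring_scheme \<Rightarrow> (nat \<Rightarrow> 'a) ring" where
  "witt_ring A = \<lparr>
     carrier = witt_set A,
     mult = witt_mult A,
     one = one_minus A \<one>\<^bsub>A\<^esub> 1,
     zero = \<one>\<^bsub>ps_ring A\<^esub>,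
     add = (\<otimes>\<^bsub>ps_ring A\<^esub>)\<rparr>"


section \<open>The subrings of rational and of Hankel-finite elements\<close>

definition Wrat_set :: "('a, 'm) ring_scheme \<Rightarrow> (nat \<Rightarrow> 'a) set" where
  "Wrat_set A = {f \<in> witt_set A. \<exists>P \<in> carrier (UP A). \<exists>Q \<in> carrier (UP A).
     P 0 = \<one>\<^bsub>A\<^esub> \<and> Q 0 = \<one>\<^bsub>A\<^esub> \<and> f \<otimes>\<^bsub>ps_ring A\<^esub> Q = P}"

definition hankel :: "(nat \<Rightarrow> 'a) \<Rightarrow> nat \<Rightarrow> nat \<Rightarrow> 'a" where
  "hankel f i j = f (i + j)"

text \<open>Determinant of the square matrix with rows and columns \<open>0, \<dots>, n - 1\<close>.\<close>

definition ring_det :: "('a, 'm) ring_scheme \<Rightarrow> nat \<Rightarrow> (nat \<Rightarrow> nat \<Rightarrow> 'a) \<Rightarrow> 'a" where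
  "ring_det A n M =
     (\<Oplus>\<^bsub>A\<^esub>p\<in>{p. p permutes {..<n}}.
        (if evenperm p then \<one>\<^bsub>A\<^esub> else \<ominus>\<^bsub>A\<^esub> \<one>\<^bsub>A\<^esub>) \<otimes>\<^bsub>A\<^esub> (\<Otimes>\<^bsub>A\<^esub>i\<in>{..<n}. M i (p i)))"

text \<open>The sequences \<open>r\<close> and \<open>c\<close> select the rows and columns of a minor.\<close>

definition minors_vanish :: "('a, 'm) ring_scheme \<Rightarrow> nat \<Rightarrow> (nat \<Rightarrow> nat \<Rightarrow> 'a) \<Rightarrow> bool" where
  "minors_vanish A n M \<longleftrightarrow>
     (\<forall>r c. strict_mono_on {..<n} r \<and> strict_mono_on {..<n} c \<longrightarrow>
        ring_det A n (\<lambda>i j. M (r i) (c j)) = \<zero>\<^bsub>A\<^esub>)"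

definition WJ_set :: "('a, 'm) ring_scheme \<Rightarrow> (nat \<Rightarrow> 'a) set" where
  "WJ_set A = {f \<in> witt_set A. \<exists>n\<ge>1. minors_vanish A (n + 1) (hankel f)}"

definition Wrat :: "('a, 'm) ring_scheme \<Rightarrow> (nat \<Rightarrow> 'a) ring" where
  "Wrat A = (witt_ring A)\<lparr>carrier := Wrat_set A\<rparr>"

definition WJ :: "('a, 'm) ring_scheme \<Rightarrow> (nat \<Rightarrow> 'a) ring" where
  "WJ A = (witt_ring A)\<lparr>carrier := WJ_set A\<rparr>"


section \<open>Strong Fatou domains\<close>

definition coprime_in :: "('a, 'm) monoid_scheme \<Rightarrow> 'a \<Rightarrow> 'a \<Rightarrow> bool" where
  "coprime_in G a b \<longleftrightarrow>
     (\<forall>d \<in> carrier G. d divides\<^bsub>G\<^esub> a \<and> d divides\<^bsub>G\<^esub> b \<longrightarrow> d \<in> Units G)"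

text \<open>A power series over \<open>A\<close> lies in \<open>K(T)\<close> iff it has a representation
  \<open>P / Q\<close> as below, so the quantification over \<open>f\<close>, \<open>P\<close>, \<open>Q\<close> ranges over
  all \<open>f \<in> K(T) \<inter> A[[T]]\<close> and their reduced representations.\<close>

definition strong_Fatou_domain :: "('a, 'm) ring_scheme \<Rightarrow> bool" where
  "strong_Fatou_domain A \<longleftrightarrow> domain A \<and>
     (let K = fraction_field A in
      \<forall>f \<in> carrier (ps_ring A). \<forall>P \<in> carrier (UP K). \<forall>Q \<in> carrier (UP K).
        coprime_in (UP K) P Q \<and> Q 0 = \<one>\<^bsub>K\<^esub> \<and>
        (to_fraction A \<circ> f) \<otimes>\<^bsub>ps_ring K\<^esub> Q = P \<longrightarrow>
        (\<forall>n. P n \<in> to_fraction A ` carrier A \<and> Q n \<in> to_fraction A ` carrier A))"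


section \<open>Sheaves of rings\<close>

text \<open>A presheaf assigns to each open set \<open>U\<close> a ring \<open>F U\<close> and to opens
  \<open>V \<subseteq> U\<close> the restriction map \<open>r U V\<close> from \<open>F U\<close> to \<open>F V\<close>. All section rings
  have their elements in one type; this loses no generality, as one may take the disjoint
  union of the section rings.\<close>

definition presheaf_of_rings ::
    "'x topology \<Rightarrow> ('x set \<Rightarrow> 'a ring) \<Rightarrow> ('x set \<Rightarrow> 'x set \<Rightarrow> 'a \<Rightarrow> 'a) \<Rightarrow> bool" where
  "presheaf_of_rings X F r \<longleftrightarrow>
     (\<forall>U. openin X U \<longrightarrow> cring (F U)) \<and>
     (\<forall>U V. openin X U \<and> openin X V \<and> V \<subseteq> U \<longrightarrow> r U V \<in> ring_hom (F U) (F V)) \<and>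
     (\<forall>U. openin X U \<longrightarrow> (\<forall>s \<in> carrier (F U). r U U s = s)) \<and>
     (\<forall>U V W. openin X U \<and> openin X V \<and> openin X W \<and> V \<subseteq> U \<and> W \<subseteq> V \<longrightarrow>
        (\<forall>s \<in> carrier (F U). r V W (r U V s) = r U W s))"

definition sheaf_of_rings ::
    "'x topology \<Rightarrow> ('x set \<Rightarrow> 'a ring) \<Rightarrow> ('x set \<Rightarrow> 'x set \<Rightarrow> 'a \<Rightarrow> 'a) \<Rightarrow> bool" where
  "sheaf_of_rings X F r \<longleftrightarrow> presheaf_of_rings X F r \<and>
     (\<forall>\<U> s. (\<forall>V \<in> \<U>. openin X V \<and> s V \<in> carrier (F V)) \<and>
        (\<forall>V \<in> \<U>. \<forall>W \<in> \<U>. r V (V \<inter> W) (s V) = r W (V \<inter> W) (s W)) \<longrightarrow>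
        (\<exists>!t. t \<in> carrier (F (\<Union>\<U>)) \<and> (\<forall>V \<in> \<U>. r (\<Union>\<U>) V t = s V)))"


section \<open>Schemes\<close>

record ('x, 'a) ringed_space =
  base :: "'x topology"
  sect :: "'x set \<Rightarrow> 'a ring"
  restr :: "'x set \<Rightarrow> 'x set \<Rightarrow> 'a \<Rightarrow> 'a"

definition ringed_space :: "('x, 'a) ringed_space \<Rightarrow> bool" where
  "ringed_space X \<longleftrightarrow> sheaf_of_rings (base X) (sect X) (restr X)"

definition open_subspace :: "('x, 'a) ringed_space \<Rightarrow> 'x set \<Rightarrow> ('x, 'a) ringed_space" where
  "open_subspace X U = X\<lparr>base := subtopology (base X) U\<rparr>"

definition ringed_space_iso :: "('x, 'a) ringed_space \<Rightarrow> ('y, 'b) ringed_space \<Rightarrow> bool" where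
  "ringed_space_iso X Y \<longleftrightarrow>
     (\<exists>\<phi> \<theta>. homeomorphic_map (base X) (base Y) \<phi> \<and>
        (let pre = (\<lambda>V. {x \<in> topspace (base X). \<phi> x \<in> V}) in
         (\<forall>V. openin (base Y) V \<longrightarrow> \<theta> V \<in> ring_iso (sect Y V) (sect X (pre V))) \<and>
         (\<forall>V W. openin (base Y) V \<and> openin (base Y) W \<and> W \<subseteq> V \<longrightarrow>
            (\<forall>s \<in> carrier (sect Y V).
               restr X (pre V) (pre W) (\<theta> V s) = \<theta> W (restr Y V W s)))))"

definition prime_spectrum :: "('a, 'm) ring_scheme \<Rightarrow> 'a set set" where
  "prime_spectrum A = {p. primeideal p A}"

definition zariski_topology :: "('a, 'm) ring_scheme \<Rightarrow> 'a set topology" where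
  "zariski_topology A =
     topology_generated_by {{p \<in> prime_spectrum A. f \<notin> p} | f. f \<in> carrier A}"

text \<open>Sections of the structure sheaf over \<open>U\<close> are the families of elements of the local
  rings \<open>A\<^sub>p\<close>, \<open>p \<in> U\<close>, that are locally given by fractions.\<close>

definition Spec_sections ::
    "('a, 'm) ring_scheme \<Rightarrow> 'a set set \<Rightarrow> ('a set \<Rightarrow> ('a \<times> 'a) set) set" where
  "Spec_sections A U =
     {s \<in> (\<Pi>\<^sub>E p\<in>U. carrier (localization A (carrier A - p))).
        \<forall>p \<in> U. \<exists>V. openin (zariski_topology A) V \<and> p \<in> V \<and> V \<subseteq> U \<and>
          (\<exists>a \<in> carrier A. \<exists>f \<in> carrier A.
             \<forall>q \<in> V. f \<notin> q \<and> s q = loc_frac A (carrier A - q) a f)}"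

definition Spec ::
    "('a, 'm) ring_scheme \<Rightarrow> ('a set, 'a set \<Rightarrow> ('a \<times> 'a) set) ringed_space" where
  "Spec A = \<lparr>
     base = zariski_topology A,
     sect = (\<lambda>U. \<lparr>
       carrier = Spec_sections A U,
       mult = (\<lambda>s t. \<lambda>p\<in>U. s p \<otimes>\<^bsub>localization A (carrier A - p)\<^esub> t p),
       one = (\<lambda>p\<in>U. \<one>\<^bsub>localization A (carrier A - p)\<^esub>),
       zero = (\<lambda>p\<in>U. \<zero>\<^bsub>localization A (carrier A - p)\<^esub>),
       add = (\<lambda>s t. \<lambda>p\<in>U. s p \<oplus>\<^bsub>localization A (carrier A - p)\<^esub> t p)\<rparr>),
     restr = (\<lambda>U V s. restrict s V)\<rparr>"

text \<open>The ring \<open>A\<close> may be taken on the type of the sections of \<open>X\<close>, since necessarily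
  \<open>A\<close> is isomorphic to \<open>sect X U\<close>.\<close>

definition affine_open :: "('x, 'a) ringed_space \<Rightarrow> 'x set \<Rightarrow> bool" where
  "affine_open X U \<longleftrightarrow> openin (base X) U \<and>
     (\<exists>A :: 'a ring. cring A \<and> ringed_space_iso (open_subspace X U) (Spec A))"

text \<open>The stalks of a ringed space that is locally isomorphic to affine ones are local rings,
  and isomorphisms of ringed spaces induce local homomorphisms on stalks, so
  schemes are the same among ringed spaces and among locally ringed spaces.\<close>

definition scheme :: "('x, 'a) ringed_space \<Rightarrow> bool" where
  "scheme X \<longleftrightarrow> ringed_space X \<and>
     (\<forall>x \<in> topspace (base X). \<exists>U. x \<in> U \<and> affine_open X U)"

definition integral_scheme :: "('x, 'a) ringed_space \<Rightarrow> bool" where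
  "integral_scheme X \<longleftrightarrow> scheme X \<and> topspace (base X) \<noteq> {} \<and>
     (\<forall>U. openin (base X) U \<and> U \<noteq> {} \<longrightarrow> domain (sect X U))"

definition strong_Fatou_scheme :: "('x, 'a) ringed_space \<Rightarrow> bool" where
  "strong_Fatou_scheme X \<longleftrightarrow> integral_scheme X \<and>
     (\<forall>U. affine_open X U \<and> U \<noteq> {} \<longrightarrow> strong_Fatou_domain (sect X U))"


section \<open>The multiplication of the big Witt ring\<close>

text \<open>The explicit \<^const>\<open>witt_mult\<close> has the properties that characterise the multiplication
  of \<open>W(A)\<close>: it makes \<open>W(A)\<close> a commutative ring (\<open>witt_ring_cring\<close>), it is functorial
  (\<open>hom_witt_mult\<close>) and continuous (\<open>witt_mult_continuous\<close>), and
  \<open>(1 - a T) * (1 - b T) = 1 - a b T\<close> (\<open>witt_mult_linear\<close>).\<close>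

lemma ps_simps:
  "f \<in> carrier (ps_ring A) \<longleftrightarrow> (\<forall>n. f n \<in> carrier A)"
  "(f \<otimes>\<^bsub>ps_ring A\<^esub> g) n = (\<Oplus>\<^bsub>A\<^esub>i\<in>{..n}. f i \<otimes>\<^bsub>A\<^esub> g (n - i))"
  "\<one>\<^bsub>ps_ring A\<^esub> n = (if n = 0 then \<one>\<^bsub>A\<^esub> else \<zero>\<^bsub>A\<^esub>)"
  "\<zero>\<^bsub>ps_ring A\<^esub> n = \<zero>\<^bsub>A\<^esub>"
  "(f \<oplus>\<^bsub>ps_ring A\<^esub> g) n = f n \<oplus>\<^bsub>A\<^esub> g n"
  by (auto simp: ps_ring_def)

context cring begin

definition tr :: "nat \<Rightarrow> (nat \<Rightarrow> 'a) \<Rightarrow> nat \<Rightarrow> 'a" where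
  "tr N f = (\<lambda>n. if n \<le> N then f n else \<zero>)"

lemma tr_carrier: "f \<in> carrier (ps_ring R) \<Longrightarrow> tr N f \<in> up R"
  unfolding up_def tr_def ps_simps by (auto intro!: exI[of _ N] bound.intro)

lemma tr_le: "n \<le> N \<Longrightarrow> tr N f n = f n" by (simp add: tr_def)

lemma ps_m_closed: "f \<in> carrier (ps_ring R) \<Longrightarrow> g \<in> carrier (ps_ring R) \<Longrightarrow> f \<otimes>\<^bsub>ps_ring R\<^esub> g \<in> carrier (ps_ring R)"
  by (auto simp: ps_simps intro!: finsum_closed)

lemma ps_mult_cong: 
  assumes "f \<in> carrier (ps_ring R)" "g \<in> carrier (ps_ring R)"
    "f' \<in> carrier (ps_ring R)" "g' \<in> carrier (ps_ring R)"
  and "\<And>n. n \<le> N \<Longrightarrow> f n = f' n" "\<And>n. n \<le> N \<Longrightarrow> g n = g' n" "n \<le> N"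
  shows "(f \<otimes>\<^bsub>ps_ring R\<^esub> g) n = (f' \<otimes>\<^bsub>ps_ring R\<^esub> g') n"
  unfolding ps_simps using assms by (intro finsum_cong') (auto simp: ps_simps)

lemma UP_mult: "p \<in> up R \<Longrightarrow> q \<in> up R \<Longrightarrow> p \<otimes>\<^bsub>UP R\<^esub> q = p \<otimes>\<^bsub>ps_ring R\<^esub> q"
  by (simp add: UP_def ps_ring_def)

lemma up_ps: "p \<in> up R \<Longrightarrow> p \<in> carrier (ps_ring R)"
  by (auto simp: ps_simps)

lemma tr_mult: assumes "f \<in> carrier (ps_ring R)" "g \<in> carrier (ps_ring R)" "n \<le> N"
  shows "(f \<otimes>\<^bsub>ps_ring R\<^esub> g) n = (tr N f \<otimes>\<^bsub>UP R\<^esub> tr N g) n"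
  using assms
  by (subst UP_mult) (auto intro!: tr_carrier ps_mult_cong[of _ _ _ _ N] up_ps, auto simp: tr_def)

lemma ps_cring: "cring (ps_ring R)"
proof -
  interpret U: UP_cring R "UP R" by unfold_locales
  have c: "carrier (UP R) = up R" by (simp add: UP_def)
  note tr = tr_mult tr_carrier ps_m_closed
  show ?thesis
  proof (rule cringI)
    show "abelian_group (ps_ring R)"
    proof (rule abelian_groupI)
      fix x assume x: "x \<in> carrier (ps_ring R)"
      then show "\<exists>y\<in>carrier (ps_ring R). y \<oplus>\<^bsub>ps_ring R\<^esub> x = \<zero>\<^bsub>ps_ring R\<^esub>"
        by (intro bexI[of _ "\<lambda>n. \<ominus> x n"] ext) (auto simp: ps_simps l_neg)
    qed (auto simp: ps_simps a_ac fun_eq_iff)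
    show "comm_monoid (ps_ring R)"
    proof (rule comm_monoidI)
      show "\<one>\<^bsub>ps_ring R\<^esub> \<in> carrier (ps_ring R)" by (auto simp: ps_simps)
      fix x y assume xy: "x \<in> carrier (ps_ring R)" "y \<in> carrier (ps_ring R)"
      show "x \<otimes>\<^bsub>ps_ring R\<^esub> y \<in> carrier (ps_ring R)" using xy by (rule ps_m_closed)
      show "x \<otimes>\<^bsub>ps_ring R\<^esub> y = y \<otimes>\<^bsub>ps_ring R\<^esub> x"
      proof
        fix n show "(x \<otimes>\<^bsub>ps_ring R\<^esub> y) n = (y \<otimes>\<^bsub>ps_ring R\<^esub> x) n"
          using U.UP_m_comm[of "tr n x" "tr n y"] xy by (simp add: tr_mult[of _ _ n n] tr_carrier c)
      qed
      fix z assume z: "z \<in> carrier (ps_ring R)"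
      show "(x \<otimes>\<^bsub>ps_ring R\<^esub> y) \<otimes>\<^bsub>ps_ring R\<^esub> z = x \<otimes>\<^bsub>ps_ring R\<^esub> (y \<otimes>\<^bsub>ps_ring R\<^esub> z)"
      proof
        fix n
        have t: "tr n x \<in> up R" "tr n y \<in> up R" "tr n z \<in> up R" using xy z by (auto intro: tr_carrier)
        have u: "tr n x \<otimes>\<^bsub>UP R\<^esub> tr n y \<in> up R" "tr n y \<otimes>\<^bsub>UP R\<^esub> tr n z \<in> up R"
          using t U.UP_mult_closed c by auto
        have "((x \<otimes>\<^bsub>ps_ring R\<^esub> y) \<otimes>\<^bsub>ps_ring R\<^esub> z) n = ((tr n x \<otimes>\<^bsub>UP R\<^esub> tr n y) \<otimes>\<^bsub>ps_ring R\<^esub> tr n z) n"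
          by (rule ps_mult_cong[of _ _ _ _ n]) (use xy z t u in \<open>auto simp: tr_mult[of _ _ _ n] tr_le up_ps ps_m_closed\<close>)
        moreover have "(x \<otimes>\<^bsub>ps_ring R\<^esub> (y \<otimes>\<^bsub>ps_ring R\<^esub> z)) n = (tr n x \<otimes>\<^bsub>ps_ring R\<^esub> (tr n y \<otimes>\<^bsub>UP R\<^esub> tr n z)) n"
          by (rule ps_mult_cong[of _ _ _ _ n]) (use xy z t u in \<open>auto simp: tr_mult[of _ _ _ n] tr_le up_ps ps_m_closed\<close>)
        moreover have "(tr n x \<otimes>\<^bsub>UP R\<^esub> tr n y) \<otimes>\<^bsub>UP R\<^esub> tr n z = tr n x \<otimes>\<^bsub>UP R\<^esub> (tr n y \<otimes>\<^bsub>UP R\<^esub> tr n z)"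
          using U.UP_m_assoc[of "tr n x" "tr n y" "tr n z"] xy z by (simp add: c tr_carrier)
        ultimately show "((x \<otimes>\<^bsub>ps_ring R\<^esub> y) \<otimes>\<^bsub>ps_ring R\<^esub> z) n = (x \<otimes>\<^bsub>ps_ring R\<^esub> (y \<otimes>\<^bsub>ps_ring R\<^esub> z)) n"
          using t u by (simp add: UP_mult)
      qed
    next
      fix x assume x: "x \<in> carrier (ps_ring R)"
      show "\<one>\<^bsub>ps_ring R\<^esub> \<otimes>\<^bsub>ps_ring R\<^esub> x = x"
      proof
        fix n
        have "tr n \<one>\<^bsub>ps_ring R\<^esub> = \<one>\<^bsub>UP R\<^esub>" by (auto simp: ps_simps tr_def UP_def)
        then show "(\<one>\<^bsub>ps_ring R\<^esub> \<otimes>\<^bsub>ps_ring R\<^esub> x) n = x n"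
          using U.UP_l_one[of "tr n x"] x 
          by (subst tr_mult[of _ _ n n]) (auto simp: ps_simps tr_carrier c, simp add: tr_def)
      qed
    qed
  next
    fix x y z assume "x \<in> carrier (ps_ring R)" "y \<in> carrier (ps_ring R)" "z \<in> carrier (ps_ring R)"
    then show "(x \<oplus>\<^bsub>ps_ring R\<^esub> y) \<otimes>\<^bsub>ps_ring R\<^esub> z = x \<otimes>\<^bsub>ps_ring R\<^esub> z \<oplus>\<^bsub>ps_ring R\<^esub> y \<otimes>\<^bsub>ps_ring R\<^esub> z"
      by (intro ext) (simp add: ps_simps l_distr Pi_def)
  qed
qed

end

context cring begin

lemma one_minus_closed: "a \<in> carrier R \<Longrightarrow> one_minus R a n \<in> carrier (ps_ring R)"
  by (simp add: ps_simps one_minus_def)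

lemma witt_partial_closed: "f \<in> carrier (ps_ring R) \<Longrightarrow> witt_partial R f n \<in> carrier (ps_ring R)"
proof (induction n)
  case 0
  then show ?case by (simp add: ps_simps)
next
  case (Suc n)
  then show ?case unfolding witt_partial.simps
    by (intro ps_m_closed one_minus_closed minus_closed) (simp_all add: ps_simps)
qed

lemma witt_coord_closed: "f \<in> carrier (ps_ring R) \<Longrightarrow> witt_coord R f n \<in> carrier R"
  using witt_partial_closed[of f "n - 1"] by (simp add: witt_coord_def ps_simps)

lemma witt_factor_closed:
  "a \<in> carrier R \<Longrightarrow> b \<in> carrier R \<Longrightarrow> witt_factor R a m b n \<in> carrier (ps_ring R)"
proof -
  interpret P: cring "ps_ring R" by (rule ps_cring)
  show "a \<in> carrier R \<Longrightarrow> b \<in> carrier R \<Longrightarrow> witt_factor R a m b n \<in> carrier (ps_ring R)"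
    unfolding witt_factor_def by (intro P.nat_pow_closed one_minus_closed m_closed nat_pow_closed)
qed

lemma witt_mult_closed:
  assumes "f \<in> carrier (ps_ring R)" "g \<in> carrier (ps_ring R)"
  shows "witt_mult R f g \<in> witt_set R"
proof -
  interpret P: cring "ps_ring R" by (rule ps_cring)
  have "(\<Otimes>\<^bsub>ps_ring R\<^esub>m\<in>{1..N}. \<Otimes>\<^bsub>ps_ring R\<^esub>n\<in>{1..N}.
        witt_factor R (witt_coord R f m) m (witt_coord R g n) n) \<in> carrier (ps_ring R)" for N
    using assms by (auto intro!: P.finprod_closed witt_factor_closed witt_coord_closed)
  then show ?thesis
    by (auto simp: witt_set_def witt_mult_def ps_simps)
qed

end

context ring_hom_cring begin

lemma ps_hom: "(\<circ>) h \<in> ring_hom (ps_ring R) (ps_ring S)"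
  by (rule ring_hom_memI) (auto simp: ps_simps fun_eq_iff Pi_def intro!: S.finsum_cong')

lemma hom_one_minus: "a \<in> carrier R \<Longrightarrow> h \<circ> one_minus R a n = one_minus S (h a) n"
  by (auto simp: one_minus_def fun_eq_iff)

lemma ps_hom_cring: "ring_hom_cring (ps_ring R) (ps_ring S) ((\<circ>) h)"
  using R.ps_cring S.ps_cring ps_hom by (simp add: ring_hom_cring_def ring_hom_cring_axioms_def)

lemma hom_ps_closed: "f \<in> carrier (ps_ring R) \<Longrightarrow> h \<circ> f \<in> carrier (ps_ring S)"
  by (simp add: ps_simps)

lemma hom_witt_partial: 
  "f \<in> carrier (ps_ring R) \<Longrightarrow> h \<circ> witt_partial R f n = witt_partial S (h \<circ> f) n"
proof (induction n)
  case 0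
  then show ?case by (auto simp: fun_eq_iff ps_simps)
next
  case (Suc n)
  interpret P: ring_hom_cring "ps_ring R" "ps_ring S" "(\<circ>) h" by (rule ps_hom_cring)
  have c: "witt_partial R f n (Suc n) \<in> carrier R" "f (Suc n) \<in> carrier R" 
    using Suc R.witt_partial_closed by (auto simp: ps_simps)
  have "h (witt_partial R f n (Suc n)) = witt_partial S (h \<circ> f) n (Suc n)"
    using Suc by (metis comp_apply)
  then have "h \<circ> witt_partial R f (Suc n) =
      (h \<circ> witt_partial R f n) \<otimes>\<^bsub>ps_ring S\<^esub>
      one_minus S (witt_partial S (h \<circ> f) n (Suc n) \<ominus>\<^bsub>S\<^esub> (h \<circ> f) (Suc n)) (Suc n)"
    using c Suc.prems
    by (simp add: R.witt_partial_closed R.one_minus_closed hom_one_minus R.minus_eq S.minus_eq)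
  then show ?case by (simp only: Suc.IH[OF Suc.prems] witt_partial.simps)
qed

lemma hom_witt_coord: 
  "f \<in> carrier (ps_ring R) \<Longrightarrow> h (witt_coord R f n) = witt_coord S (h \<circ> f) n"
  using hom_witt_partial[of f "n - 1"] R.witt_partial_closed[of f "n - 1"]
  by (auto simp: witt_coord_def ps_simps R.minus_eq S.minus_eq fun_eq_iff)

lemma hom_nat_pow': "x \<in> carrier R \<Longrightarrow> h (x [^]\<^bsub>R\<^esub> (n::nat)) = h x [^]\<^bsub>S\<^esub> n"
  by (induction n) auto

lemma hom_finprod2:
  assumes "\<And>i j. x i j \<in> carrier R"
  shows "h (\<Otimes>\<^bsub>R\<^esub>i\<in>I. \<Otimes>\<^bsub>R\<^esub>j\<in>J. x i j) = (\<Otimes>\<^bsub>S\<^esub>i\<in>I. \<Otimes>\<^bsub>S\<^esub>j\<in>J. h (x i j))"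
  using assms by (simp add: hom_finprod Pi_def o_def)

lemma hom_witt_factor:
  "a \<in> carrier R \<Longrightarrow> b \<in> carrier R \<Longrightarrow> h \<circ> witt_factor R a m b n = witt_factor S (h a) m (h b) n"
proof -
  interpret P: ring_hom_cring "ps_ring R" "ps_ring S" "(\<circ>) h" by (rule ps_hom_cring)
  show "a \<in> carrier R \<Longrightarrow> b \<in> carrier R \<Longrightarrow> ?thesis"
    unfolding witt_factor_def 
    by (subst P.hom_nat_pow') (simp_all add: R.one_minus_closed hom_one_minus hom_nat_pow')
qed

theorem hom_witt_mult:
  assumes "f \<in> carrier (ps_ring R)" "g \<in> carrier (ps_ring R)"
  shows "h \<circ> witt_mult R f g = witt_mult S (h \<circ> f) (h \<circ> g)"
proof
  fix N
  interpret P: ring_hom_cring "ps_ring R" "ps_ring S" "(\<circ>) h" by (rule ps_hom_cring)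
  have "h \<circ> (\<Otimes>\<^bsub>ps_ring R\<^esub>m\<in>{1..N}. \<Otimes>\<^bsub>ps_ring R\<^esub>n\<in>{1..N}.
        witt_factor R (witt_coord R f m) m (witt_coord R g n) n) = 
     (\<Otimes>\<^bsub>ps_ring S\<^esub>m\<in>{1..N}. \<Otimes>\<^bsub>ps_ring S\<^esub>n\<in>{1..N}.
        h \<circ> witt_factor R (witt_coord R f m) m (witt_coord R g n) n)"
    using assms by (intro P.hom_finprod2 R.witt_factor_closed R.witt_coord_closed)
  then show "(h \<circ> witt_mult R f g) N = witt_mult S (h \<circ> f) (h \<circ> g) N"
    using assms by (simp add: witt_mult_def hom_witt_factor hom_witt_coord R.witt_coord_closed fun_eq_iff)
qed

end

text \<open>Over a type of class \<^class>\<open>comm_ring_1\<close>, \<open>om\<close>, \<open>wfac\<close>, \<open>wp\<close>, \<open>wc\<close> and \<open>wm\<close> mirror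
  \<^const>\<open>one_minus\<close>, \<^const>\<open>witt_factor\<close>, \<^const>\<open>witt_partial\<close>, \<^const>\<open>witt_coord\<close> and
  \<^const>\<open>witt_mult\<close>. The ghost series \<open>GH F = - T F' / F\<close> turns the product of power series
  into addition and \<open>wm\<close> into coefficientwise multiplication.\<close>

definition om :: "'b::comm_ring_1 \<Rightarrow> nat \<Rightarrow> 'b fps" where
  "om a n = 1 - fps_const a * fps_X ^ n"

definition wfac :: "'b::comm_ring_1 \<Rightarrow> nat \<Rightarrow> 'b \<Rightarrow> nat \<Rightarrow> 'b fps" where
  "wfac a m b n = om (a ^ (n div gcd m n) * b ^ (m div gcd m n)) (lcm m n) ^ gcd m n"

primrec wp :: "'b::comm_ring_1 fps \<Rightarrow> nat \<Rightarrow> 'b fps" where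
  "wp F 0 = 1"
| "wp F (Suc n) = wp F n * om (fps_nth (wp F n) (Suc n) - fps_nth F (Suc n)) (Suc n)"

definition wc :: "'b::comm_ring_1 fps \<Rightarrow> nat \<Rightarrow> 'b" where
  "wc F n = fps_nth (wp F (n - 1)) n - fps_nth F n"

definition wm :: "'b::comm_ring_1 fps \<Rightarrow> 'b fps \<Rightarrow> 'b fps" where
  "wm F G = Abs_fps (\<lambda>N. fps_nth (\<Prod>m\<in>{1..N}. \<Prod>n\<in>{1..N}. wfac (wc F m) m (wc G n) n) N)"

definition feq :: "nat \<Rightarrow> 'b::comm_ring_1 fps \<Rightarrow> 'b fps \<Rightarrow> bool" where
  "feq N F G \<longleftrightarrow> (\<forall>k\<le>N. fps_nth F k = fps_nth G k)"

lemma feq_refl [simp]: "feq N F F" by (simp add: feq_def)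

lemma feq_mult: "feq N F F' \<Longrightarrow> feq N G G' \<Longrightarrow> feq N (F * G) (F' * G')"
  by (auto simp: feq_def fps_mult_nth intro!: sum.cong)

lemma feq_prod_1: "(\<And>i. i \<in> I \<Longrightarrow> feq N (P i) 1) \<Longrightarrow> feq N (prod P I) 1"
proof (induction I rule: infinite_finite_induct)
  case (insert x I)
  then show ?case using feq_mult[of N "P x" 1 "prod P I" 1] by simp
qed auto

lemma feq_pow_1: "feq N P 1 \<Longrightarrow> feq N (P ^ k) 1"
  using feq_prod_1[of "{..<k}" N "\<lambda>_. P"] by simp

lemma om_nth: "n \<ge> 1 \<Longrightarrow> fps_nth (om a n) k = (if k = 0 then 1 else if k = n then - a else 0)"
  by (auto simp: om_def)

lemma mult_om_nth: "n \<ge> 1 \<Longrightarrow> fps_nth (F * om a n) k = fps_nth F k - (if k < n then 0 else a * fps_nth F (k - n))"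
proof -
  have "F * om a n = F - fps_const a * (F * fps_X ^ n)" by (simp add: om_def algebra_simps)
  then show ?thesis by (simp add: fps_X_power_mult_right_nth)
qed

lemma wp_prod: "wp F n = (\<Prod>k\<in>{1..n}. om (wc F k) k)"
  by (induction n) (auto simp: wc_def)

lemma wp_0: "fps_nth (wp F n) 0 = 1"
  by (induction n) (auto simp: om_nth)

lemma wp_feq: "fps_nth F 0 = 1 \<Longrightarrow> feq n F (wp F n)"
proof (induction n)
  case (Suc n)
  have "fps_nth (wp F (Suc n)) k = (if k = Suc n then fps_nth F k else fps_nth (wp F n) k)"
    if "k \<le> Suc n" for k
    using that by (auto simp: mult_om_nth wp_0)
  then show ?case using Suc by (auto simp: feq_def)
qed (auto simp: feq_def)

definition dlN :: "nat \<Rightarrow> 'b::comm_ring_1 fps \<Rightarrow> 'b fps \<Rightarrow> bool" where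
  "dlN N W F \<longleftrightarrow> feq N (W * F) (- (fps_X * fps_deriv F))"

lemma XD_nth: "fps_nth (fps_X * fps_deriv F) k = of_nat k * fps_nth F k"
  by (cases k) (auto)

lemma dlN_mult: fixes F :: "'b::comm_ring_1 fps" shows "W * F = - (fps_X * fps_deriv F) \<Longrightarrow> V * G = - (fps_X * fps_deriv G) \<Longrightarrow>
  (W + V) * (F * G) = - (fps_X * fps_deriv (F * G))"
proof -
  assume a: "W * F = - (fps_X * fps_deriv F)" "V * G = - (fps_X * fps_deriv G)"
  have "(W + V) * (F * G) = (W * F) * G + F * (V * G)" by (simp add: algebra_simps)
  also have "\<dots> = - (fps_X * fps_deriv (F * G))" unfolding a by (simp add: algebra_simps)
  finally show ?thesis .
qed

lemma dlN_prod: fixes F :: "'c \<Rightarrow> 'b::comm_ring_1 fps" shows "(\<And>i. i \<in> I \<Longrightarrow> W i * F i = - (fps_X * fps_deriv (F i))) \<Longrightarrow>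
   (\<Sum>i\<in>I. W i) * (\<Prod>i\<in>I. F i) = - (fps_X * fps_deriv (\<Prod>i\<in>I. F i))"
proof (induction I rule: infinite_finite_induct)
  case (insert x I)
  then show ?case by (simp add: dlN_mult)
qed auto

lemma dlN_pow: fixes F :: "'b::comm_ring_1 fps" shows "W * F = - (fps_X * fps_deriv F) \<Longrightarrow>
   (of_nat n * W) * F ^ n = - (fps_X * fps_deriv (F ^ n))"
  using dlN_prod[of "{..<n}" "\<lambda>_. W" "\<lambda>_. F"] by simp

lemma dlN_cong: "dlN N W F \<Longrightarrow> feq N W W' \<Longrightarrow> feq N F F' \<Longrightarrow> dlN N W' F'"
  using feq_mult[of N W W' F F'] unfolding dlN_def feq_def by (simp only: XD_nth fps_neg_nth) simp

lemma dlN_I: "W * F = - (fps_X * fps_deriv F) \<Longrightarrow> dlN N W F" by (simp add: dlN_def)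

lemma dl_iff: "W * F = - (fps_X * fps_deriv F) \<longleftrightarrow> (\<forall>N. dlN N W F)"
  by (auto simp: dlN_def feq_def fps_eq_iff)

lemma dlN_nth: "dlN N W F \<Longrightarrow> fps_nth F 0 = 1 \<Longrightarrow> k \<le> N \<Longrightarrow>
  fps_nth W k = - of_nat k * fps_nth F k - (\<Sum>i<k. fps_nth W i * fps_nth F (k - i))"
proof -
  assume a: "dlN N W F" "fps_nth F 0 = 1" "k \<le> N"
  then have "fps_nth (W * F) k = - of_nat k * fps_nth F k" by (auto simp: dlN_def feq_def XD_nth)
  moreover have "fps_nth (W * F) k = (\<Sum>i<k. fps_nth W i * fps_nth F (k - i)) + fps_nth W k"
    using a by (simp add: fps_mult_nth atLeast0AtMost lessThan_Suc_atMost[symmetric])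
  ultimately show ?thesis by (simp add: algebra_simps)
qed

lemma dlN_unique: assumes "dlN N W F" "dlN N V F" "fps_nth F 0 = 1" shows "feq N W V"
proof -
  have "k \<le> N \<Longrightarrow> fps_nth W k = fps_nth V k" for k
  proof (induction k rule: less_induct)
    case (less k)
    have "(\<Sum>i<k. fps_nth W i * fps_nth F (k - i)) = (\<Sum>i<k. fps_nth V i * fps_nth F (k - i))"
      using less by (intro sum.cong) auto
    then show ?case using dlN_nth[OF assms(1,3), of k] dlN_nth[OF assms(2,3), of k] less by simp
  qed
  then show ?thesis by (simp add: feq_def)
qed

definition gh :: "'b::comm_ring_1 \<Rightarrow> nat \<Rightarrow> 'b fps" where
  "gh a m = Abs_fps (\<lambda>N. if m dvd N \<and> N \<noteq> 0 then of_nat m * a ^ (N div m) else 0)"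

lemma gh_om: assumes "m \<ge> 1" shows "gh a m * om a m = - (fps_X * fps_deriv (om a m))"
proof (rule fps_ext)
  fix k
  have "fps_nth (gh a m) k - (if k < m then 0 else a * fps_nth (gh a m) (k - m)) = (if k = m then of_nat m * a else 0)"
  proof -
    consider "k = 0" | "\<not> m dvd k" | "k = m" | j where "k = m * (j + 2)"
    proof -
      assume *: "k = 0 \<Longrightarrow> thesis" "\<not> m dvd k \<Longrightarrow> thesis" "k = m \<Longrightarrow> thesis" "\<And>j. k = m * (j+2) \<Longrightarrow> thesis"
      show thesis
      proof (cases "m dvd k")
        case True
        then obtain i where i: "k = m * i" by auto
        consider "i = 0" | "i = 1" | "i \<ge> 2" by linarith
        then show thesis
        proof cases
          case 3
          then have "(i - 2) + 2 = i" by simp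
          then have "k = m * ((i - 2) + 2)" using i by (simp only:)
          then show thesis by (rule *(4))
        qed (use * i in simp_all)
      qed (use * in auto)
    qed
    then show ?thesis
    proof cases
      case 2
      then have "\<not> k < m \<Longrightarrow> \<not> m dvd (k - m)" by (simp add: dvd_minus_self)
      moreover have "k \<noteq> m" using 2 by auto
      ultimately show ?thesis using 2 by (simp add: gh_def)
    next
      case (4 j)
      have "k - m = m * (j + 1)" using 4 by (simp add: algebra_simps)
      moreover have "k \<noteq> m" "\<not> k < m" using 4 assms by auto
      ultimately show ?thesis using 4 assms by (simp add: gh_def)
    qed (use assms in \<open>auto simp: gh_def\<close>)
  qed
  then show "fps_nth (gh a m * om a m) k = fps_nth (- (fps_X * fps_deriv (om a m))) k"
    using assms by (simp add: mult_om_nth XD_nth om_nth)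
qed

definition GH :: "'b::comm_ring_1 fps \<Rightarrow> 'b fps" where
  "GH F = Abs_fps (\<lambda>N. \<Sum>m\<in>{1..N}. fps_nth (gh (wc F m) m) N)"

lemma GH_nth: "k \<le> N \<Longrightarrow> fps_nth (GH F) k = (\<Sum>m\<in>{1..N}. fps_nth (gh (wc F m) m) k)"
  unfolding GH_def fps_nth_Abs_fps by (rule sum.mono_neutral_left) (auto simp: gh_def dest: dvd_imp_le)

lemma GH_0: "fps_nth (GH F) 0 = 0"
  by (simp add: GH_def)

lemma GH_dl: assumes "fps_nth F 0 = 1" shows "GH F * F = - (fps_X * fps_deriv F)"
  unfolding dl_iff
proof
  fix N
  have "(\<Sum>m\<in>{1..N}. gh (wc F m) m) * wp F N = - (fps_X * fps_deriv (wp F N))"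
    unfolding wp_prod by (rule dlN_prod) (auto simp: gh_om)
  then have "dlN N (\<Sum>m\<in>{1..N}. gh (wc F m) m) (wp F N)" by (rule dlN_I)
  then show "dlN N (GH F) F"
    by (rule dlN_cong) (use wp_feq[OF assms, of N] in \<open>auto simp: feq_def GH_nth fps_sum_nth\<close>)
qed

lemma GH_unique: assumes "W * F = - (fps_X * fps_deriv F)" "fps_nth F 0 = 1" shows "GH F = W"
proof (rule fps_ext)
  fix k
  have "feq k (GH F) W" using assms GH_dl[OF assms(2)] by (intro dlN_unique dlN_I)
  then show "fps_nth (GH F) k = fps_nth W k" by (simp add: feq_def)
qed

lemma GH_mult: "fps_nth F 0 = 1 \<Longrightarrow> fps_nth G 0 = 1 \<Longrightarrow> GH (F * G) = GH F + GH G"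
  by (intro GH_unique dlN_mult GH_dl) auto

lemma GH_om: "m \<ge> 1 \<Longrightarrow> GH (om a m) = gh a m"
  by (intro GH_unique gh_om) (auto simp: om_nth)

lemma wfac_feq: assumes "m \<ge> 1" "n \<ge> 1" "m > k \<or> n > k" shows "feq k (wfac a m b n) 1"
proof -
  have "m \<le> lcm m n" "n \<le> lcm m n" using assms by (auto intro!: dvd_imp_le simp: lcm_pos_nat)
  then have "lcm m n > k" "lcm m n \<ge> 1" using assms by auto
  then show ?thesis unfolding wfac_def by (intro feq_pow_1) (auto simp: feq_def om_nth)
qed

lemma wm_nth: assumes "k \<le> N" 
  shows "fps_nth (wm F G) k = fps_nth (\<Prod>m\<in>{1..N}. \<Prod>n\<in>{1..N}. wfac (wc F m) m (wc G n) n) k"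
proof -
  let ?p = "\<lambda>(m,n). wfac (wc F m) m (wc G n) n"
  let ?A = "{1..k} \<times> {1..k}" and ?B = "{1..N} \<times> {1..N}"
  have "prod ?p ?B = prod ?p (?B - ?A) * prod ?p ?A"
    using assms by (intro prod.subset_diff) auto
  moreover have "feq k (prod ?p (?B - ?A)) 1"
    by (rule feq_prod_1) (auto intro!: wfac_feq)
  then have "feq k (prod ?p (?B - ?A) * prod ?p ?A) (1 * prod ?p ?A)"
    by (intro feq_mult feq_refl)
  ultimately have "feq k (prod ?p ?B) (1 * prod ?p ?A)" by (simp only:)
  then show ?thesis by (simp add: wm_def prod.cartesian_product feq_def)
qed

lemma wm_0: "fps_nth (wm F G) 0 = 1" by (simp add: wm_def)

lemma gh_wfac: 
  fixes a b :: "'b::comm_ring_1"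
  assumes "m \<ge> 1" "n \<ge> 1"
  shows "of_nat (gcd m n) * fps_nth (gh (a ^ (n div gcd m n) * b ^ (m div gcd m n)) (lcm m n)) k
    = fps_nth (gh a m) k * fps_nth (gh b n) k"
proof (cases "m dvd k \<and> n dvd k \<and> k \<noteq> 0")
  case True
  then obtain j where j: "k = lcm m n * j" by (meson dvdE lcm_least)
  define m' n' where "m' = m div gcd m n" and "n' = n div gcd m n"
  have l: "lcm m n = m * n'" "lcm m n = n * m'"
    unfolding m'_def n'_def
    by (simp add: lcm_nat_def div_mult_swap) (simp add: lcm_nat_def div_mult_swap mult.commute)
  have p: "lcm m n > 0" using assms by (simp add: lcm_pos_nat)
  have k1: "k div m = n' * j" using assms unfolding j l(1) by (simp add: mult.assoc)
  have k2: "k div n = m' * j" using assms unfolding j l(2) by (simp add: mult.assoc)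
  have k3: "k div lcm m n = j" using p by (simp add: j)
  have gl: "of_nat (gcd m n) * of_nat (lcm m n) = (of_nat m * of_nat n :: 'b)"
    by (simp flip: of_nat_mult add: prod_gcd_lcm_nat[symmetric])
  have "of_nat (gcd m n) * (of_nat (lcm m n) * (a ^ n' * b ^ m') ^ j)
      = (of_nat m * of_nat n) * (a ^ (n' * j) * b ^ (m' * j))"
    unfolding gl[symmetric] by (simp add: power_mult_distrib power_mult mult.assoc)
  then have "of_nat (gcd m n) * (of_nat (lcm m n) * (a ^ n' * b ^ m') ^ j)
      = (of_nat m * a ^ (n' * j)) * (of_nat n * b ^ (m' * j))"
    by (simp add: mult_ac)
  moreover have "lcm m n dvd k" using True by simp
  ultimately show ?thesis using True
    unfolding gh_def fps_nth_Abs_fps m'_def[symmetric] n'_def[symmetric] k1 k2 k3 by simp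
qed (auto simp: gh_def)

theorem GH_wm: "fps_nth (GH (wm F G)) k = fps_nth (GH F) k * fps_nth (GH G) k"
proof -
  let ?W = "Abs_fps (\<lambda>k. fps_nth (GH F) k * fps_nth (GH G) k)"
  have "?W * wm F G = - (fps_X * fps_deriv (wm F G))"
    unfolding dl_iff
  proof
    fix N
    let ?V = "\<lambda>m n. of_nat (gcd m n) * gh (wc F m ^ (n div gcd m n) * wc G n ^ (m div gcd m n)) (lcm m n)"
    let ?P = "\<lambda>m n. wfac (wc F m) m (wc G n) n"
    have "?V m n * ?P m n = - (fps_X * fps_deriv (?P m n))" if "m \<ge> 1" "n \<ge> 1" for m n
      unfolding wfac_def by (intro dlN_pow gh_om) (use that in \<open>simp add: Suc_leI lcm_pos_nat\<close>)
    then have "(\<Sum>m\<in>{1..N}. \<Sum>n\<in>{1..N}. ?V m n) * (\<Prod>m\<in>{1..N}. \<Prod>n\<in>{1..N}. ?P m n) = - (fps_X * fps_deriv (\<Prod>m\<in>{1..N}. \<Prod>n\<in>{1..N}. ?P m n))"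
      by (intro dlN_prod) auto
    then have "dlN N (\<Sum>m\<in>{1..N}. \<Sum>n\<in>{1..N}. ?V m n) (\<Prod>m\<in>{1..N}. \<Prod>n\<in>{1..N}. ?P m n)"
      by (rule dlN_I)
    moreover have "feq N (\<Sum>m\<in>{1..N}. \<Sum>n\<in>{1..N}. ?V m n) ?W"
      unfolding feq_def
    proof (intro allI impI)
      fix k assume k: "k \<le> N"
      have n: "fps_nth (of_nat c * H) k = of_nat c * fps_nth H k" for c and H :: "'a fps"
        by (metis fps_mult_left_const_nth fps_of_nat)
      have "fps_nth (\<Sum>m\<in>{1..N}. \<Sum>n\<in>{1..N}. ?V m n) k = (\<Sum>m\<in>{1..N}. \<Sum>n\<in>{1..N}. fps_nth (gh (wc F m) m) k * fps_nth (gh (wc G n) n) k)"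
        by (simp add: fps_sum_nth n gh_wfac)
      then show "fps_nth (\<Sum>m\<in>{1..N}. \<Sum>n\<in>{1..N}. ?V m n) k = fps_nth ?W k"
        using k by (simp add: GH_nth sum_product)
    qed
    ultimately show "dlN N ?W (wm F G)"
      by (rule dlN_cong) (simp add: feq_def wm_nth)
  qed
  then have "GH (wm F G) = ?W" by (intro GH_unique wm_0)
  then show ?thesis by simp
qed

definition torsion_free :: "'b::comm_ring_1 itself \<Rightarrow> bool" where
  "torsion_free _ \<longleftrightarrow> (\<forall>n (c::'b). n > 0 \<longrightarrow> of_nat n * c = 0 \<longrightarrow> c = 0)"

lemma GH_inj: 
  fixes F :: "'b::comm_ring_1 fps"
  assumes "torsion_free TYPE('b)" "fps_nth F 0 = 1" "fps_nth G 0 = 1" "GH F = GH G"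
  shows "F = G"
proof -
  have "fps_nth F k = fps_nth G k" for k
  proof (induction k rule: less_induct)
    case (less k)
    have s: "(\<Sum>i<k. fps_nth (GH F) i * fps_nth F (k - i)) = (\<Sum>i<k. fps_nth (GH G) i * fps_nth G (k - i))"
    proof (intro sum.cong refl)
      fix i assume "i \<in> {..<k}"
      then show "fps_nth (GH F) i * fps_nth F (k - i) = fps_nth (GH G) i * fps_nth G (k - i)"
        using less[of "k - i"] assms by (cases "i = 0") (auto simp: GH_0)
    qed
    have "dlN k (GH F) F" "dlN k (GH G) G" using GH_dl assms(2,3) by (auto intro: dlN_I)
    from dlN_nth[OF this(1) assms(2), of k] dlN_nth[OF this(2) assms(3), of k] s assms(4)
    have "of_nat k * (fps_nth F k - fps_nth G k) = 0" by (simp add: algebra_simps)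
    then have "k > 0 \<Longrightarrow> fps_nth F k - fps_nth G k = 0"
      using assms(1) unfolding torsion_free_def by blast
    then show ?case using assms(2,3) by (cases "k = 0") auto
  qed
  then show ?thesis by (simp add: fps_eq_iff)
qed

lemma wm_laws:
  fixes F :: "'b::comm_ring_1 fps" and a b :: 'b
  assumes "torsion_free TYPE('b)" "fps_nth F 0 = 1" "fps_nth G 0 = 1" "fps_nth H 0 = 1"
  shows "wm F G = wm G F" "wm (wm F G) H = wm F (wm G H)" "wm (F * G) H = wm F H * wm G H"
    "wm (om 1 1) F = F" "wm (om a 1) (om b 1) = om (a * b) 1"
proof -
  note i = GH_inj[OF assms(1)]
  note * = assms wm_0 om_nth fps_eq_iff GH_wm GH_mult GH_om
  show "wm F G = wm G F" by (rule i) (simp_all add: * mult.commute)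
  show "wm (wm F G) H = wm F (wm G H)" by (rule i) (simp_all add: * mult.assoc)
  show "wm (F * G) H = wm F H * wm G H" by (rule i) (simp_all add: * distrib_right)
  show "wm (om 1 1) F = F" by (rule i) (simp_all add: * gh_def GH_0)
  show "wm (om a 1) (om b 1) = om (a * b) 1"
    by (rule i) (simp_all add: * gh_def power_mult_distrib)
qed

definition univ_ring :: "'b::comm_ring_1 ring" where
  "univ_ring = \<lparr>carrier = UNIV, mult = (*), one = 1, zero = 0, add = (+)\<rparr>"

lemma univ_simps [simp]: "carrier univ_ring = UNIV" "x \<otimes>\<^bsub>univ_ring\<^esub> y = x * y" 
  "x \<oplus>\<^bsub>univ_ring\<^esub> y = x + y" "\<one>\<^bsub>univ_ring\<^esub> = 1" "\<zero>\<^bsub>univ_ring\<^esub> = 0"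
  by (simp_all add: univ_ring_def)

lemma univ_cring: "cring univ_ring"
  by (auto intro!: cringI abelian_groupI comm_monoidI simp: algebra_simps intro: exI[of _ "- x" for x])
     (metis add.right_inverse)

interpretation UU: cring "univ_ring" by (rule univ_cring)

interpretation PU: cring "ps_ring univ_ring" by (rule UU.ps_cring)

lemma univ_neg [simp]: "\<ominus>\<^bsub>univ_ring\<^esub> x = - x"
  by (rule UU.minus_equality) auto

lemma univ_minus [simp]: "x \<ominus>\<^bsub>univ_ring\<^esub> y = x - y"
  by (simp add: a_minus_def)

lemma univ_pow [simp]: "x [^]\<^bsub>univ_ring\<^esub> (n::nat) = x ^ n"
  by (induction n) (auto simp: mult.commute)

lemma univ_sum: "finsum univ_ring f A = sum f A"
  by (induction A rule: infinite_finite_induct) (auto simp: UU.finsum_infinite UU.finsum_insert)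

lemma nth_carrier [simp]: "f \<in> carrier (ps_ring univ_ring)"
  by (simp add: ps_simps)

lemma nth_mult: "fps_nth F \<otimes>\<^bsub>ps_ring univ_ring\<^esub> fps_nth G = fps_nth (F * G)"
  by (auto simp: fun_eq_iff ps_simps univ_sum fps_mult_nth atLeast0AtMost)

lemma nth_one: "\<one>\<^bsub>ps_ring univ_ring\<^esub> = fps_nth 1"
  by (auto simp: fun_eq_iff ps_simps)

lemma nth_pow: "fps_nth F [^]\<^bsub>ps_ring univ_ring\<^esub> (n::nat) = fps_nth (F ^ n)"
  by (induction n) (auto simp: nth_one nth_mult mult.commute)

lemma nth_prod: "finprod (ps_ring univ_ring) (\<lambda>i. fps_nth (P i)) A = fps_nth (prod P A)"
  by (induction A rule: infinite_finite_induct) (auto simp: nth_one nth_mult)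

lemma nth_one_minus: "n \<ge> 1 \<Longrightarrow> one_minus univ_ring a n = fps_nth (om a n)"
  by (auto simp: fun_eq_iff one_minus_def om_nth)

lemma nth_partial: "witt_partial univ_ring (fps_nth F) n = fps_nth (wp F n)"
  by (induction n) (simp_all add: nth_one nth_mult nth_one_minus)

lemma nth_coord: "witt_coord univ_ring (fps_nth F) n = wc F n"
  by (simp add: witt_coord_def wc_def nth_partial)

lemma nth_factor: "m \<ge> 1 \<Longrightarrow> n \<ge> 1 \<Longrightarrow> witt_factor univ_ring a m b n = fps_nth (wfac a m b n)"
  by (simp add: witt_factor_def wfac_def nth_one_minus nth_pow Suc_leI lcm_pos_nat)

lemma nth_witt_mult: "witt_mult univ_ring (fps_nth F) (fps_nth G) = fps_nth (wm F G)"
proof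
  fix N
  have "(\<Otimes>\<^bsub>ps_ring univ_ring\<^esub>m\<in>{1..N}. \<Otimes>\<^bsub>ps_ring univ_ring\<^esub>n\<in>{1..N}. witt_factor univ_ring (wc F m) m (wc G n) n)
     = (\<Otimes>\<^bsub>ps_ring univ_ring\<^esub>m\<in>{1..N}. fps_nth (\<Prod>n\<in>{1..N}. wfac (wc F m) m (wc G n) n))"
    unfolding nth_prod[symmetric]
    by (intro PU.finprod_cong' refl) (auto simp: nth_factor Pi_def simp del: nth_prod)
  then show "witt_mult univ_ring (fps_nth F) (fps_nth G) N = fps_nth (wm F G) N"
    by (simp add: witt_mult_def wm_def nth_coord nth_prod)
qed

text \<open>Every commutative ring is a quotient of a polynomial ring over the integers, which is
  torsion-free; this transfers the ring laws to arbitrary commutative rings.\<close>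

type_synonym 'a zpoly = "'a multiset \<Rightarrow>\<^sub>0 int"

lemma lookup_of_nat_mult: "Poly_Mapping.lookup (of_nat n * (c :: 'a zpoly)) k = int n * Poly_Mapping.lookup c k"
  by (induction n) (auto simp: distrib_right lookup_add)

lemma zpoly_torsion_free: "torsion_free TYPE('a zpoly)"
  unfolding torsion_free_def
proof (intro allI impI)
  fix n and c :: "'a zpoly" assume "n > 0" "of_nat n * c = 0"
  then have "int n * Poly_Mapping.lookup c k = 0" for k using lookup_of_nat_mult[of n c k] by simp
  then show "c = 0" using \<open>n > 0\<close> by (intro poly_mapping_eqI) simp
qed

lemma zpoly_induct:
  fixes p :: "'a zpoly"
  assumes "P 0" "\<And>p m c. P p \<Longrightarrow> P (p + Poly_Mapping.single m c)" 
  shows "P p"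
proof (induction p rule: update_induct)
  case const
  show ?case by (rule assms(1))
next
  case (update f a b)
  have "Poly_Mapping.update a b f = f + Poly_Mapping.single a b"
    using update by (intro poly_mapping_eqI) (auto simp: lookup_update lookup_add lookup_single in_keys_iff when_def)
  then show ?case using assms(2) update by simp
qed

context cring begin

definition mon :: "'a multiset \<Rightarrow> 'a" where
  "mon m = fold_mset (\<lambda>x y. if x \<in> carrier R \<and> y \<in> carrier R then x \<otimes> y else y) \<one> m"

lemma mon_comm: "comp_fun_commute (\<lambda>x y. if x \<in> carrier R \<and> y \<in> carrier R then x \<otimes> y else y)"
  by unfold_locales (auto simp: fun_eq_iff m_lcomm)

lemma mon_add: "mon (add_mset x m) = (if x \<in> carrier R \<and> mon m \<in> carrier R then x \<otimes> mon m else mon m)"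
  unfolding mon_def by (rule comp_fun_commute.fold_mset_add_mset[OF mon_comm])

lemma mon_empty: "mon {#} = \<one>" by (simp add: mon_def)

lemma mon_closed [simp]: "mon m \<in> carrier R"
  by (induction m) (auto simp: mon_add mon_empty)

lemma mon_union: "mon (m + n) = mon m \<otimes> mon n"
  by (induction m) (auto simp: mon_add mon_empty m_assoc)

definition ev :: "'a zpoly \<Rightarrow> 'a" where
  "ev p = (\<Oplus>m\<in>Poly_Mapping.keys p. [Poly_Mapping.lookup p m] \<cdot> mon m)"

lemma ev_superset: "finite S \<Longrightarrow> Poly_Mapping.keys p \<subseteq> S \<Longrightarrow> ev p = (\<Oplus>m\<in>S. [Poly_Mapping.lookup p m] \<cdot> mon m)"
  unfolding ev_def
  by (intro add.finprod_mono_neutral_cong_left) (auto simp: in_keys_iff add_pow_int_ge)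

lemma ev_closed [simp]: "ev p \<in> carrier R"
  unfolding ev_def by (auto intro!: finsum_closed)

lemma ev_add: "ev (p + q) = ev p \<oplus> ev q"
proof -
  let ?S = "Poly_Mapping.keys p \<union> Poly_Mapping.keys q"
  have "ev (p + q) = (\<Oplus>m\<in>?S. [Poly_Mapping.lookup p m] \<cdot> mon m \<oplus> [Poly_Mapping.lookup q m] \<cdot> mon m)"
    using ev_superset[of ?S "p + q"] Poly_Mapping.keys_add[of p q]
    by (simp add: lookup_add add.int_pow_mult)
  also have "\<dots> = ev p \<oplus> ev q"
    using ev_superset[of ?S p] ev_superset[of ?S q] by (simp add: finsum_addf Pi_def)
  finally show ?thesis .
qed

lemma ev_0: "ev 0 = \<zero>" by (simp add: ev_def)

lemma ev_single: "ev (Poly_Mapping.single m c) = [c] \<cdot> mon m"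
  using ev_superset[of "{m}" "Poly_Mapping.single m c"] by (simp add: finsum_insert finsum_empty)

lemma ev_mult_single: "ev (p * Poly_Mapping.single n d) = ev p \<otimes> ([d] \<cdot> mon n)"
proof (induction p rule: zpoly_induct)
  case (2 p m c)
  have "[(c * d)] \<cdot> (mon m \<otimes> mon n) = ([c] \<cdot> mon m) \<otimes> ([d] \<cdot> mon n)"
    by (simp add: add_pow_ldistr_int add_pow_rdistr_int add.int_pow_pow)
  then show ?case using 2
    by (simp add: distrib_right ev_add mult_single ev_single mon_union l_distr)
qed (simp add: ev_0)

lemma ev_mult: "ev (p * q) = ev p \<otimes> ev q"
  by (induction q rule: zpoly_induct) (simp_all add: ev_0 distrib_left ev_add ev_mult_single ev_single r_distr)

lemma ev_one: "ev 1 = \<one>"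
  using ev_single[of "{#}" 1] by (simp add: mon_empty flip: single_one)

lemma ev_var: "a \<in> carrier R \<Longrightarrow> ev (Poly_Mapping.single {#a#} 1) = a"
  by (simp add: ev_single mon_add mon_empty)

lemma ev_hom: "ring_hom_cring univ_ring R ev"
  by (intro ring_hom_cringI ring_hom_ringI2 ring_hom_memI)
     (auto simp: univ_cring is_cring ev_add ev_mult ev_one intro: UU.ring_axioms ring_axioms)

definition push :: "'a zpoly fps \<Rightarrow> nat \<Rightarrow> 'a" where
  "push F = ev \<circ> fps_nth F"

lemma push_mult: "push (F * G) = push F \<otimes>\<^bsub>ps_ring R\<^esub> push G"
  using ring_hom_mult[OF ring_hom_cring.ps_hom[OF ev_hom], of "fps_nth F" "fps_nth G"]
  by (simp add: push_def nth_mult)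

lemma push_wm: "push (wm F G) = witt_mult R (push F) (push G)"
  using ring_hom_cring.hom_witt_mult[OF ev_hom, of "fps_nth F" "fps_nth G"]
  by (simp add: push_def nth_witt_mult)

lemma push_om: "push (om a 1) = one_minus R (ev a) 1"
  using ring_hom_cring.hom_one_minus[OF ev_hom, of a 1]
  by (simp add: push_def nth_one_minus)

lemma push_1: "push 1 = \<one>\<^bsub>ps_ring R\<^esub>"
  using ring_hom_one[OF ring_hom_cring.ps_hom[OF ev_hom]]
  by (simp add: push_def nth_one)

lemma push_closed: "fps_nth F 0 = 1 \<Longrightarrow> push F \<in> witt_set R"
  by (simp add: push_def witt_set_def ps_simps ev_one)

lemma push_surj: assumes "f \<in> witt_set R" 
  obtains F where "fps_nth F 0 = 1" "f = push F"
proof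
  let ?F = "Abs_fps (\<lambda>n. if n = 0 then 1 else Poly_Mapping.single {#f n#} 1)"
  show "fps_nth ?F 0 = 1" by simp
  show "f = push ?F" using assms by (auto simp: push_def fun_eq_iff witt_set_def ps_simps ev_one ev_var)
qed

theorem witt_ring_cring: "cring (witt_ring R)"
proof -
  interpret P: cring "ps_ring R" by (rule ps_cring)
  note laws = wm_laws[OF zpoly_torsion_free]
  have c: "x \<in> witt_set R \<Longrightarrow> x \<in> carrier (ps_ring R)" for x by (simp add: witt_set_def)
  have pc: "x \<in> witt_set R \<Longrightarrow> y \<in> witt_set R \<Longrightarrow> x \<otimes>\<^bsub>ps_ring R\<^esub> y \<in> witt_set R" for x y
    by (auto simp: witt_set_def) (auto simp: ps_simps)
  have W: "carrier (witt_ring R) = witt_set R" "x \<otimes>\<^bsub>witt_ring R\<^esub> y = witt_mult R x y"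
    "x \<oplus>\<^bsub>witt_ring R\<^esub> y = x \<otimes>\<^bsub>ps_ring R\<^esub> y" "\<one>\<^bsub>witt_ring R\<^esub> = one_minus R \<one> 1"
    "\<zero>\<^bsub>witt_ring R\<^esub> = \<one>\<^bsub>ps_ring R\<^esub>" for x y
    by (simp_all add: witt_ring_def)
  have o: "one_minus R \<one> 1 = push (om 1 1)" by (simp only: push_om ev_one)
  show ?thesis
  proof (rule cringI)
    show "abelian_group (witt_ring R)"
    proof (rule abelian_groupI)
      fix x assume "x \<in> carrier (witt_ring R)"
      then obtain F where F: "fps_nth F 0 = 1" "x = push F" using push_surj W by metis
      let ?G = "fps_left_inverse F 1"
      have "?G * F = 1" using F by (intro fps_left_inverse) simp
      moreover have "fps_nth ?G 0 = 1" by simp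
      ultimately show "\<exists>y\<in>carrier (witt_ring R). y \<oplus>\<^bsub>witt_ring R\<^esub> x = \<zero>\<^bsub>witt_ring R\<^esub>"
        using F push_closed[of ?G] by (intro bexI[of _ "push ?G"]) (auto simp: W push_1 simp flip: push_mult)
    qed (auto simp: W c pc P.m_ac, simp add: witt_set_def ps_simps)
    show "comm_monoid (witt_ring R)"
    proof (rule comm_monoidI)
      show "\<one>\<^bsub>witt_ring R\<^esub> \<in> carrier (witt_ring R)"
        by (simp add: W witt_set_def one_minus_closed) (simp add: one_minus_def)
      fix x y assume xy: "x \<in> carrier (witt_ring R)" "y \<in> carrier (witt_ring R)"
      then show "x \<otimes>\<^bsub>witt_ring R\<^esub> y \<in> carrier (witt_ring R)"
        by (simp add: W witt_mult_closed c)
      from xy obtain F G where F: "fps_nth F 0 = 1" "x = push F" "fps_nth G 0 = 1" "y = push G"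
        using push_surj W by metis
      show "x \<otimes>\<^bsub>witt_ring R\<^esub> y = y \<otimes>\<^bsub>witt_ring R\<^esub> x"
        using F by (simp add: W laws(1) flip: push_wm)
      fix z assume "z \<in> carrier (witt_ring R)"
      then obtain H where H: "fps_nth H 0 = 1" "z = push H" using push_surj W by metis
      show "(x \<otimes>\<^bsub>witt_ring R\<^esub> y) \<otimes>\<^bsub>witt_ring R\<^esub> z = x \<otimes>\<^bsub>witt_ring R\<^esub> (y \<otimes>\<^bsub>witt_ring R\<^esub> z)"
        using F H by (simp add: W laws(2) flip: push_wm)
    next
      fix x assume "x \<in> carrier (witt_ring R)"
      then obtain F where F: "fps_nth F 0 = 1" "x = push F" using push_surj W by metis
      show "\<one>\<^bsub>witt_ring R\<^esub> \<otimes>\<^bsub>witt_ring R\<^esub> x = x"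
        using F laws(4)[of F F F] unfolding W o by (simp flip: push_wm)
    qed
  next
    fix x y z assume "x \<in> carrier (witt_ring R)" "y \<in> carrier (witt_ring R)" "z \<in> carrier (witt_ring R)"
    then obtain F G H where F: "fps_nth F 0 = 1" "x = push F" "fps_nth G 0 = 1" "y = push G"
         "fps_nth H 0 = 1" "z = push H"
      using push_surj W by metis
    show "(x \<oplus>\<^bsub>witt_ring R\<^esub> y) \<otimes>\<^bsub>witt_ring R\<^esub> z = x \<otimes>\<^bsub>witt_ring R\<^esub> z \<oplus>\<^bsub>witt_ring R\<^esub> y \<otimes>\<^bsub>witt_ring R\<^esub> z"
      using F by (simp add: W laws(3) flip: push_wm push_mult)
  qed
qed

theorem witt_mult_linear:
  assumes "a \<in> carrier R" "b \<in> carrier R"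
  shows "witt_mult R (one_minus R a 1) (one_minus R b 1) = one_minus R (a \<otimes> b) 1"
proof -
  let ?a = "Poly_Mapping.single {#a#} 1 :: 'a zpoly" and ?b = "Poly_Mapping.single {#b#} 1 :: 'a zpoly"
  have "witt_mult R (push (om ?a 1)) (push (om ?b 1)) = push (om (?a * ?b) 1)"
    using wm_laws(5)[OF zpoly_torsion_free, of 1 1 1 ?a ?b] by (simp flip: push_wm)
  then show ?thesis using assms unfolding push_om by (simp add: ev_var ev_mult)
qed

text \<open>A sharp form of \<open>T\<close>-adic continuity: the coefficient of \<open>T\<^sup>N\<close> depends only on
  the factors modulo \<open>T\<^sup>N\<^sup>+\<^sup>1\<close>.\<close>

theorem witt_mult_continuous:
  assumes "f \<in> carrier (ps_ring R)" "f' \<in> carrier (ps_ring R)" "\<And>k. k \<le> N \<Longrightarrow> f k = f' k"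
    and "g \<in> carrier (ps_ring R)" "g' \<in> carrier (ps_ring R)" "\<And>k. k \<le> N \<Longrightarrow> g k = g' k"
  shows "witt_mult R f g N = witt_mult R f' g' N"
proof -
  interpret P: cring "ps_ring R" by (rule ps_cring)
  have p: "witt_partial R f n = witt_partial R f' n" if "\<And>k. k \<le> n \<Longrightarrow> f k = f' k" for f f' n
    using that by (induction n) auto
  have q: "witt_coord R f n = witt_coord R f' n" if "\<And>k. k \<le> n \<Longrightarrow> f k = f' k" for f f' n
    using p[of "n - 1" f f'] that by (simp add: witt_coord_def)
  have e: "m \<in> {1..N} \<Longrightarrow> witt_coord R f m = witt_coord R f' m"
      "m \<in> {1..N} \<Longrightarrow> witt_coord R g m = witt_coord R g' m" for m
    using assms by (auto intro!: q)
  have "(\<Otimes>\<^bsub>ps_ring R\<^esub>m\<in>{1..N}. \<Otimes>\<^bsub>ps_ring R\<^esub>n\<in>{1..N}. witt_factor R (witt_coord R f m) m (witt_coord R g n) n)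
    = (\<Otimes>\<^bsub>ps_ring R\<^esub>m\<in>{1..N}. \<Otimes>\<^bsub>ps_ring R\<^esub>n\<in>{1..N}. witt_factor R (witt_coord R f' m) m (witt_coord R g' n) n)"
    by (intro P.finprod_cong' refl Pi_I P.finprod_closed witt_factor_closed witt_coord_closed assms)
       (simp only: e)
  then show ?thesis by (simp add: witt_mult_def)
qed

end

end

theory Submission
  imports Defs
    "HOL-Library.Multiset_Order"
    "HOL-Computational_Algebra.Fraction_Field"
    "HOL-Computational_Algebra.Polynomial_FPS"
    "HOL-Algebra.Algebraic_Closure_Type"
    "Jordan_Normal_Form.Determinant"
begin

text \<open>
  For a domain \<open>R\<close>, the order of recurrence of a power series \<open>f\<close> is the smallest degree \<open>d\<close> of a
  nonzero denominator. It can be read off from the minors of the Hankel matrix, hence does not change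
  under injective homomorphisms, and a denominator of degree at most \<open>d\<close> with constant term 1 is
  unique. On an integral scheme all restrictions to nonempty open subsets are injective. If \<open>f\<close> lies in
  \<open>W\<^sub>J(O(U))\<close>, its restriction to an affine open \<open>V\<close> is rational over the fraction field of
  \<open>O(V)\<close>, and by the strong Fatou property it has such a denominator over \<open>O(V)\<close>. By uniqueness these
  denominators glue coefficientwise, so \<open>f\<close> is rational over \<open>O(U)\<close>. Thus \<open>W\<^sub>r\<^sub>a\<^sub>t = W\<^sub>J\<close>,
  and gluing of rational sections is immediate because the vanishing of the minors can be tested on a
  single nonempty open subset.

  That rational series are closed under the Witt product is checked universally, in characteristic 0,
  where the polynomials split into linear factors over an algebraically closed field.
\<close>

text \<open>The notation would otherwise capture the variable \<open>X\<close> of the theorem.\<close>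
no_notation Polynomials.var ("X\<index>")

section \<open>Witt products of polynomials\<close>

text \<open>The strong Fatou hypothesis speaks about affine open sets only, while \<open>U\<close>
  and the overlaps of a cover need not be affine. Minimality of the degree bridges this: the same
  \<open>d\<close> is the order of recurrence over \<open>U\<close>, over every member of an affine
  cover, over its fraction field and over every nonempty overlap. So one degree bound serves an
  infinite cover, and uniqueness applies on overlaps about which nothing else is known. A minimal
  denominator over a field is moreover automatically reduced, which is the form in which the strong
  Fatou property can be applied.

  For this, affine open sets must be shown to form a base, which amounts to identifying
  \<open>basic_open A g\<close> with the spectrum of its own ring of sections. Determinants in
  carrier rings are handled by substituting one indeterminate for each ring element, so that
  identities can be proved in the type class setting.\<close>

lemma wm_one_left:
  fixes H :: "'b::idom fps"
  assumes "torsion_free TYPE('b)" "fps_nth H 0 = 1"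
  shows "wm 1 H = 1"
proof -
  \<comment> \<open>The series \<open>1\<close> is the zero of the Witt ring, so this is the usual
    \<open>0 h + 0 h = 0 h\<close>, followed by cancellation in the domain of power series.\<close>
  have "wm 1 H * wm 1 H = wm 1 H * 1"
    using wm_laws(3)[OF assms(1), of 1 1 H] assms(2) by simp
  moreover have "wm 1 H \<noteq> 0"
    using wm_0[of 1 H] by auto
  ultimately show ?thesis by (metis mult_left_cancel)
qed

lemma prod_mset_nth_0:
  "(\<And>a. a \<in># A \<Longrightarrow> fps_nth (f a) 0 = 1) \<Longrightarrow> fps_nth (\<Prod>a\<in>#A. f a) 0 = (1::'b::comm_ring_1)"
  by (induction A) auto

lemma wm_prod_mset:
  fixes H :: "'b::idom fps"
  assumes "torsion_free TYPE('b)" "fps_nth H 0 = 1" "\<And>a. a \<in># A \<Longrightarrow> fps_nth (f a) 0 = 1"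
  shows "wm (\<Prod>a\<in>#A. f a) H = (\<Prod>a\<in>#A. wm (f a) H)"
  using assms(3)
proof (induction A)
  case empty
  then show ?case by (simp add: wm_one_left[OF assms(1,2)])
next
  case (add x A)
  then show ?case
    using wm_laws(3)[OF assms(1), of "f x" "\<Prod>a\<in>#A. f a" H] assms(2)
    by (simp add: prod_mset_nth_0)
qed

text \<open>By biadditivity and the rule for linear factors, the Witt product multiplies the
  reciprocal roots pairwise. In particular the product of two such polynomials is again a
  polynomial.\<close>

lemma wm_split:
  fixes A B :: "'b::idom multiset"
  assumes "torsion_free TYPE('b)"
  shows "wm (\<Prod>a\<in>#A. om a 1) (\<Prod>b\<in>#B. om b 1) = (\<Prod>a\<in>#A. \<Prod>b\<in>#B. om (a * b) 1)"
proof -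
  have "wm (om a 1) (\<Prod>b\<in>#B. om b 1) = (\<Prod>b\<in>#B. om (a * b) 1)" for a
  proof -
    have "wm (om a 1) (\<Prod>b\<in>#B. om b 1) = wm (\<Prod>b\<in>#B. om b 1) (om a 1)"
      by (rule wm_laws(1)[OF assms, where H = 1]) (auto simp: prod_mset_nth_0 om_nth)
    also have "\<dots> = (\<Prod>b\<in>#B. wm (om b 1) (om a 1))"
      by (rule wm_prod_mset[OF assms]) (auto simp: om_nth)
    also have "\<dots> = (\<Prod>b\<in>#B. om (a * b) 1)"
      by (simp add: wm_laws(5)[OF assms, of 1 1 1] mult.commute del: One_nat_def)
    finally show ?thesis .
  qed
  moreover have "wm (\<Prod>a\<in>#A. om a 1) (\<Prod>b\<in>#B. om b 1) = (\<Prod>a\<in>#A. wm (om a 1) (\<Prod>b\<in>#B. om b 1))"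
    by (rule wm_prod_mset[OF assms]) (auto simp: om_nth prod_mset_nth_0)
  ultimately show ?thesis by simp
qed

text \<open>A root \<open>x\<close> splits off the factor \<open>T - x\<close>; moving the constant
  \<open>- x\<close> into the cofactor turns it into \<open>1 - T / x\<close>. The constant term 1
  excludes \<open>x = 0\<close> and is passed on to the cofactor.\<close>

lemma alg_closed_reciprocal_split:
  fixes p :: "'b::alg_closed_field poly"
  assumes "coeff p 0 = 1"
  shows "\<exists>A. p = (\<Prod>a\<in>#A. [:1, - a:])"
  using assms
proof (induction "degree p" arbitrary: p rule: less_induct)
  case less
  show ?case
  proof (cases "degree p = 0")
    case True
    then obtain c where "p = [:c:]" by (rule degree_eq_zeroE)
    with less.prems have "p = 1" by (simp add: one_pCons)
    then show ?thesis by (intro exI[of _ "{#}"]) simp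
  next
    case False
    then obtain x where x: "poly p x = 0"
      using alg_closed_imp_poly_has_root by blast
    then obtain q where q: "p = [:-x, 1:] * q"
      using poly_eq_0_iff_dvd by (metis dvdE)
    define r where "r = smult (- x) q"
    have xq: "- x * coeff q 0 = 1" using less.prems by (simp add: q)
    then have "x \<noteq> 0" "q \<noteq> 0" by auto
    have p: "p = [:1, - (1 / x):] * r"
      using \<open>x \<noteq> 0\<close> by (simp add: q r_def smult_add_right)
    have "degree p = Suc (degree q)"
      using \<open>q \<noteq> 0\<close> by (subst q, subst degree_mult_eq) auto
    then have "degree r < degree p" by (simp add: r_def)
    then obtain A where "r = (\<Prod>a\<in>#A. [:1, - a:])"
      using less.hyps[of r] xq by (auto simp: r_def)
    then have "p = (\<Prod>a\<in>#add_mset (1 / x) A. [:1, - a:])" by (simp add: p)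
    then show ?thesis ..
  qed
qed

text \<open>Polynomials as power series, described through coefficients: this form passes back and
  forth along an injective map of coefficients.\<close>

definition fps_finite :: "'b::zero fps \<Rightarrow> bool" where
  "fps_finite F \<longleftrightarrow> (\<exists>n. \<forall>k>n. fps_nth F k = 0)"

lemma fps_finite_iff: "fps_finite F \<longleftrightarrow> (\<exists>p. F = fps_of_poly p)"
proof
  assume "fps_finite F"
  then obtain n where "\<forall>k>n. fps_nth F k = 0" by (auto simp: fps_finite_def)
  then have "coeff (Abs_poly (fps_nth F)) = fps_nth F"
    by (intro Abs_poly_inverse) (auto simp: MOST_nat)
  then have "F = fps_of_poly (Abs_poly (fps_nth F))"
    by (simp add: fps_eq_iff)
  then show "\<exists>p. F = fps_of_poly p" ..
next
  assume "\<exists>p. F = fps_of_poly p"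
  then show "fps_finite F"
    using coeff_eq_0 by (fastforce simp: fps_finite_def)
qed

lemma om_fps_of_poly: "om a 1 = fps_of_poly [:1, - a:]"
  by (auto simp: fps_eq_iff om_nth coeff_pCons split: nat.splits)

lemma fps_of_poly_prod_mset: "fps_of_poly (\<Prod>a\<in>#A. f a) = (\<Prod>a\<in>#A. fps_of_poly (f a))"
  by (induction A) (auto simp: fps_of_poly_mult)

lemma wm_finite_alg_closed:
  fixes F G :: "'b::alg_closed_field fps"
  assumes "torsion_free TYPE('b)" "fps_nth F 0 = 1" "fps_nth G 0 = 1" "fps_finite F" "fps_finite G"
  shows "fps_finite (wm F G)"
proof -
  have *: "\<exists>A. F = (\<Prod>a\<in>#A. om a 1)" if F: "fps_nth F 0 = 1" "fps_finite F" for F :: "'b fps"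
  proof -
    obtain p where p: "F = fps_of_poly p" using \<open>fps_finite F\<close> fps_finite_iff by blast
    then obtain A where "p = (\<Prod>a\<in>#A. [:1, - a:])"
      using alg_closed_reciprocal_split[of p] F(1) by auto
    then show ?thesis using p by (auto simp: fps_of_poly_prod_mset om_fps_of_poly simp del: One_nat_def)
  qed
  from *[OF assms(2,4)] *[OF assms(3,5)] obtain A B
    where AB: "F = (\<Prod>a\<in>#A. om a 1)" "G = (\<Prod>a\<in>#B. om a 1)" by blast
  have "wm F G = fps_of_poly (\<Prod>a\<in>#A. \<Prod>b\<in>#B. [:1, - (a * b):])"
    unfolding AB wm_split[OF assms(1)] by (simp only: fps_of_poly_prod_mset om_fps_of_poly)
  then show ?thesis unfolding fps_finite_iff by blast
qed

text \<open>The coefficients embed into the algebraic closure of the fraction field, where both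
  factors split. Functoriality identifies the product there with the image of \<open>wm F G\<close>,
  and injectivity brings finiteness back. Characteristic 0 makes the closure torsion-free, as the
  ghost argument behind \<open>wm_laws\<close> requires.\<close>

lemma wm_finite:
  fixes F G :: "'b::{idom,ring_char_0} fps"
  assumes "fps_nth F 0 = 1" "fps_nth G 0 = 1" "fps_finite F" "fps_finite G"
  shows "fps_finite (wm F G)"
proof -
  define h :: "'b \<Rightarrow> 'b fract alg_closure" where "h x = to_ac (Fract x 1)" for x
  have inj: "h x = h y \<longleftrightarrow> x = y" for x y by (simp add: h_def eq_fract)
  have h: "h (x + y) = h x + h y" "h (x * y) = h x * h y" "h 1 = 1" "h 0 = 0" for x y
    by (simp_all add: h_def One_fract_def flip: to_ac_add to_ac_mult)
       (simp add: Zero_fract_def[symmetric])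
  have "h (of_nat n) = of_nat n" for n
    by (induction n) (auto simp: h)
  then have "of_nat n \<noteq> (0 :: 'b fract alg_closure)" if "n > 0" for n
    using that inj[of "of_nat n" 0] by (simp add: h)
  then have tf: "torsion_free TYPE('b fract alg_closure)" by (auto simp: torsion_free_def)
  interpret H: ring_hom_cring "univ_ring :: 'b ring" "univ_ring" h
    by (intro ring_hom_cringI ring_hom_ringI2 ring_hom_memI)
       (auto simp: h univ_cring cring.axioms(1))
  let ?h = "\<lambda>F. Abs_fps (h \<circ> fps_nth F)"
  have n: "fps_nth (?h F) = h \<circ> fps_nth F" for F by (simp add: fun_eq_iff)
  have "h \<circ> fps_nth (wm F G) = fps_nth (wm (?h F) (?h G))"
    using H.hom_witt_mult[of "fps_nth F" "fps_nth G"] nth_witt_mult[of "?h F" "?h G"]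
    by (simp add: nth_witt_mult n)
  then have *: "h (fps_nth (wm F G) k) = fps_nth (wm (?h F) (?h G)) k" for k
    by (metis comp_apply)
  have "fps_finite (?h F)" if F: "fps_finite F" for F
  proof -
    from F obtain n where "\<And>k. k > n \<Longrightarrow> fps_nth F k = 0" by (auto simp: fps_finite_def)
    then show ?thesis by (auto simp: fps_finite_def h intro!: exI[of _ n])
  qed
  then have "fps_finite (wm (?h F) (?h G))"
    using assms by (intro wm_finite_alg_closed tf) (simp_all add: h)
  then obtain n where "\<And>k. k > n \<Longrightarrow> h (fps_nth (wm F G) k) = h 0"
    by (auto simp: fps_finite_def * h)
  then show ?thesis
    by (auto simp: fps_finite_def inj)
qed

lemma (in cring) up_iff: "p \<in> carrier (UP R) \<longleftrightarrow> (\<forall>n. p n \<in> carrier R) \<and> (\<exists>N. \<forall>n>N. p n = \<zero>)"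
  by (auto simp: UP_def up_def bound_def)

section \<open>Evaluation of integer polynomials at a sequence of ring elements\<close>

context cring begin

text \<open>Like \<open>ev\<close>, but with indeterminates numbered by natural numbers and values
  given by \<open>v\<close>. An index whose value lies outside the carrier is skipped by
  \<open>mon\<close>, so this is a homomorphism for every \<open>v\<close>.\<close>

definition eval_at :: "(nat \<Rightarrow> 'a) \<Rightarrow> nat zpoly \<Rightarrow> 'a" where
  "eval_at v p = (\<Oplus>m\<in>Poly_Mapping.keys p. [Poly_Mapping.lookup p m] \<cdot> mon (image_mset v m))"

lemma eval_at_superset:
  "finite S \<Longrightarrow> Poly_Mapping.keys p \<subseteq> S \<Longrightarrow>
    eval_at v p = (\<Oplus>m\<in>S. [Poly_Mapping.lookup p m] \<cdot> mon (image_mset v m))"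
  unfolding eval_at_def
  by (intro add.finprod_mono_neutral_cong_left) (auto simp: in_keys_iff add_pow_int_ge)

lemma eval_at_closed [simp]: "eval_at v p \<in> carrier R"
  unfolding eval_at_def by (auto intro!: finsum_closed)

lemma eval_at_add: "eval_at v (p + q) = eval_at v p \<oplus> eval_at v q"
proof -
  let ?S = "Poly_Mapping.keys p \<union> Poly_Mapping.keys q"
  have "eval_at v (p + q) = (\<Oplus>m\<in>?S. [Poly_Mapping.lookup p m] \<cdot> mon (image_mset v m)
      \<oplus> [Poly_Mapping.lookup q m] \<cdot> mon (image_mset v m))"
    using eval_at_superset[of ?S "p + q"] Poly_Mapping.keys_add[of p q]
    by (simp add: lookup_add add.int_pow_mult)
  also have "\<dots> = eval_at v p \<oplus> eval_at v q"
    using eval_at_superset[of ?S p] eval_at_superset[of ?S q] by (simp add: finsum_addf Pi_def)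
  finally show ?thesis .
qed

lemma eval_at_0: "eval_at v 0 = \<zero>" by (simp add: eval_at_def)

lemma eval_at_single: "eval_at v (Poly_Mapping.single m c) = [c] \<cdot> mon (image_mset v m)"
  using eval_at_superset[of "{m}" "Poly_Mapping.single m c"] by (simp add: finsum_insert finsum_empty)

lemma eval_at_mult_single:
  "eval_at v (p * Poly_Mapping.single n d) = eval_at v p \<otimes> ([d] \<cdot> mon (image_mset v n))"
proof (induction p rule: zpoly_induct)
  case (2 p m c)
  have "[(c * d)] \<cdot> (mon (image_mset v m) \<otimes> mon (image_mset v n))
      = ([c] \<cdot> mon (image_mset v m)) \<otimes> ([d] \<cdot> mon (image_mset v n))"
    by (simp add: add_pow_ldistr_int add_pow_rdistr_int add.int_pow_pow)
  then show ?case using 2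
    by (simp add: distrib_right eval_at_add mult_single eval_at_single mon_union l_distr)
qed (simp add: eval_at_0)

lemma eval_at_mult: "eval_at v (p * q) = eval_at v p \<otimes> eval_at v q"
  by (induction q rule: zpoly_induct)
     (simp_all add: eval_at_0 distrib_left eval_at_add eval_at_mult_single eval_at_single r_distr)

lemma eval_at_one: "eval_at v 1 = \<one>"
  using eval_at_single[of v "{#}" 1] by (simp add: mon_empty flip: single_one)

lemma eval_at_var: "v i \<in> carrier R \<Longrightarrow> eval_at v (Poly_Mapping.single {#i#} 1) = v i"
  by (simp add: eval_at_single mon_add mon_empty)

lemma eval_at_hom: "ring_hom_cring univ_ring R (eval_at v)"
  by (intro ring_hom_cringI ring_hom_ringI2 ring_hom_memI)
     (auto simp: univ_cring is_cring eval_at_add eval_at_mult eval_at_one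
       intro: UU.ring_axioms ring_axioms)

text \<open>Finitely many indeterminates suffice for two polynomials; indexing them by a linearly
  ordered type makes the ring of universal coefficients an instance of \<^class>\<open>idom\<close>.\<close>

lemma witt_mult_poly:
  assumes "p \<in> carrier (UP R)" "q \<in> carrier (UP R)" "p 0 = \<one>" "q 0 = \<one>"
  shows "witt_mult R p q \<in> carrier (UP R)"
proof -
  \<comment> \<open>Interleaves both coefficient sequences in one assignment: even indices belong to
    \<open>p\<close>, odd ones to \<open>q\<close>.\<close>
  define v where "v k = (if even k then p (k div 2) else q (k div 2))" for k
  \<comment> \<open>Vanishing coefficients are lifted to 0 and not to an indeterminate, which keeps
    the lift a polynomial; the constant term is lifted to 1.\<close>
  define lift :: "(nat \<Rightarrow> 'a) \<Rightarrow> nat \<Rightarrow> nat zpoly fps" where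
    "lift f c = Abs_fps (\<lambda>n. if n = 0 then 1 else if f n = \<zero> then 0 else
       Poly_Mapping.single {#2 * n + c#} 1)" for f c
  have lift: "fps_finite (lift f c)" "fps_nth (lift f c) 0 = 1" if "f \<in> carrier (UP R)" for f c
    using that by (auto simp: lift_def fps_finite_def up_iff)
  have f: "p n \<in> carrier R" "q n \<in> carrier R" "v n \<in> carrier R" for n
    using assms by (auto simp: up_iff v_def)
  have e: "eval_at v \<circ> fps_nth (lift p 0) = p" "eval_at v \<circ> fps_nth (lift q 1) = q"
    using assms(3,4) f
    by (auto simp: lift_def fun_eq_iff eval_at_one eval_at_0 eval_at_var v_def)
  have "fps_finite (wm (lift p 0) (lift q 1))"
    using assms by (intro wm_finite lift)
  then obtain N where N: "\<And>k. k > N \<Longrightarrow> fps_nth (wm (lift p 0) (lift q 1)) k = 0"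
    by (auto simp: fps_finite_def)
  have "witt_mult R p q = eval_at v \<circ> fps_nth (wm (lift p 0) (lift q 1))"
    using ring_hom_cring.hom_witt_mult[OF eval_at_hom, of "fps_nth (lift p 0)" "fps_nth (lift q 1)" v]
    by (simp add: nth_witt_mult e del: One_nat_def)
  then show ?thesis using N by (auto simp: up_iff eval_at_0 intro!: exI[of _ N])
qed

end

section \<open>The subring of rational elements\<close>

context cring begin

text \<open>With \<open>p = x + q\<close> and \<open>p' = y + q'\<close> this is
  \<open>(p - q) (p' - q') + (p q' + q p') = p p' + q q'\<close>, which exhibits a product of
  differences as a difference. It is applied in the Witt ring.\<close>

lemma minus_mult_minus:
  assumes "x \<in> carrier R" "y \<in> carrier R" "q \<in> carrier R" "q' \<in> carrier R"
  shows "x \<otimes> y \<oplus> ((x \<oplus> q) \<otimes> q' \<oplus> q \<otimes> (y \<oplus> q')) = (x \<oplus> q) \<otimes> (y \<oplus> q') \<oplus> q \<otimes> q'"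
  using assms by algebra

lemma carrier_UP_ps: "p \<in> carrier (UP R) \<Longrightarrow> p \<in> carrier (ps_ring R)"
  by (auto simp: up_iff ps_simps)

lemma UP_ps_mult:
  assumes "p \<in> carrier (UP R)" "q \<in> carrier (UP R)"
  shows "p \<otimes>\<^bsub>ps_ring R\<^esub> q \<in> carrier (UP R)"
proof -
  have "p \<in> up R" "q \<in> up R" using assms by (simp_all add: UP_def)
  then have "p \<otimes>\<^bsub>UP R\<^esub> q = p \<otimes>\<^bsub>ps_ring R\<^esub> q" by (rule UP_mult)
  moreover have "p \<otimes>\<^bsub>UP R\<^esub> q \<in> carrier (UP R)"
    using UP_ring.UP_mult_closed[of R p q] assms by (simp add: UP_ring_def ring_axioms)
  ultimately show ?thesis by simp
qed

lemma ps_mult_0: "f \<in> carrier (ps_ring R) \<Longrightarrow> g \<in> carrier (ps_ring R) \<Longrightarrow>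
    (f \<otimes>\<^bsub>ps_ring R\<^esub> g) 0 = f 0 \<otimes> g 0"
  by (simp add: ps_simps)

lemma witt_simps:
  "carrier (witt_ring R) = witt_set R" "x \<otimes>\<^bsub>witt_ring R\<^esub> y = witt_mult R x y"
  "x \<oplus>\<^bsub>witt_ring R\<^esub> y = x \<otimes>\<^bsub>ps_ring R\<^esub> y" "\<one>\<^bsub>witt_ring R\<^esub> = one_minus R \<one> 1"
  "\<zero>\<^bsub>witt_ring R\<^esub> = \<one>\<^bsub>ps_ring R\<^esub>"
  by (simp_all add: witt_ring_def)

text \<open>A subsemiring of the Witt ring. Multiplying by a denominator is Witt addition, so the
  rational series are exactly the differences of its elements, and these form a subring.\<close>

definition unit_polys :: "(nat \<Rightarrow> 'a) set" where
  "unit_polys = {p \<in> carrier (UP R). p 0 = \<one>}"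

lemma unit_polys_witt: "p \<in> unit_polys \<Longrightarrow> p \<in> witt_set R"
  by (auto simp: unit_polys_def witt_set_def carrier_UP_ps)

lemma unit_polys_add:
  "p \<in> unit_polys \<Longrightarrow> q \<in> unit_polys \<Longrightarrow> p \<oplus>\<^bsub>witt_ring R\<^esub> q \<in> unit_polys"
  by (auto simp: unit_polys_def witt_simps UP_ps_mult ps_mult_0 carrier_UP_ps)

lemma unit_polys_mult:
  "p \<in> unit_polys \<Longrightarrow> q \<in> unit_polys \<Longrightarrow> p \<otimes>\<^bsub>witt_ring R\<^esub> q \<in> unit_polys"
  using witt_mult_closed[of p q]
  by (auto simp: unit_polys_def witt_simps witt_mult_poly carrier_UP_ps witt_set_def)

lemma one_minus_unit_poly: "one_minus R \<one> 1 \<in> unit_polys"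
  by (auto simp: unit_polys_def up_iff one_minus_def intro!: exI[of _ 1])

lemma ps_one_unit_poly: "\<one>\<^bsub>ps_ring R\<^esub> \<in> unit_polys"
  by (auto simp: unit_polys_def up_iff ps_simps intro!: exI[of _ 1])

lemma Wrat_set_alt:
  "Wrat_set R = {f \<in> carrier (witt_ring R). \<exists>p\<in>unit_polys. \<exists>q\<in>unit_polys. f \<oplus>\<^bsub>witt_ring R\<^esub> q = p}"
  by (auto simp: Wrat_set_def witt_simps unit_polys_def)

lemma Wrat_cring: "cring (Wrat R)"
proof -
  interpret W: cring "witt_ring R" by (rule witt_ring_cring)
  have sub: "p \<in> unit_polys \<Longrightarrow> p \<in> carrier (witt_ring R)" for p
    by (simp add: witt_simps unit_polys_witt)
  have diff: "x \<in> Wrat_set R"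
    if "x \<in> carrier (witt_ring R)" "p \<in> unit_polys" "q \<in> unit_polys" "x \<oplus>\<^bsub>witt_ring R\<^esub> q = p" for x p q
    using that by (auto simp: Wrat_set_alt)
  have "subring (Wrat_set R) (witt_ring R)"
  proof (rule W.subringI)
    show "Wrat_set R \<subseteq> carrier (witt_ring R)" by (auto simp: Wrat_set_alt)
    show "\<one>\<^bsub>witt_ring R\<^esub> \<in> Wrat_set R"
      using one_minus_unit_poly ps_one_unit_poly
      by (intro diff[of _ "one_minus R \<one> 1" "\<one>\<^bsub>ps_ring R\<^esub>"])
         (simp_all del: One_nat_def flip: witt_simps(4,5))
  next
    fix h assume "h \<in> Wrat_set R"
    then obtain p q where h: "h \<in> carrier (witt_ring R)" "p \<in> unit_polys" "q \<in> unit_polys"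
      "h \<oplus>\<^bsub>witt_ring R\<^esub> q = p" by (auto simp: Wrat_set_alt)
    \<comment> \<open>Negation in the Witt ring is the reciprocal series: numerator and denominator
      change places.\<close>
    have "\<ominus>\<^bsub>witt_ring R\<^esub> h \<oplus>\<^bsub>witt_ring R\<^esub> p = q"
      unfolding h(4)[symmetric] using h(1) sub[OF h(3)] by (rule W.r_neg1)
    then show "\<ominus>\<^bsub>witt_ring R\<^esub> h \<in> Wrat_set R"
      using h(1) by (intro diff[OF _ h(3,2)]) simp_all
  next
    fix x y assume "x \<in> Wrat_set R" "y \<in> Wrat_set R"
    then obtain p q p' q' where x: "x \<in> carrier (witt_ring R)" "p \<in> unit_polys" "q \<in> unit_polys"
      "p = x \<oplus>\<^bsub>witt_ring R\<^esub> q"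
      and y: "y \<in> carrier (witt_ring R)" "p' \<in> unit_polys" "q' \<in> unit_polys"
      "p' = y \<oplus>\<^bsub>witt_ring R\<^esub> q'" by (auto simp: Wrat_set_alt)
    note c = x(1) y(1) sub[OF x(3)] sub[OF y(3)] W.a_closed W.m_closed
    show "x \<oplus>\<^bsub>witt_ring R\<^esub> y \<in> Wrat_set R"
    proof (rule diff)
      show "p \<oplus>\<^bsub>witt_ring R\<^esub> p' \<in> unit_polys" "q \<oplus>\<^bsub>witt_ring R\<^esub> q' \<in> unit_polys"
        using x(2,3) y(2,3) by (auto intro!: unit_polys_add)
      show "x \<oplus>\<^bsub>witt_ring R\<^esub> y \<oplus>\<^bsub>witt_ring R\<^esub> (q \<oplus>\<^bsub>witt_ring R\<^esub> q') = p \<oplus>\<^bsub>witt_ring R\<^esub> p'"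
        unfolding x(4) y(4) by (simp only: c W.a_ac)
    qed (simp add: c)
    show "x \<otimes>\<^bsub>witt_ring R\<^esub> y \<in> Wrat_set R"
    proof (rule diff)
      show "p \<otimes>\<^bsub>witt_ring R\<^esub> p' \<oplus>\<^bsub>witt_ring R\<^esub> q \<otimes>\<^bsub>witt_ring R\<^esub> q' \<in> unit_polys"
        "p \<otimes>\<^bsub>witt_ring R\<^esub> q' \<oplus>\<^bsub>witt_ring R\<^esub> q \<otimes>\<^bsub>witt_ring R\<^esub> p' \<in> unit_polys"
        using x(2,3) y(2,3) by (auto intro!: unit_polys_add unit_polys_mult)
      show "x \<otimes>\<^bsub>witt_ring R\<^esub> y \<oplus>\<^bsub>witt_ring R\<^esub> (p \<otimes>\<^bsub>witt_ring R\<^esub> q' \<oplus>\<^bsub>witt_ring R\<^esub> q \<otimes>\<^bsub>witt_ring R\<^esub> p') =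
        p \<otimes>\<^bsub>witt_ring R\<^esub> p' \<oplus>\<^bsub>witt_ring R\<^esub> q \<otimes>\<^bsub>witt_ring R\<^esub> q'"
        unfolding x(4) y(4) using c(1-4) by (rule W.minus_mult_minus)
    qed (simp add: c)
  qed
  then have "subcring (Wrat_set R) (witt_ring R)" by (rule W.subcringI')
  then show ?thesis
    unfolding Wrat_def by (subst W.subcring_iff[symmetric]) (auto simp: Wrat_set_alt)
qed

end

section \<open>Determinants over carrier rings\<close>

lemma (in ring_hom_cring) hom_ring_det:
  assumes "\<And>i j. M i j \<in> carrier R"
  shows "h (ring_det R n M) = ring_det S n (\<lambda>i j. h (M i j))"
proof -
  have s: "h (if b then \<one>\<^bsub>R\<^esub> else \<ominus>\<^bsub>R\<^esub> \<one>\<^bsub>R\<^esub>) = (if b then \<one>\<^bsub>S\<^esub> else \<ominus>\<^bsub>S\<^esub> \<one>\<^bsub>S\<^esub>)" for b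
    by simp
  have c: "(if b then \<one>\<^bsub>R\<^esub> else \<ominus>\<^bsub>R\<^esub> \<one>\<^bsub>R\<^esub>) \<otimes>\<^bsub>R\<^esub> (\<Otimes>\<^bsub>R\<^esub>i\<in>{..<n}. M i (p i)) \<in> carrier R" for b p
    using assms by (auto intro!: R.m_closed R.finprod_closed)
  have "h (\<Otimes>\<^bsub>R\<^esub>i\<in>{..<n}. M i (p i)) = (\<Otimes>\<^bsub>S\<^esub>i\<in>{..<n}. h (M i (p i)))" for p
    using assms by (subst hom_finprod) (auto simp: o_def)
  then have "h ((if b then \<one>\<^bsub>R\<^esub> else \<ominus>\<^bsub>R\<^esub> \<one>\<^bsub>R\<^esub>) \<otimes>\<^bsub>R\<^esub> (\<Otimes>\<^bsub>R\<^esub>i\<in>{..<n}. M i (p i)))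
     = (if b then \<one>\<^bsub>S\<^esub> else \<ominus>\<^bsub>S\<^esub> \<one>\<^bsub>S\<^esub>) \<otimes>\<^bsub>S\<^esub> (\<Otimes>\<^bsub>S\<^esub>i\<in>{..<n}. h (M i (p i)))" for b p
    using assms by (subst hom_mult) (auto simp only: s intro!: R.finprod_closed Pi_I, auto)
  then show ?thesis
    unfolding ring_det_def using c by (subst hom_finsum) (auto simp: o_def)
qed

lemma univ_finprod: "finprod univ_ring f A = prod f A"
  by (induction A rule: infinite_finite_induct) (auto simp: UU.finprod_infinite UU.finprod_insert)

text \<open>Links the Leibniz formula of \<open>ring_det\<close> to the matrix determinant over a
  type, for which Laplace expansion, adjugate and multiplicativity are at hand.\<close>

lemma ring_det_univ: "ring_det univ_ring n M = det (mat n n (\<lambda>(i, j). M i j))"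
proof -
  have "signof p * (\<Prod>i = 0..<n. mat n n (\<lambda>(i, j). M i j) $$ (i, p i)) =
      (if evenperm p then 1 else - 1) * (\<Prod>i<n. M i (p i))" if "p permutes {0..<n}" for p
    using that permutes_in_image[OF that]
    by (auto simp: sign_def atLeast0LessThan intro!: prod.cong)
  then have "det (mat n n (\<lambda>(i, j). M i j)) =
      (\<Sum>p | p permutes {0..<n}. (if evenperm p then 1 else - 1) * (\<Prod>i<n. M i (p i)))"
    by (subst det_def'[of _ n]) (auto intro!: sum.cong)
  then show ?thesis
    by (auto simp: ring_det_def univ_sum univ_finprod atLeast0LessThan intro!: sum.cong)
qed

section \<open>Determinant identities obtained from integer polynomials\<close>

context cring begin

definition var :: "'a \<Rightarrow> 'a zpoly" where
  "var a = Poly_Mapping.single {#a#} 1"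

lemma ev_var': "a \<in> carrier R \<Longrightarrow> ev (var a) = a"
  by (simp add: var_def ev_var)

lemma ev_det: "ev (det (mat n n (\<lambda>(i, j). M i j))) = ring_det R n (\<lambda>i j. ev (M i j))"
  using ring_hom_cring.hom_ring_det[OF ev_hom, of M n] by (simp add: ring_det_univ)

text \<open>Each entry is replaced by the indeterminate named after it. Equal entries receive equal
  indeterminates, so coincidences among the entries survive the lift.\<close>

lemma ring_det_lift:
  assumes "\<And>i j. M i j \<in> carrier R"
  shows "ring_det R n M = ev (det (mat n n (\<lambda>(i, j). var (M i j))))"
  using assms by (simp add: ev_det ev_var')

lemma ring_det_closed: "(\<And>i j. M i j \<in> carrier R) \<Longrightarrow> ring_det R n M \<in> carrier R"
  by (simp add: ring_det_lift)

lemma ring_det_cong: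
  assumes "\<And>i j. i < n \<Longrightarrow> j < n \<Longrightarrow> M i j = M' i j" "\<And>i j. M i j \<in> carrier R" "\<And>i j. M' i j \<in> carrier R"
  shows "ring_det R n M = ring_det R n M'"
proof -
  have "mat n n (\<lambda>(i, j). var (M i j)) = mat n n (\<lambda>(i, j). var (M' i j))"
    using assms(1) by (intro eq_matI) auto
  then show ?thesis using assms(2,3) by (simp add: ring_det_lift)
qed

lemma ev_sum: "finite A \<Longrightarrow> ev (sum f A) = (\<Oplus>i\<in>A. ev (f i))"
  by (induction A rule: finite_induct) (simp_all add: ev_0 ev_add finsum_insert finsum_empty)

text \<open>Laplace expansion along the last column. The \<open>C i\<close> are cofactors and do not
  involve that column, so the same coefficients serve for every \<open>v\<close>; \<open>C n\<close>
  is the minor left by deleting the last row and the last column.\<close>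

lemma ring_det_expand_last:
  assumes M: "\<And>i j. M i j \<in> carrier R"
  obtains C where "\<And>i. C i \<in> carrier R" "C n = ring_det R n M"
    "\<And>v. (\<And>i. v i \<in> carrier R) \<Longrightarrow>
      ring_det R (Suc n) (\<lambda>i j. if j < n then M i j else v i) = (\<Oplus>i\<in>{..n}. v i \<otimes> C i)"
proof
  let ?L = "mat (Suc n) (Suc n) (\<lambda>(i, j). var (M i j))"
  let ?C = "\<lambda>i. ev (cofactor ?L i n)"
  show "?C i \<in> carrier R" for i by simp
  have "mat_delete ?L n n = mat n n (\<lambda>(i, j). var (M i j))"
    by (rule eq_matI) (auto simp: mat_delete_def)
  then show "?C n = ring_det R n M"
    by (simp add: cofactor_def ring_det_lift[OF M])
  fix v :: "nat \<Rightarrow> 'a" assume v: "\<And>i. v i \<in> carrier R"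
  let ?A = "mat (Suc n) (Suc n) (\<lambda>(i, j). var (if j < n then M i j else v i))"
  have "cofactor ?A i n = cofactor ?L i n" if "i < Suc n" for i
  proof -
    have "mat_delete ?A i n = mat_delete ?L i n"
      by (rule eq_matI) (auto simp: mat_delete_def)
    then show ?thesis by (simp add: cofactor_def)
  qed
  then have "det ?A = (\<Sum>i\<le>n. var (v i) * cofactor ?L i n)"
    by (subst laplace_expansion_column[of _ "Suc n" n]) (auto simp: lessThan_Suc_atMost intro!: sum.cong)
  then show "ring_det R (Suc n) (\<lambda>i j. if j < n then M i j else v i) = (\<Oplus>i\<in>{..n}. v i \<otimes> ?C i)"
    by (subst ring_det_lift) (simp_all add: M v ev_sum ev_mult ev_var')
qed

lemma ring_det_adjugate:
  assumes M: "\<And>i j. M i j \<in> carrier R"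
  obtains B where "\<And>i j. B i j \<in> carrier R"
    "\<And>i k. i < n \<Longrightarrow> k < n \<Longrightarrow>
      (\<Oplus>j\<in>{..<n}. M i j \<otimes> B j k) = (if i = k then ring_det R n M else \<zero>)"
proof
  let ?L = "mat n n (\<lambda>(i, j). var (M i j))"
  let ?B = "\<lambda>i j. ev (adj_mat ?L $$ (i, j))"
  show "?B i j \<in> carrier R" for i j by simp
  fix i k assume ik: "i < n" "k < n"
  have A: "adj_mat ?L \<in> carrier_mat n n" "?L * adj_mat ?L = det ?L \<cdot>\<^sub>m 1\<^sub>m n"
    by (auto intro!: adj_mat)
  have "(?L * adj_mat ?L) $$ (i, k) = (\<Sum>j<n. var (M i j) * adj_mat ?L $$ (j, k))"
    using ik A(1) by (auto simp: scalar_prod_def atLeast0LessThan intro!: sum.cong)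
  moreover have "(?L * adj_mat ?L) $$ (i, k) = (if i = k then det ?L else 0)"
    unfolding A(2) using ik by simp
  ultimately have "(\<Sum>j<n. var (M i j) * adj_mat ?L $$ (j, k)) = (if i = k then det ?L else 0)"
    by (rule trans[OF sym])
  then have "ev (\<Sum>j<n. var (M i j) * adj_mat ?L $$ (j, k)) = (if i = k then ev (det ?L) else \<zero>)"
    by (simp add: ev_0)
  then show "(\<Oplus>j\<in>{..<n}. M i j \<otimes> ?B j k) = (if i = k then ring_det R n M else \<zero>)"
    by (simp add: ev_sum ev_mult ev_var' M ring_det_lift[OF M])
qed

text \<open>The matrix factors through \<open>m < n\<close> dimensions. Padded to square size, the
  left factor acquires a zero column, so its determinant vanishes and with it that of the
  product.\<close>

lemma ring_det_row_span:
  assumes A: "\<And>i k. A i k \<in> carrier R" and B: "\<And>k j. B k j \<in> carrier R" and "m < n"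
  shows "ring_det R n (\<lambda>i j. \<Oplus>k\<in>{..<m}. A i k \<otimes> B k j) = \<zero>"
proof -
  let ?A = "mat n n (\<lambda>(i, k). if k < m then var (A i k) else 0)"
  let ?B = "mat n n (\<lambda>(k, j). var (B k j))"
  let ?S = "\<lambda>i j. \<Sum>k<m. var (A i k) * var (B k j)"
  have "det ?A = (\<Sum>i<n. ?A $$ (i, n - 1) * cofactor ?A i (n - 1))"
    using \<open>m < n\<close> by (intro laplace_expansion_column[of _ n]) auto
  also have "\<dots> = 0" using \<open>m < n\<close> by (intro sum.neutral) auto
  finally have d: "det (?A * ?B) = 0" by (subst det_mult[of _ n]) auto
  have "?A * ?B = mat n n (\<lambda>(i, j). ?S i j)"
  proof (rule eq_matI)
    fix i j assume "i < dim_row (mat n n (\<lambda>(i, j). ?S i j))" "j < dim_col (mat n n (\<lambda>(i, j). ?S i j))"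
    then have ij: "i < n" "j < n" by auto
    then have "(?A * ?B) $$ (i, j) = (\<Sum>k<n. (if k < m then var (A i k) else 0) * var (B k j))"
      by (auto simp: scalar_prod_def atLeast0LessThan intro!: sum.cong)
    also have "\<dots> = ?S i j"
      using \<open>m < n\<close> by (intro sum.mono_neutral_cong_right) auto
    finally show "(?A * ?B) $$ (i, j) = mat n n (\<lambda>(i, j). ?S i j) $$ (i, j)" using ij by simp
  qed auto
  then have "ring_det R n (\<lambda>i j. ev (?S i j)) = \<zero>"
    using d ev_det[of n ?S] by (simp add: ev_0)
  then show ?thesis by (simp add: ev_sum ev_mult ev_var' A B)
qed

lemma ring_det_identical_columns:
  assumes M: "\<And>i j. M i j \<in> carrier R" and "j < n" "k < n" "j \<noteq> k" "\<And>i. M i j = M i k"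
  shows "ring_det R n M = \<zero>"
proof -
  let ?L = "mat n n (\<lambda>(i, j). var (M i j))"
  have "det (transpose_mat ?L) = 0"
    using assms by (intro det_identical_rows[of _ n j k]) auto
  then show ?thesis
    by (simp add: ring_det_lift[OF M] det_transpose[of _ n] ev_0)
qed

lemma ring_det_permute_columns:
  assumes M: "\<And>i j. M i j \<in> carrier R" and p: "p permutes {..<n}" and "ring_det R n M = \<zero>"
  shows "ring_det R n (\<lambda>i j. M i (p j)) = \<zero>"
proof -
  let ?L = "mat n n (\<lambda>(i, j). var (M i j))" and ?P = "mat n n (\<lambda>(i, j). var (M i (p j)))"
  have pn: "i < n \<Longrightarrow> p i < n" for i using permutes_in_image[OF p] by auto
  have "mat n n (\<lambda>(i, j). transpose_mat ?L $$ (p i, j)) = transpose_mat ?P"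
    by (rule eq_matI) (auto simp: pn)
  then have "det ?P = signof p * det ?L"
    using det_permute_rows[of "transpose_mat ?L" n p] p
    by (simp add: det_transpose[of _ n] atLeast0LessThan)
  then have "ring_det R n (\<lambda>i j. M i (p j)) = ev (signof p) \<otimes> ring_det R n M"
    using M by (simp add: ring_det_lift ev_mult)
  then show ?thesis using assms(3) by simp
qed

text \<open>\<open>minors_vanish\<close> only concerns increasing selections of columns. An
  arbitrary selection either repeats a column or is a permutation of an increasing one, which
  changes the determinant by a sign.\<close>

lemma minors_vanish_columns:
  assumes M: "\<And>i j. M i j \<in> carrier R" and "minors_vanish R n M" "strict_mono_on {..<n} r"
  shows "ring_det R n (\<lambda>i j. M (r i) (c j)) = \<zero>"
proof (cases "inj_on c {..<n}")
  case False
  then obtain j k where jk: "j < n" "k < n" "j \<noteq> k" "c j = c k" by (auto simp: inj_on_def)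
  show ?thesis by (rule ring_det_identical_columns[OF _ jk(1-3)]) (simp_all add: M jk(4))
next
  case True
  let ?S = "c ` {..<n}"
  define s where "s i = sorted_list_of_set ?S ! i" for i
  have len: "length (sorted_list_of_set ?S) = n" using True by (simp add: card_image)
  have smono: "strict_mono_on {..<n} s"
    using strict_sorted_list_of_set[of ?S] len
    by (intro strict_mono_onI) (simp add: s_def sorted_wrt_nth_less)
  have bs: "bij_betw s {..<n} ?S"
    unfolding s_def by (rule bij_betw_nth) (use len in auto)
  \<comment> \<open>\<open>s\<close> enumerates the image of \<open>c\<close> increasingly, and
    \<open>p\<close> is the permutation with \<open>c = s \<circ> p\<close> on the index range;
    outside it \<open>p\<close> is the identity, as \<open>permutes\<close> demands.\<close>
  define p where "p i = (if i < n then inv_into {..<n} s (c i) else i)" for i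
  have sp: "s (p i) = c i" if "i < n" for i
    using bs that by (simp add: p_def bij_betw_inv_into_right)
  have "bij_betw (inv_into {..<n} s \<circ> c) {..<n} {..<n}"
    using bij_betw_trans[OF inj_on_imp_bij_betw[OF True] bij_betw_inv_into[OF bs]] .
  then have "bij_betw p {..<n} {..<n}"
    using bij_betw_cong[of "{..<n}" p "inv_into {..<n} s \<circ> c" "{..<n}"] by (simp add: p_def)
  then have p: "p permutes {..<n}" by (rule bij_imp_permutes) (auto simp: p_def)
  have "ring_det R n (\<lambda>i j. M (r i) (s j)) = \<zero>"
    using assms(2)[unfolded minors_vanish_def, rule_format, of r s] assms(3) smono by simp
  then have "ring_det R n (\<lambda>i j. M (r i) (s (p j))) = \<zero>"
    using M p ring_det_permute_columns[of "\<lambda>i j. M (r i) (s j)" p n] by simp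
  also have "ring_det R n (\<lambda>i j. M (r i) (s (p j))) = ring_det R n (\<lambda>i j. M (r i) (c j))"
    by (rule ring_det_cong) (simp_all add: M sp)
  finally show ?thesis .
qed

end

section \<open>Linear dependence of rows over a domain\<close>

context domain begin

text \<open>Multiplying the row relation \<open>q M = 0\<close> by the adjugate gives
  \<open>q k\<close> times the determinant equal to zero, and the nonzero \<open>q k\<close> cancels
  in a domain.\<close>

lemma ring_det_dependent_rows:
  assumes M: "\<And>i j. M i j \<in> carrier R" and q: "\<And>i. q i \<in> carrier R" "k < n" "q k \<noteq> \<zero>"
    and dep: "\<And>j. j < n \<Longrightarrow> (\<Oplus>i\<in>{..<n}. q i \<otimes> M i j) = \<zero>"
  shows "ring_det R n M = \<zero>"
proof -
  obtain B where B: "\<And>i j. B i j \<in> carrier R"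
    "\<And>i k. i < n \<Longrightarrow> k < n \<Longrightarrow>
      (\<Oplus>j\<in>{..<n}. M i j \<otimes> B j k) = (if i = k then ring_det R n M else \<zero>)"
    using ring_det_adjugate[of M n] M by blast
  have d: "ring_det R n M \<in> carrier R" using M by (rule ring_det_closed)
  have "q k \<otimes> ring_det R n M = (\<Oplus>i\<in>{..<n}. if k = i then q i \<otimes> ring_det R n M else \<zero>)"
    using q d by (subst finsum_singleton) auto
  also have "\<dots> = (\<Oplus>i\<in>{..<n}. q i \<otimes> (\<Oplus>j\<in>{..<n}. M i j \<otimes> B j k))"
    using q d by (intro finsum_cong') (auto simp: B)
  also have "\<dots> = (\<Oplus>i\<in>{..<n}. \<Oplus>j\<in>{..<n}. q i \<otimes> M i j \<otimes> B j k)"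
    using M q B(1) by (simp add: finsum_rdistr Pi_def m_assoc cong: finsum_cong)
  also have "\<dots> = (\<Oplus>j\<in>{..<n}. \<Oplus>i\<in>{..<n}. q i \<otimes> M i j \<otimes> B j k)"
    using M q B(1) by (intro finsum_finsum_swap) auto
  also have "\<dots> = (\<Oplus>j\<in>{..<n}. (\<Oplus>i\<in>{..<n}. q i \<otimes> M i j) \<otimes> B j k)"
    using M q B(1) by (simp add: finsum_ldistr Pi_def)
  also have "\<dots> = (\<Oplus>j\<in>{..<n}. \<zero>)"
    using B(1) by (intro finsum_cong') (auto simp: dep)
  finally show ?thesis using q d by (simp add: integral_iff)
qed

text \<open>Enlarging a nonzero minor column by column: expanding along the new last column, a vanishing
  of all the extensions is a linear relation whose last coefficient is the old minor.\<close>

lemma independent_minor: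
  fixes v :: "nat \<Rightarrow> 'c \<Rightarrow> 'a"
  assumes v: "\<And>i j. v i j \<in> carrier R"
    and indep: "\<And>q. (\<And>i. q i \<in> carrier R) \<Longrightarrow> (\<And>j. (\<Oplus>i\<in>{..<n}. q i \<otimes> v i j) = \<zero>) \<Longrightarrow>
      (\<And>i. i < n \<Longrightarrow> q i = \<zero>)"
  shows "\<exists>c. ring_det R n (\<lambda>i j. v i (c j)) \<noteq> \<zero>"
  using indep
proof (induction n)
  case 0
  then show ?case using v by (auto simp: ring_det_lift ev_one)
next
  case (Suc n)
  have "\<exists>c. ring_det R n (\<lambda>i j. v i (c j)) \<noteq> \<zero>"
  proof (rule Suc.IH)
    fix q i assume q: "\<And>i. q i \<in> carrier R" "\<And>j. (\<Oplus>i\<in>{..<n}. q i \<otimes> v i j) = \<zero>" and "i < n"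
    \<comment> \<open>A relation among the first \<open>n\<close> rows is one among
      \<open>n + 1\<close> rows whose last coefficient is 0, so independence passes to the first
      \<open>n\<close> rows.\<close>
    have "(\<Oplus>i\<in>{..<Suc n}. (if i < n then q i else \<zero>) \<otimes> v i j) = (\<Oplus>i\<in>{..<n}. q i \<otimes> v i j)" for j
      using q(1) v by (intro add.finprod_mono_neutral_cong_right) auto
    then show "q i = \<zero>"
      using Suc.prems[of "\<lambda>i. if i < n then q i else \<zero>" i] q \<open>i < n\<close> by auto
  qed
  then obtain c where c: "ring_det R n (\<lambda>i j. v i (c j)) \<noteq> \<zero>" ..
  obtain C where C: "\<And>i. C i \<in> carrier R" "C n = ring_det R n (\<lambda>i j. v i (c j))"
    "\<And>w. (\<And>i. w i \<in> carrier R) \<Longrightarrow>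
      ring_det R (Suc n) (\<lambda>i j. if j < n then v i (c j) else w i) = (\<Oplus>i\<in>{..n}. w i \<otimes> C i)"
    using ring_det_expand_last[of "\<lambda>i j. v i (c j)" n] v by blast
  have "\<exists>x. ring_det R (Suc n) (\<lambda>i j. if j < n then v i (c j) else v i x) \<noteq> \<zero>"
  proof (rule ccontr)
    assume "\<not> ?thesis"
    then have "(\<Oplus>i\<in>{..n}. v i x \<otimes> C i) = \<zero>" for x
      using C(3)[of "\<lambda>i. v i x", OF v] by simp
    then have "(\<Oplus>i\<in>{..<Suc n}. C i \<otimes> v i x) = \<zero>" for x
      using v C(1) by (simp add: m_comm lessThan_Suc_atMost)
    from Suc.prems[OF C(1) this, of n] show False using c C(2) by simp
  qed
  then obtain x where x: "ring_det R (Suc n) (\<lambda>i j. if j < n then v i (c j) else v i x) \<noteq> \<zero>" ..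
  have eq: "(\<lambda>i j. if j < n then v i (c j) else v i x) = (\<lambda>i j. v i (if j < n then c j else x))"
    by (auto simp: fun_eq_iff)
  show ?case by (rule exI[of _ "\<lambda>j. if j < n then c j else x"]) (use x in \<open>simp only: eq simp_thms\<close>)
qed

end

section \<open>Linear recurrences\<close>

text \<open>\<open>denominator R f d Q\<close> says that \<open>f = P / Q\<close> with polynomials \<open>P\<close>, \<open>Q\<close> and \<open>deg Q \<le> d\<close>,
  without requiring \<open>Q\<close> to be nonzero.\<close>

definition denominator :: "('a, 'm) ring_scheme \<Rightarrow> (nat \<Rightarrow> 'a) \<Rightarrow> nat \<Rightarrow> (nat \<Rightarrow> 'a) \<Rightarrow> bool" where
  "denominator R f d Q \<longleftrightarrow> Q \<in> carrier (ps_ring R) \<and> (\<forall>t>d. Q t = \<zero>\<^bsub>R\<^esub>) \<and>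
     f \<otimes>\<^bsub>ps_ring R\<^esub> Q \<in> carrier (UP R)"

definition recurrent :: "('a, 'm) ring_scheme \<Rightarrow> (nat \<Rightarrow> 'a) \<Rightarrow> nat \<Rightarrow> bool" where
  "recurrent R f d \<longleftrightarrow> (\<exists>Q. denominator R f d Q \<and> (\<exists>t. Q t \<noteq> \<zero>\<^bsub>R\<^esub>))"

definition recurrence_order :: "('a, 'm) ring_scheme \<Rightarrow> (nat \<Rightarrow> 'a) \<Rightarrow> nat \<Rightarrow> bool" where
  "recurrence_order R f d \<longleftrightarrow> recurrent R f d \<and> (\<forall>e<d. \<not> recurrent R f e)"

lemma recurrent_imp_order: "recurrent R f n \<Longrightarrow> \<exists>d. recurrence_order R f d"
  unfolding recurrence_order_def
  by (rule exI[of _ "LEAST d. recurrent R f d"]) (auto intro: LeastI dest: not_less_Least)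

section \<open>Operations on denominators and uniqueness in minimal degree\<close>

context cring begin

lemma mult_minus_eq_zero:
  assumes "x \<in> carrier R" "y \<in> carrier R" "z \<in> carrier R" "x \<otimes> y = x \<otimes> z"
  shows "x \<otimes> (y \<ominus> z) = \<zero>"
proof -
  have "x \<otimes> (y \<ominus> z) = x \<otimes> y \<oplus> \<ominus> (x \<otimes> z)"
    using assms(1-3) by (simp add: minus_eq r_distr r_minus)
  then show ?thesis using assms by (simp add: r_neg)
qed

lemma ps_closed: "f \<in> carrier (ps_ring R) \<Longrightarrow> f n \<in> carrier R"
  by (simp add: ps_simps)

lemma ps_mult_closed_nth:
  "f \<in> carrier (ps_ring R) \<Longrightarrow> g \<in> carrier (ps_ring R) \<Longrightarrow> (f \<otimes>\<^bsub>ps_ring R\<^esub> g) n \<in> carrier R"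
  using ps_m_closed by (simp add: ps_simps)

text \<open>Reads a coefficient of the product as a linear combination in the Hankel matrix: the
  coefficients of \<open>Q\<close>, in reverse order, are the weights of rows \<open>0\<close> to
  \<open>d\<close> in column \<open>m\<close>.\<close>

lemma ps_mult_poly_nth:
  assumes f: "f \<in> carrier (ps_ring R)" and Q: "Q \<in> carrier (ps_ring R)" "\<And>t. t > d \<Longrightarrow> Q t = \<zero>"
  shows "(f \<otimes>\<^bsub>ps_ring R\<^esub> Q) (d + m) = (\<Oplus>i\<in>{..d}. Q (d - i) \<otimes> f (i + m))"
proof -
  have c: "f n \<in> carrier R" "Q n \<in> carrier R" for n using f Q(1) by (auto simp: ps_simps)
  have "(f \<otimes>\<^bsub>ps_ring R\<^esub> Q) (d + m) = (\<Oplus>k\<in>{..d + m}. f k \<otimes> Q (d + m - k))"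
    by (simp add: ps_simps)
  \<comment> \<open>For \<open>k < m\<close> the index \<open>d + m - k\<close> exceeds
    \<open>d\<close>, where \<open>Q\<close> vanishes; the remaining indices are
    \<open>k = i + m\<close>.\<close>
  also have "\<dots> = (\<Oplus>k\<in>(\<lambda>i. i + m) ` {..d}. f k \<otimes> Q (d + m - k))"
  proof (rule add.finprod_mono_neutral_cong_right)
    fix k assume k: "k \<in> {..d + m} - (\<lambda>i. i + m) ` {..d}"
    then have "k \<noteq> (k - m) + m \<or> k - m > d" by auto
    with k have "d + m - k > d" by auto
    then show "f k \<otimes> Q (d + m - k) = \<zero>" using Q(2) c by simp
  qed (auto simp: c)
  also have "\<dots> = (\<Oplus>i\<in>{..d}. f (i + m) \<otimes> Q (d + m - (i + m)))"
    by (rule add.finprod_reindex) (auto simp: c)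
  also have "\<dots> = (\<Oplus>i\<in>{..d}. Q (d - i) \<otimes> f (i + m))"
    by (intro finsum_cong') (auto simp: c m_comm)
  finally show ?thesis .
qed

lemma ps_mult_shift:
  assumes "f \<in> carrier (ps_ring R)" "Q \<in> carrier (ps_ring R)" "Q 0 = \<zero>"
  shows "(f \<otimes>\<^bsub>ps_ring R\<^esub> Q) (Suc k) = (f \<otimes>\<^bsub>ps_ring R\<^esub> (\<lambda>t. Q (Suc t))) k"
proof -
  have c: "f n \<in> carrier R" "Q n \<in> carrier R" for n using assms by (auto simp: ps_simps)
  have "(\<Oplus>i\<in>{..k}. f i \<otimes> Q (Suc k - i)) = (\<Oplus>i\<in>{..k}. f i \<otimes> Q (Suc (k - i)))"
    by (intro finsum_cong') (auto simp: c Suc_diff_le)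
  then show ?thesis by (simp add: ps_simps c assms(3))
qed

lemma ps_mult_smult:
  assumes "f \<in> carrier (ps_ring R)" "Q \<in> carrier (ps_ring R)" "a \<in> carrier R"
  shows "f \<otimes>\<^bsub>ps_ring R\<^esub> (\<lambda>t. a \<otimes> Q t) = (\<lambda>n. a \<otimes> (f \<otimes>\<^bsub>ps_ring R\<^esub> Q) n)"
proof
  fix n
  have c: "f n \<in> carrier R" "Q n \<in> carrier R" for n using assms by (auto simp: ps_simps)
  show "(f \<otimes>\<^bsub>ps_ring R\<^esub> (\<lambda>t. a \<otimes> Q t)) n = a \<otimes> (f \<otimes>\<^bsub>ps_ring R\<^esub> Q) n"
    using assms(3) by (simp add: ps_simps c finsum_rdistr Pi_def m_lcomm)
qed

lemma denominator_smult:
  assumes "f \<in> carrier (ps_ring R)" "denominator R f d Q" "a \<in> carrier R"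
  shows "denominator R f d (\<lambda>t. a \<otimes> Q t)"
proof -
  obtain N where "\<And>n. n > N \<Longrightarrow> (f \<otimes>\<^bsub>ps_ring R\<^esub> Q) n = \<zero>"
    using assms by (auto simp: denominator_def up_iff)
  then show ?thesis
    using assms unfolding denominator_def
    by (auto simp: ps_mult_smult up_iff ps_closed intro!: exI[of _ N]) (auto simp: ps_simps)
qed

lemma denominator_add:
  assumes f: "f \<in> carrier (ps_ring R)" and "denominator R f d Q" "denominator R f d Q'"
  shows "denominator R f d (\<lambda>t. Q t \<oplus> Q' t)"
proof -
  interpret P: cring "ps_ring R" by (rule ps_cring)
  have Q: "Q \<in> carrier (ps_ring R)" "Q' \<in> carrier (ps_ring R)" using assms by (auto simp: denominator_def)
  have s: "(\<lambda>t. Q t \<oplus> Q' t) = Q \<oplus>\<^bsub>ps_ring R\<^esub> Q'" by (simp add: ps_ring_def)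
  obtain N where N: "\<And>n. n > N \<Longrightarrow> (f \<otimes>\<^bsub>ps_ring R\<^esub> Q) n = \<zero>"
    using assms by (auto simp: denominator_def up_iff)
  obtain N' where N': "\<And>n. n > N' \<Longrightarrow> (f \<otimes>\<^bsub>ps_ring R\<^esub> Q') n = \<zero>"
    using assms by (auto simp: denominator_def up_iff)
  have e: "f \<otimes>\<^bsub>ps_ring R\<^esub> (\<lambda>t. Q t \<oplus> Q' t) =
      (\<lambda>n. (f \<otimes>\<^bsub>ps_ring R\<^esub> Q) n \<oplus> (f \<otimes>\<^bsub>ps_ring R\<^esub> Q') n)"
    unfolding s P.r_distr[OF Q f] by (simp add: ps_ring_def)
  have "f \<otimes>\<^bsub>ps_ring R\<^esub> (\<lambda>t. Q t \<oplus> Q' t) \<in> carrier (UP R)"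
    unfolding e up_iff
    by (intro conjI allI exI[of _ "max N N'"] impI) (simp_all add: N N' ps_mult_closed_nth f Q)
  moreover have "(\<lambda>t. Q t \<oplus> Q' t) \<in> carrier (ps_ring R)" unfolding s using Q by simp
  moreover have "\<forall>t>d. Q t \<oplus> Q' t = \<zero>" using assms(2,3) by (simp add: denominator_def)
  ultimately show ?thesis by (simp add: denominator_def)
qed

text \<open>A denominator with constant term 0 is divisible by \<open>T\<close>; the quotient has
  its degree bound lowered by one, and the numerator is divided by \<open>T\<close> as well.\<close>

lemma denominator_shift:
  assumes f: "f \<in> carrier (ps_ring R)" and "denominator R f (Suc d) Q" "Q 0 = \<zero>"
  shows "denominator R f d (\<lambda>t. Q (Suc t))"
proof -
  have Q: "Q \<in> carrier (ps_ring R)" using assms by (auto simp: denominator_def)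
  obtain N where N: "\<And>n. n > N \<Longrightarrow> (f \<otimes>\<^bsub>ps_ring R\<^esub> Q) n = \<zero>"
    using assms by (auto simp: denominator_def up_iff)
  have "f \<otimes>\<^bsub>ps_ring R\<^esub> (\<lambda>t. Q (Suc t)) = (\<lambda>n. (f \<otimes>\<^bsub>ps_ring R\<^esub> Q) (Suc n))"
    using ps_mult_shift[OF f Q assms(3)] by auto
  then have "f \<otimes>\<^bsub>ps_ring R\<^esub> (\<lambda>t. Q (Suc t)) \<in> carrier (UP R)"
    using N f Q by (auto simp: up_iff ps_mult_closed_nth intro!: exI[of _ N])
  then show ?thesis using assms(2) by (auto simp: denominator_def ps_simps)
qed

text \<open>The difference of \<open>Q\<close> and \<open>Q'\<close> has constant term 0, hence is
  divisible by \<open>T\<close>, and the quotient is a denominator of degree at most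
  \<open>d - 1\<close>; by minimality it is zero. For \<open>d = 0\<close> there is nothing beyond
  the constant term.\<close>

lemma denominator_unique:
  assumes f: "f \<in> carrier (ps_ring R)" and "\<forall>e<d. \<not> recurrent R f e"
    and Q: "denominator R f d Q" and Q': "denominator R f d Q'" and "Q 0 = Q' 0"
  shows "Q = Q'"
proof
  fix t
  let ?D = "\<lambda>t. Q t \<oplus> \<ominus> \<one> \<otimes> Q' t"
  have c: "Q n \<in> carrier R" "Q' n \<in> carrier R" for n using Q Q' by (auto simp: denominator_def ps_simps)
  have D: "denominator R f d ?D"
    by (intro denominator_add denominator_smult f Q Q') simp
  have D0: "?D 0 = \<zero>" using c assms(5) by (simp add: l_minus r_neg)
  have "?D t = \<zero>"
  proof (cases t)
    case 0
    then show ?thesis using D0 by simp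
  next
    case (Suc s)
    show ?thesis
    proof (cases d)
      case 0
      then show ?thesis using D Suc by (simp add: denominator_def)
    next
      case (Suc e)
      then have "denominator R f e (\<lambda>t. ?D (Suc t))"
        using denominator_shift[of f e ?D, OF f _ D0] D by simp
      then show ?thesis
        using assms(2) Suc \<open>t = Suc s\<close> unfolding recurrent_def by blast
    qed
  qed
  then show "Q t = Q' t" using c by (simp add: l_minus flip: minus_eq)
qed

text \<open>Selects the top \<open>n + 1\<close> rows and frees the choice of columns; this is the
  shape that \<open>recurrent_iff_minors\<close> expects, with shift 0.\<close>

lemma WJ_imp_recurrent: "f \<in> WJ_set R \<Longrightarrow> \<exists>n. \<forall>c. ring_det R (Suc n) (\<lambda>i j. f (i + c j)) = \<zero>"
proof -
  assume f: "f \<in> WJ_set R"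
  then obtain n where n: "minors_vanish R (Suc n) (hankel f)" by (auto simp: WJ_set_def)
  have "f n \<in> carrier R" for n using f by (auto simp: WJ_set_def witt_set_def ps_simps)
  then have "ring_det R (Suc n) (\<lambda>i j. hankel f (id i) (c j)) = \<zero>" for c
    using n minors_vanish_columns[of "hankel f" "Suc n" id c]
    by (simp add: hankel_def[abs_def] strict_mono_on_def)
  then show ?thesis by (auto simp: hankel_def)
qed

text \<open>Valid over any commutative ring: because \<open>Q 0 = \<one>\<close>, the recurrence can
  be solved for its highest term without division. So finitely many rows span all others, and every
  minor with one row more vanishes.\<close>

lemma Wrat_subset_WJ: "Wrat_set R \<subseteq> WJ_set R"
proof
  fix f assume "f \<in> Wrat_set R"
  then obtain P Q where f: "f \<in> witt_set R" and PQ: "P \<in> carrier (UP R)" "Q \<in> carrier (UP R)"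
    "Q 0 = \<one>" "f \<otimes>\<^bsub>ps_ring R\<^esub> Q = P" by (auto simp: Wrat_set_def)
  obtain a where a: "\<And>n. n > a \<Longrightarrow> P n = \<zero>" using PQ by (auto simp: up_iff)
  obtain b where b: "\<And>n. n > b \<Longrightarrow> Q n = \<zero>" using PQ by (auto simp: up_iff)
  \<comment> \<open>Bounds the degrees of \<open>P\<close> and \<open>Q\<close> at once, so that the
    recurrence of length \<open>d\<close> holds in every degree above \<open>d\<close>.\<close>
  define d where "d = max a b"
  have fc: "f \<in> carrier (ps_ring R)" and Qc: "Q \<in> carrier (ps_ring R)"
    using f PQ by (auto simp: witt_set_def carrier_UP_ps)
  have c: "f n \<in> carrier R" "Q n \<in> carrier R" for n using fc Qc by (auto simp: ps_simps)
  have rec: "f (d + m) = \<ominus> (\<Oplus>i\<in>{..<d}. Q (d - i) \<otimes> f (i + m))" if "m > 0" for m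
  proof -
    have "(\<Oplus>i\<in>{..d}. Q (d - i) \<otimes> f (i + m)) = \<zero>"
      using ps_mult_poly_nth[OF fc Qc, of d m] that by (simp add: PQ(4) a b d_def)
    moreover have "(\<Oplus>i\<in>{..d}. Q (d - i) \<otimes> f (i + m)) = f (d + m) \<oplus> (\<Oplus>i\<in>{..<d}. Q (d - i) \<otimes> f (i + m))"
      using PQ(3) by (simp add: lessThan_Suc_atMost[symmetric] lessThan_Suc finsum_insert c)
    ultimately show ?thesis
      using c by (intro minus_equality[symmetric]) (auto intro!: finsum_closed)
  qed
  text \<open>All rows of the Hankel matrix lie in the span of the first \<open>d + 1\<close>.\<close>
  have "\<exists>A. (\<forall>k. A k \<in> carrier R) \<and> (\<forall>j. f (r + j) = (\<Oplus>k\<in>{..<Suc d}. A k \<otimes> f (k + j)))" for r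
  proof (induction r rule: less_induct)
    case (less r)
    show ?case
    proof (cases "r \<le> d")
      case True
      have "(\<Oplus>k\<in>{..<Suc d}. (if k = r then \<one> else \<zero>) \<otimes> f (k + j)) = f (r + j)" for j
      proof -
        have "(\<Oplus>k\<in>{..<Suc d}. (if k = r then \<one> else \<zero>) \<otimes> f (k + j)) =
            (\<Oplus>k\<in>{..<Suc d}. if r = k then f (k + j) else \<zero>)"
          using c by (intro finsum_cong') auto
        also have "\<dots> = f (r + j)" using True c by (subst finsum_singleton) auto
        finally show ?thesis .
      qed
      then show ?thesis by (intro exI[of _ "\<lambda>k. if k = r then \<one> else \<zero>"]) simp
    next
      case False
      define m where "m = r - d"
      have m: "r = d + m" "m > 0" using False by (auto simp: m_def)
      \<comment> \<open>The recurrence expresses row \<open>r = d + m\<close> through the rows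
        \<open>i + m\<close> with \<open>i < d\<close>, all of smaller index, whose coefficients the
        induction hypothesis provides.\<close>
      have "\<forall>i. \<exists>A. i < d \<longrightarrow> (\<forall>k. A k \<in> carrier R) \<and>
          (\<forall>j. f (i + m + j) = (\<Oplus>k\<in>{..<Suc d}. A k \<otimes> f (k + j)))"
      proof
        fix i show "\<exists>A. i < d \<longrightarrow> (\<forall>k. A k \<in> carrier R) \<and>
          (\<forall>j. f (i + m + j) = (\<Oplus>k\<in>{..<Suc d}. A k \<otimes> f (k + j)))"
          using less[of "i + m"] m by (cases "i < d") auto
      qed
      then obtain A where A: "\<And>i k. i < d \<Longrightarrow> A i k \<in> carrier R"
        "\<And>i j. i < d \<Longrightarrow> f (i + m + j) = (\<Oplus>k\<in>{..<Suc d}. A i k \<otimes> f (k + j))" by metis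
      let ?B = "\<lambda>k. \<ominus> (\<Oplus>i\<in>{..<d}. Q (d - i) \<otimes> A i k)"
      have B: "(\<Oplus>i\<in>{..<d}. Q (d - i) \<otimes> A i k) \<in> carrier R" for k
        using A(1) c by (auto intro!: finsum_closed)
      have "f (r + j) = (\<Oplus>k\<in>{..<Suc d}. ?B k \<otimes> f (k + j))" for j
      proof -
        have "(\<Oplus>i\<in>{..<d}. Q (d - i) \<otimes> f (i + (m + j))) =
            (\<Oplus>i\<in>{..<d}. Q (d - i) \<otimes> (\<Oplus>k\<in>{..<Suc d}. A i k \<otimes> f (k + j)))"
          using c A by (intro finsum_cong') (auto simp: add.assoc[symmetric] intro!: finsum_closed)
        also have "\<dots> = (\<Oplus>i\<in>{..<d}. \<Oplus>k\<in>{..<Suc d}. Q (d - i) \<otimes> A i k \<otimes> f (k + j))"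
          using c A by (intro finsum_cong')
            (auto simp: m_assoc finsum_rdistr Pi_def simp del: lessThan_Suc intro!: finsum_closed)
        also have "\<dots> = (\<Oplus>k\<in>{..<Suc d}. \<Oplus>i\<in>{..<d}. Q (d - i) \<otimes> A i k \<otimes> f (k + j))"
          using c A by (intro finsum_finsum_swap) auto
        also have "\<dots> = (\<Oplus>k\<in>{..<Suc d}. (\<Oplus>i\<in>{..<d}. Q (d - i) \<otimes> A i k) \<otimes> f (k + j))"
          using c A by (intro finsum_cong') (auto simp: finsum_ldistr Pi_def intro!: finsum_closed)
        finally have "f (r + j) = \<ominus> (\<Oplus>k\<in>{..<Suc d}. (\<Oplus>i\<in>{..<d}. Q (d - i) \<otimes> A i k) \<otimes> f (k + j))"
          using rec[of "m + j"] m by (simp add: add.assoc)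
        also have "\<dots> = (\<ominus> \<one>) \<otimes> (\<Oplus>k\<in>{..<Suc d}. (\<Oplus>i\<in>{..<d}. Q (d - i) \<otimes> A i k) \<otimes> f (k + j))"
          using B c by (subst l_minus) (auto simp del: lessThan_Suc intro!: finsum_closed)
        also have "\<dots> = (\<Oplus>k\<in>{..<Suc d}. (\<ominus> \<one>) \<otimes> ((\<Oplus>i\<in>{..<d}. Q (d - i) \<otimes> A i k) \<otimes> f (k + j)))"
          using B c by (intro finsum_rdistr) auto
        also have "\<dots> = (\<Oplus>k\<in>{..<Suc d}. ?B k \<otimes> f (k + j))"
          using B c by (intro finsum_cong') (auto simp: l_minus)
        finally show ?thesis .
      qed
      then show ?thesis using B by (intro exI[of _ ?B]) auto
    qed
  qed
  then obtain A where A: "\<And>r k. A r k \<in> carrier R"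
    "\<And>r j. f (r + j) = (\<Oplus>k\<in>{..<Suc d}. A r k \<otimes> f (k + j))" by metis
  have "ring_det R (Suc d + 1) (\<lambda>i j. hankel f (r i) (s j)) = \<zero>" for r s
    unfolding hankel_def by (subst A(2)) (rule ring_det_row_span; simp add: A(1) c)
  then have "minors_vanish R (Suc d + 1) (hankel f)" by (simp add: minors_vanish_def)
  then show "f \<in> WJ_set R" using f unfolding WJ_set_def by (auto intro!: exI[of _ "Suc d"])
qed

end

section \<open>Recurrences and Hankel determinants over a domain\<close>

context domain begin

text \<open>A denominator of degree at most \<open>d\<close> is a nontrivial linear relation among
  \<open>d + 1\<close> consecutive rows of the Hankel matrix, valid from some column on; the shift
  \<open>N\<close> absorbs the degree of the numerator. Over a domain such a relation exists iff all
  determinants formed from these rows vanish. The right-hand side mentions determinants only and is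
  therefore insensitive to injective extensions of the ring.\<close>

lemma recurrent_iff_minors:
  assumes f: "f \<in> carrier (ps_ring R)"
  shows "recurrent R f d \<longleftrightarrow> (\<exists>N. \<forall>c. ring_det R (Suc d) (\<lambda>i j. f (i + N + c j)) = \<zero>)"
proof
  assume "recurrent R f d"
  then obtain Q t where Q: "denominator R f d Q" "Q t \<noteq> \<zero>" by (auto simp: recurrent_def)
  then obtain N where N: "\<And>n. n > N \<Longrightarrow> (f \<otimes>\<^bsub>ps_ring R\<^esub> Q) n = \<zero>"
    by (auto simp: denominator_def up_iff)
  have Qc: "Q \<in> carrier (ps_ring R)" "\<And>t. t > d \<Longrightarrow> Q t = \<zero>" using Q by (auto simp: denominator_def)
  then have "t \<le> d" using Q(2) by (meson not_le)
  have "ring_det R (Suc d) (\<lambda>i j. f (i + Suc N + c j)) = \<zero>" for c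
  proof (rule ring_det_dependent_rows[where q = "\<lambda>i. Q (d - i)" and k = "d - t"])
    show "Q (d - (d - t)) \<noteq> \<zero>" using Q \<open>t \<le> d\<close> by simp
    fix j assume "j < Suc d"
    show "(\<Oplus>i\<in>{..<Suc d}. Q (d - i) \<otimes> f (i + Suc N + c j)) = \<zero>"
      using ps_mult_poly_nth[OF f Qc, of d "Suc N + c j"] N[of "d + (Suc N + c j)"]
      by (simp add: lessThan_Suc_atMost add.assoc)
  qed (use f Qc(1) in \<open>auto simp: ps_simps\<close>)
  then show "\<exists>N. \<forall>c. ring_det R (Suc d) (\<lambda>i j. f (i + N + c j)) = \<zero>" by blast
next
  assume "\<exists>N. \<forall>c. ring_det R (Suc d) (\<lambda>i j. f (i + N + c j)) = \<zero>"
  then obtain N where N: "\<And>c. ring_det R (Suc d) (\<lambda>i j. f (i + N + c j)) = \<zero>" by blast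
  have fc: "f n \<in> carrier R" for n using f by (simp add: ps_simps)
  \<comment> \<open>The contrapositive of \<open>independent_minor\<close>: no choice of columns
    gives a nonzero determinant, so the rows are dependent.\<close>
  obtain q k where q: "\<And>i. q i \<in> carrier R" "\<And>j. (\<Oplus>i\<in>{..<Suc d}. q i \<otimes> f (i + N + j)) = \<zero>"
    "k < Suc d" "q k \<noteq> \<zero>"
    using independent_minor[of "\<lambda>i j. f (i + N + j)" "Suc d"] N fc by blast
  \<comment> \<open>Lists the coefficients of the relation backwards, to match the index
    \<open>d - i\<close> in \<open>ps_mult_poly_nth\<close>.\<close>
  define Q where "Q t = (if t \<le> d then q (d - t) else \<zero>)" for t
  have Q: "Q \<in> carrier (ps_ring R)" "\<And>t. t > d \<Longrightarrow> Q t = \<zero>" using q by (auto simp: Q_def ps_simps)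
  have "(f \<otimes>\<^bsub>ps_ring R\<^esub> Q) (d + (N + j)) = (\<Oplus>i\<in>{..<Suc d}. q i \<otimes> f (i + N + j))" for j
    unfolding ps_mult_poly_nth[OF f Q, of d "N + j", simplified] lessThan_Suc_atMost
    using q(1) fc by (intro finsum_cong') (auto simp: Q_def add.assoc)
  then have z: "(f \<otimes>\<^bsub>ps_ring R\<^esub> Q) (d + (N + j)) = \<zero>" for j using q by simp
  have "(f \<otimes>\<^bsub>ps_ring R\<^esub> Q) n = \<zero>" if "n > d + N" for n
    using z[of "n - d - N"] that by simp
  then have "denominator R f d Q"
    using Q f by (auto simp: denominator_def up_iff ps_mult_closed_nth)
  moreover have "Q (d - k) \<noteq> \<zero>" using q by (simp add: Q_def)
  ultimately show "recurrent R f d" by (auto simp: recurrent_def)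
qed

lemma ps_cancel:
  assumes D: "D \<in> carrier (ps_ring R)" "D 0 \<noteq> \<zero>" and x: "x \<in> carrier (ps_ring R)"
    and "D \<otimes>\<^bsub>ps_ring R\<^esub> x = \<zero>\<^bsub>ps_ring R\<^esub>"
  shows "x = \<zero>\<^bsub>ps_ring R\<^esub>"
proof
  fix n show "x n = \<zero>\<^bsub>ps_ring R\<^esub> n"
  proof (induction n rule: less_induct)
    case (less n)
    have c: "D k \<in> carrier R" "x k \<in> carrier R" for k using D x by (auto simp: ps_simps)
    have "\<zero> = (\<Oplus>i\<in>{..n}. D i \<otimes> x (n - i))"
      using assms(4) by (metis ps_simps(2,4))
    also have "\<dots> = (\<Oplus>i\<in>{..n}. if 0 = i then D i \<otimes> x (n - i) else \<zero>)"
      using less c by (intro finsum_cong') (auto simp: ps_simps)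
    also have "\<dots> = D 0 \<otimes> x n"
      using c by (subst finsum_singleton) auto
    finally show ?case using D c integral[of "D 0" "x n"] by (simp add: ps_simps)
  qed
qed

end

text \<open>Minimality is used twice. A minimal denominator with constant term 0 would be divisible
  by \<open>T\<close>, so the constant term can be normalised to 1. A common factor of numerator and
  denominator cancels and leaves a denominator of smaller degree, unless the factor is
  constant.\<close>

lemma (in field) reduced_denominator:
  assumes f: "f \<in> carrier (ps_ring R)" and d: "recurrence_order R f d"
  obtains Q where "denominator R f d Q" "Q 0 = \<one>" "coprime_in (UP R) (f \<otimes>\<^bsub>ps_ring R\<^esub> Q) Q"
proof -
  have up: "carrier (UP R) = up R" and zUP: "\<zero>\<^bsub>UP R\<^esub> = (\<lambda>_. \<zero>)"
    and cf: "\<And>p n. p \<in> carrier (UP R) \<Longrightarrow> up_ring.coeff (UP R) p n = p n"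
    by (simp_all add: UP_def)
  have mult: "p \<otimes>\<^bsub>UP R\<^esub> q = p \<otimes>\<^bsub>ps_ring R\<^esub> q" if "p \<in> carrier (UP R)" "q \<in> carrier (UP R)" for p q
    using that unfolding up by (rule UP_mult)
  interpret U: UP_domain R "UP R" by unfold_locales
  interpret P: cring "ps_ring R" by (rule ps_cring)
  obtain Q0 t where Q0: "denominator R f d Q0" "Q0 t \<noteq> \<zero>"
    using d by (auto simp: recurrence_order_def recurrent_def)
  have c0: "Q0 n \<in> carrier R" for n using Q0 by (simp add: denominator_def ps_simps)
  have "Q0 0 \<noteq> \<zero>"
  proof
    assume z: "Q0 0 = \<zero>"
    \<comment> \<open>The zero denominator has the same constant term as \<open>Q0\<close>, so
      uniqueness would force \<open>Q0\<close> to vanish.\<close>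
    then have "denominator R f d (\<lambda>_. \<zero>)"
      using denominator_smult[OF f Q0(1), of \<zero>] c0 by simp
    then have "Q0 = (\<lambda>_. \<zero>)"
      using d z by (intro denominator_unique[OF f _ Q0(1)]) (simp_all add: recurrence_order_def)
    then show False using Q0 by simp
  qed
  then have u: "inv (Q0 0) \<in> carrier R" "inv (Q0 0) \<otimes> Q0 0 = \<one>"
    using c0[of 0] field_Units by auto
  define Q where "Q t = inv (Q0 0) \<otimes> Q0 t" for t
  have Q: "denominator R f d Q" unfolding Q_def by (intro denominator_smult f Q0 u)
  have Q1: "Q 0 = \<one>" by (simp add: Q_def u)
  have QU: "Q \<in> carrier (UP R)"
    using Q unfolding denominator_def up_iff ps_simps(1) by blast
  let ?P = "f \<otimes>\<^bsub>ps_ring R\<^esub> Q"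
  have PU: "?P \<in> carrier (UP R)" using Q by (simp add: denominator_def)
  have "D \<in> Units (UP R)" if D: "D \<in> carrier (UP R)" "D divides\<^bsub>UP R\<^esub> ?P" "D divides\<^bsub>UP R\<^esub> Q" for D
  proof -
    obtain E where E: "E \<in> carrier (UP R)" "Q = D \<otimes>\<^bsub>UP R\<^esub> E" using D(3) by (auto simp: factor_def)
    obtain E' where E': "E' \<in> carrier (UP R)" "?P = D \<otimes>\<^bsub>UP R\<^esub> E'" using D(2) by (auto simp: factor_def)
    note ps = carrier_UP_ps[OF D(1)] carrier_UP_ps[OF E(1)] carrier_UP_ps[OF E'(1)]
    have cl: "D n \<in> carrier R" "E n \<in> carrier R" for n using ps by (auto simp: ps_simps)
    have DE: "D 0 \<otimes> E 0 = \<one>"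
      using Q1 E ps D by (simp add: mult ps_mult_0)
    then have nz: "D 0 \<noteq> \<zero>" "E 0 \<noteq> \<zero>" using cl by auto
    \<comment> \<open>Cancelling \<open>D\<close> among power series shows that the cofactor
      \<open>E\<close> is itself a denominator, with numerator \<open>E'\<close>.\<close>
    have "D \<otimes>\<^bsub>ps_ring R\<^esub> (f \<otimes>\<^bsub>ps_ring R\<^esub> E) = D \<otimes>\<^bsub>ps_ring R\<^esub> E'"
      using E E' D(1) f ps by (simp add: mult P.m_lcomm)
    then have "D \<otimes>\<^bsub>ps_ring R\<^esub> (f \<otimes>\<^bsub>ps_ring R\<^esub> E \<ominus>\<^bsub>ps_ring R\<^esub> E') = \<zero>\<^bsub>ps_ring R\<^esub>"
      by (rule P.mult_minus_eq_zero[OF ps(1) ps_m_closed[OF f ps(2)] ps(3)])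
    then have "f \<otimes>\<^bsub>ps_ring R\<^esub> E \<ominus>\<^bsub>ps_ring R\<^esub> E' = \<zero>\<^bsub>ps_ring R\<^esub>"
      by (rule ps_cancel[OF ps(1) nz(1) P.minus_closed[OF ps_m_closed[OF f ps(2)] ps(3)]])
    then have fE: "f \<otimes>\<^bsub>ps_ring R\<^esub> E = E'"
      by (simp only: P.r_right_minus_eq[OF ps_m_closed[OF f ps(2)] ps(3)])
    have nzU: "D \<noteq> \<zero>\<^bsub>UP R\<^esub>" "E \<noteq> \<zero>\<^bsub>UP R\<^esub>" using nz unfolding zUP by auto
    then have dg: "UnivPoly.deg R Q = UnivPoly.deg R D + UnivPoly.deg R E" unfolding E(2) using D(1) E(1) by (rule U.deg_mult)
    have "UnivPoly.deg R Q \<le> d"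
      using Q by (intro U.deg_aboveI[OF _ QU]) (simp add: cf[OF QU] denominator_def)
    have "UnivPoly.deg R D = 0"
    proof (rule ccontr)
      assume "UnivPoly.deg R D \<noteq> 0"
      then have lt: "UnivPoly.deg R E < d" using dg \<open>UnivPoly.deg R Q \<le> d\<close> by simp
      have "E t = \<zero>" if "t > UnivPoly.deg R E" for t
        using U.deg_aboveD[OF that E(1)] by (simp only: cf[OF E(1)])
      then have "denominator R f (UnivPoly.deg R E) E"
        using ps(2) E'(1) by (simp add: denominator_def fE)
      then have "recurrent R f (UnivPoly.deg R E)" using nz by (auto simp: recurrent_def)
      then show False using d lt by (auto simp: recurrence_order_def)
    qed
    \<comment> \<open>A divisor of degree 0 is a constant, and \<open>DE\<close> supplies its
      inverse \<open>E 0\<close>.\<close>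
    then have "D = up_ring.monom (UP R) (D 0) 0"
      by (rule U.deg_zero_impl_monom[OF D(1), unfolded cf[OF D(1)]])
    moreover have "up_ring.monom (UP R) (D 0) 0 \<otimes>\<^bsub>UP R\<^esub> up_ring.monom (UP R) (E 0) 0 = \<one>\<^bsub>UP R\<^esub>"
      using U.monom_mult[of "D 0" "E 0" 0 0] cl by (simp only: DE add_0 U.monom_one)
    ultimately have "D \<otimes>\<^bsub>UP R\<^esub> up_ring.monom (UP R) (E 0) 0 = \<one>\<^bsub>UP R\<^esub>" by argo
    moreover have "up_ring.monom (UP R) (E 0) 0 \<in> carrier (UP R)"
      using cl by (intro U.monom_closed)
    ultimately show ?thesis
      using D(1) U.UP_m_comm[OF D(1), of "up_ring.monom (UP R) (E 0) 0"] unfolding Units_def by auto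
  qed
  then have "coprime_in (UP R) ?P Q" by (auto simp: coprime_in_def)
  then show ?thesis using that Q Q1 by blast
qed

text \<open>A denominator over \<open>S\<close> need not come from \<open>R\<close>, but the
  determinant criterion descends: \<open>h\<close> carries determinants to determinants and, being
  injective, detects their vanishing.\<close>

lemma recurrent_hom:
  assumes "ring_hom_cring R S h" "inj_on h (carrier R)" "domain R" "domain S"
    and f: "f \<in> carrier (ps_ring R)"
  shows "recurrent S (h \<circ> f) d \<longleftrightarrow> recurrent R f d"
proof -
  interpret R: domain R by fact
  interpret S: domain S by fact
  interpret h: ring_hom_cring R S h by fact
  have fc: "f n \<in> carrier R" for n using f by (simp add: ps_simps)
  have *: "ring_det S (Suc d) (\<lambda>i j. h (f (i + N + c j))) = \<zero>\<^bsub>S\<^esub> \<longleftrightarrow>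
      ring_det R (Suc d) (\<lambda>i j. f (i + N + c j)) = \<zero>\<^bsub>R\<^esub>" for N c
  proof -
    have cl: "ring_det R (Suc d) (\<lambda>i j. f (i + N + c j)) \<in> carrier R"
      by (rule R.ring_det_closed) (rule fc)
    have "h (ring_det R (Suc d) (\<lambda>i j. f (i + N + c j))) = ring_det S (Suc d) (\<lambda>i j. h (f (i + N + c j)))"
      by (rule h.hom_ring_det) (rule fc)
    then show ?thesis using inj_onD[OF assms(2) _ cl R.zero_closed] h.hom_zero by metis
  qed
  have "h \<circ> f \<in> carrier (ps_ring S)" using f by (rule h.hom_ps_closed)
  then show ?thesis
    by (simp only: R.recurrent_iff_minors[OF f] S.recurrent_iff_minors comp_apply *)
qed

lemma recurrence_order_hom:
  assumes "ring_hom_cring R S h" "inj_on h (carrier R)" "domain R" "domain S"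
    and f: "f \<in> carrier (ps_ring R)"
  shows "recurrence_order S (h \<circ> f) d \<longleftrightarrow> recurrence_order R f d"
  using recurrent_hom[OF assms] by (simp add: recurrence_order_def)

text \<open>Vanishing of the minors of a given size is detected by an injection. Applied to a
  restriction map, this tests membership on one open subset.\<close>

lemma (in ring_hom_cring) WJ_hom_inj:
  assumes "inj_on h (carrier R)" "f \<in> witt_set R" "h \<circ> f \<in> WJ_set S"
  shows "f \<in> WJ_set R"
proof -
  have fc: "f n \<in> carrier R" for n using assms by (simp add: witt_set_def ps_simps)
  have e: "ring_det S m (\<lambda>i j. h (hankel f (r i) (c j))) = h (ring_det R m (\<lambda>i j. hankel f (r i) (c j)))" for m r c
    by (rule hom_ring_det[symmetric]) (simp add: hankel_def fc)
  have cl: "ring_det R m (\<lambda>i j. hankel f (r i) (c j)) \<in> carrier R" for m r c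
    by (rule R.ring_det_closed) (simp add: hankel_def fc)
  have z: "h x = \<zero>\<^bsub>S\<^esub> \<Longrightarrow> x \<in> carrier R \<Longrightarrow> x = \<zero>\<^bsub>R\<^esub>" for x
    using inj_onD[OF assms(1), of x "\<zero>\<^bsub>R\<^esub>"] by simp
  obtain n where "n \<ge> 1" "minors_vanish S (n + 1) (hankel (h \<circ> f))"
    using assms(3) by (auto simp: WJ_set_def)
  moreover from this have "minors_vanish R (n + 1) (hankel f)"
    using z[OF _ cl] e by (auto simp: minors_vanish_def hankel_def)
  ultimately show ?thesis using assms(2) by (auto simp: WJ_set_def)
qed

section \<open>Localisations\<close>

locale localizing_set = cring R for R (structure) +
  fixes S
  assumes sub: "S \<subseteq> carrier R" and one_mem: "\<one> \<in> S"
    and mult_mem: "\<And>s t. s \<in> S \<Longrightarrow> t \<in> S \<Longrightarrow> s \<otimes> t \<in> S"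
begin

lemma S_carrier: "s \<in> S \<Longrightarrow> s \<in> carrier R"
  using sub by blast

lemma equiv_loc_rel: "equiv (carrier R \<times> S) (loc_rel R S)"
proof (rule equivI)
  show "loc_rel R S \<subseteq> (carrier R \<times> S) \<times> (carrier R \<times> S)"
    by (auto simp: loc_rel_def)
  show "refl_on (carrier R \<times> S) (loc_rel R S)"
    using one_mem by (auto simp: refl_on_def loc_rel_def)
  show "sym (loc_rel R S)"
    unfolding sym_def loc_rel_def by (fastforce simp: eq_commute)
  show "trans (loc_rel R S)"
    unfolding trans_def
  proof (clarify)
    fix a s b t c r
    assume "((a, s), b, t) \<in> loc_rel R S" "((b, t), c, r) \<in> loc_rel R S"
    then obtain u v where c: "a \<in> carrier R" "b \<in> carrier R" "c \<in> carrier R"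
      and S: "s \<in> S" "t \<in> S" "r \<in> S" "u \<in> S" "v \<in> S"
      and u: "u \<otimes> (a \<otimes> t) = u \<otimes> (b \<otimes> s)" and v: "v \<otimes> (b \<otimes> r) = v \<otimes> (c \<otimes> t)"
      by (auto simp: loc_rel_def)
    note cS = S[THEN S_carrier]
    have "(u \<otimes> v \<otimes> t) \<otimes> (a \<otimes> r) = (v \<otimes> r) \<otimes> (u \<otimes> (a \<otimes> t))"
      using c cS by (simp add: m_ac)
    also have "\<dots> = (u \<otimes> s) \<otimes> (v \<otimes> (b \<otimes> r))"
      unfolding u using c cS by (simp add: m_ac)
    also have "\<dots> = (u \<otimes> v \<otimes> t) \<otimes> (c \<otimes> s)"
      unfolding v using c cS by (simp add: m_ac)
    finally show "((a, s), c, r) \<in> loc_rel R S"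
      using c S mult_mem unfolding loc_rel_def by blast
  qed
qed

lemma loc_frac_eq_iff:
  assumes "a \<in> carrier R" "b \<in> carrier R" "s \<in> S" "t \<in> S"
  shows "loc_frac R S a s = loc_frac R S b t \<longleftrightarrow> (\<exists>u\<in>S. u \<otimes> (a \<otimes> t) = u \<otimes> (b \<otimes> s))"
proof -
  have "loc_frac R S a s = loc_frac R S b t \<longleftrightarrow> ((a, s), (b, t)) \<in> loc_rel R S"
    unfolding loc_frac_def using assms by (intro eq_equiv_class_iff[OF equiv_loc_rel]) auto
  then show ?thesis using assms by (simp add: loc_rel_def)
qed

lemma loc_frac_mem_iff:
  assumes "a \<in> carrier R" "s \<in> S"
  shows "(b, t) \<in> loc_frac R S a s \<longleftrightarrow>
    b \<in> carrier R \<and> t \<in> S \<and> loc_frac R S a s = loc_frac R S b t"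
proof -
  have "(b, t) \<in> loc_frac R S a s \<longleftrightarrow>
      b \<in> carrier R \<and> t \<in> S \<and> (\<exists>u\<in>S. u \<otimes> (a \<otimes> t) = u \<otimes> (b \<otimes> s))"
    using assms by (simp add: loc_frac_def loc_rel_def)
  then show ?thesis using assms loc_frac_eq_iff[of a b s t] by blast
qed

lemma carrier_localization:
  "carrier (localization R S) = {loc_frac R S a s | a s. a \<in> carrier R \<and> s \<in> S}"
  by (auto simp: localization_def quotient_def loc_frac_def)

lemma localization_one: "\<one>\<^bsub>localization R S\<^esub> = loc_frac R S \<one> \<one>"
  and localization_zero: "\<zero>\<^bsub>localization R S\<^esub> = loc_frac R S \<zero> \<one>"
  by (simp_all add: localization_def)

text \<open>The operations of \<open>localization\<close> are unions over all representatives of two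
  classes; if the value does not depend on the representatives, such a union collapses to
  it.\<close>

lemma loc_frac_UN2:
  assumes "a \<in> carrier R" "b \<in> carrier R" "s \<in> S" "t \<in> S"
    and "\<And>a' s' b' t'. a' \<in> carrier R \<Longrightarrow> s' \<in> S \<Longrightarrow> b' \<in> carrier R \<Longrightarrow> t' \<in> S \<Longrightarrow>
      loc_frac R S a s = loc_frac R S a' s' \<Longrightarrow> loc_frac R S b t = loc_frac R S b' t' \<Longrightarrow>
      F a' s' b' t' = F a s b t"
  shows "(\<Union>(a', s')\<in>loc_frac R S a s. \<Union>(b', t')\<in>loc_frac R S b t. F a' s' b' t') = F a s b t"
proof -
  have m: "(a, s) \<in> loc_frac R S a s" "(b, t) \<in> loc_frac R S b t"
    unfolding loc_frac_mem_iff[OF assms(1,3)] loc_frac_mem_iff[OF assms(2,4)]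
    using assms(1-4) by simp_all
  have F: "F a' s' b' t' = F a s b t"
    if "(a', s') \<in> loc_frac R S a s" "(b', t') \<in> loc_frac R S b t" for a' s' b' t'
    using that unfolding loc_frac_mem_iff[OF assms(1,3)] loc_frac_mem_iff[OF assms(2,4)]
    by (intro assms(5)) auto
  show ?thesis
  proof (intro equalityI subsetI)
    fix x assume "x \<in> (\<Union>(a', s')\<in>loc_frac R S a s. \<Union>(b', t')\<in>loc_frac R S b t. F a' s' b' t')"
    then show "x \<in> F a s b t" using F by fast
  next
    fix x assume "x \<in> F a s b t"
    then show "x \<in> (\<Union>(a', s')\<in>loc_frac R S a s. \<Union>(b', t')\<in>loc_frac R S b t. F a' s' b' t')"
      using m by fast
  qed
qed

lemma localization_mult:
  assumes "a \<in> carrier R" "b \<in> carrier R" "s \<in> S" "t \<in> S"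
  shows "loc_frac R S a s \<otimes>\<^bsub>localization R S\<^esub> loc_frac R S b t = loc_frac R S (a \<otimes> b) (s \<otimes> t)"
  unfolding localization_def monoid.simps
proof (rule loc_frac_UN2[OF assms])
  fix a' s' b' t'
  assume p: "a' \<in> carrier R" "s' \<in> S" "b' \<in> carrier R" "t' \<in> S"
    "loc_frac R S a s = loc_frac R S a' s'" "loc_frac R S b t = loc_frac R S b' t'"
  then obtain u v where uv: "u \<in> S" "v \<in> S"
    and u: "u \<otimes> (a \<otimes> s') = u \<otimes> (a' \<otimes> s)" and v: "v \<otimes> (b \<otimes> t') = v \<otimes> (b' \<otimes> t)"
    using assms by (auto simp: loc_frac_eq_iff)
  note c = assms(1,2) p(1,3) assms(3,4)[THEN S_carrier] p(2,4)[THEN S_carrier] uv[THEN S_carrier]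
  have "(u \<otimes> v) \<otimes> ((a' \<otimes> b') \<otimes> (s \<otimes> t)) = (u \<otimes> (a' \<otimes> s)) \<otimes> (v \<otimes> (b' \<otimes> t))"
    using c by (simp add: m_ac)
  also have "\<dots> = (u \<otimes> v) \<otimes> ((a \<otimes> b) \<otimes> (s' \<otimes> t'))"
    unfolding u[symmetric] v[symmetric] using c by (simp add: m_ac)
  finally show "loc_frac R S (a' \<otimes> b') (s' \<otimes> t') = loc_frac R S (a \<otimes> b) (s \<otimes> t)"
    using c p assms uv mult_mem by (subst loc_frac_eq_iff) auto
qed

lemma localization_add:
  assumes "a \<in> carrier R" "b \<in> carrier R" "s \<in> S" "t \<in> S"
  shows "loc_frac R S a s \<oplus>\<^bsub>localization R S\<^esub> loc_frac R S b t =
    loc_frac R S (a \<otimes> t \<oplus> b \<otimes> s) (s \<otimes> t)"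
  unfolding localization_def ring.simps
proof (rule loc_frac_UN2[OF assms])
  fix a' s' b' t'
  assume p: "a' \<in> carrier R" "s' \<in> S" "b' \<in> carrier R" "t' \<in> S"
    "loc_frac R S a s = loc_frac R S a' s'" "loc_frac R S b t = loc_frac R S b' t'"
  then obtain u v where uv: "u \<in> S" "v \<in> S"
    and u: "u \<otimes> (a \<otimes> s') = u \<otimes> (a' \<otimes> s)" and v: "v \<otimes> (b \<otimes> t') = v \<otimes> (b' \<otimes> t)"
    using assms by (auto simp: loc_frac_eq_iff)
  note c = assms(1,2) p(1,3) assms(3,4)[THEN S_carrier] p(2,4)[THEN S_carrier] uv[THEN S_carrier]
  have "(u \<otimes> v) \<otimes> ((a' \<otimes> t' \<oplus> b' \<otimes> s') \<otimes> (s \<otimes> t)) =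
      (v \<otimes> t \<otimes> t') \<otimes> (u \<otimes> (a' \<otimes> s)) \<oplus> (u \<otimes> s \<otimes> s') \<otimes> (v \<otimes> (b' \<otimes> t))"
    using c by algebra
  also have "\<dots> = (u \<otimes> v) \<otimes> ((a \<otimes> t \<oplus> b \<otimes> s) \<otimes> (s' \<otimes> t'))"
    unfolding u[symmetric] v[symmetric] using c by algebra
  finally show "loc_frac R S (a' \<otimes> t' \<oplus> b' \<otimes> s') (s' \<otimes> t') = loc_frac R S (a \<otimes> t \<oplus> b \<otimes> s) (s \<otimes> t)"
    using c p assms uv mult_mem by (subst loc_frac_eq_iff) auto
qed

lemma loc_frac_carrier: "a \<in> carrier R \<Longrightarrow> s \<in> S \<Longrightarrow> loc_frac R S a s \<in> carrier (localization R S)"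
  by (auto simp: carrier_localization)

end

locale domain_localizing_set = localizing_set + domain +
  assumes zero_notin: "\<zero> \<notin> S"
begin

lemma loc_frac_eq:
  assumes "a \<in> carrier R" "b \<in> carrier R" "s \<in> S" "t \<in> S"
  shows "loc_frac R S a s = loc_frac R S b t \<longleftrightarrow> a \<otimes> t = b \<otimes> s"
proof -
  have "u \<otimes> (a \<otimes> t) = u \<otimes> (b \<otimes> s) \<longleftrightarrow> a \<otimes> t = b \<otimes> s" if "u \<in> S" for u
    using assms that S_carrier zero_notin by (intro m_lcancel) auto
  then show ?thesis using assms one_mem by (auto simp: loc_frac_eq_iff)
qed

end

lemma (in cring) localizing_set_prime: "primeideal p R \<Longrightarrow> localizing_set R (carrier R - p)"
proof -
  assume "primeideal p R"
  then interpret p: primeideal p R .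
  show ?thesis
  proof
    show "\<one> \<in> carrier R - p" using p.one_imp_carrier p.I_notcarr by auto
  qed (use p.I_prime in auto)
qed

lemma (in domain) domain_localizing_set_prime:
  assumes "primeideal p R" shows "domain_localizing_set R (carrier R - p)"
proof -
  interpret localizing_set R "carrier R - p" by (rule localizing_set_prime[OF assms])
  interpret p: primeideal p R by fact
  show ?thesis by unfold_locales auto
qed

section \<open>Fraction fields and the strong Fatou property\<close>

lemma (in domain) domain_localizing_set_nonzero: "domain_localizing_set R (carrier R - {\<zero>})"
  using domain_localizing_set_prime[OF zeroprimeideal] .

lemma (in domain) fraction_field_field: "field (fraction_field R)"
proof -
  interpret L: domain_localizing_set R "carrier R - {\<zero>}" by (rule domain_localizing_set_nonzero)
  let ?K = "fraction_field R" and ?f = "loc_frac R (carrier R - {\<zero>})"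
  note K = L.carrier_localization[folded fraction_field_def]
    and cl = L.loc_frac_carrier[folded fraction_field_def]
    and one = L.localization_one[folded fraction_field_def]
    and zero = L.localization_zero[folded fraction_field_def]
    and mult = L.localization_mult[folded fraction_field_def]
    and add = L.localization_add[folded fraction_field_def]
  have nz: "s \<otimes> t \<in> carrier R - {\<zero>}" if "s \<in> carrier R - {\<zero>}" "t \<in> carrier R - {\<zero>}" for s t
    using that L.mult_mem by blast
  have E: "\<exists>a s. x = ?f a s \<and> a \<in> carrier R \<and> s \<in> carrier R \<and> s \<noteq> \<zero>" if "x \<in> carrier ?K" for x
    using that by (auto simp: K)
  have eq: "?f a s = ?f b t \<longleftrightarrow> a \<otimes> t = b \<otimes> s"
    if "a \<in> carrier R" "b \<in> carrier R" "s \<in> carrier R" "s \<noteq> \<zero>" "t \<in> carrier R" "t \<noteq> \<zero>" for a b s t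
    using that by (intro L.loc_frac_eq) auto
  have cr: "cring ?K"
  proof (rule cringI)
    show "abelian_group ?K"
    proof (rule abelian_groupI)
      show "\<zero>\<^bsub>?K\<^esub> \<in> carrier ?K" by (simp add: zero cl)
    next
      fix x y assume "x \<in> carrier ?K" "y \<in> carrier ?K"
      then obtain a s b t where xy: "x = ?f a s" "a \<in> carrier R" "s \<in> carrier R" "s \<noteq> \<zero>"
        "y = ?f b t" "b \<in> carrier R" "t \<in> carrier R" "t \<noteq> \<zero>" using E by metis
      show "x \<oplus>\<^bsub>?K\<^esub> y \<in> carrier ?K" using xy nz by (simp add: add cl)
      show "x \<oplus>\<^bsub>?K\<^esub> y = y \<oplus>\<^bsub>?K\<^esub> x" using xy by (simp add: add a_comm m_comm)
      fix z assume "z \<in> carrier ?K"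
      then obtain c r where z: "z = ?f c r" "c \<in> carrier R" "r \<in> carrier R" "r \<noteq> \<zero>" using E by metis
      have "(a \<otimes> t \<oplus> b \<otimes> s) \<otimes> r \<oplus> c \<otimes> (s \<otimes> t) = a \<otimes> (t \<otimes> r) \<oplus> (b \<otimes> r \<oplus> c \<otimes> t) \<otimes> s"
        using xy z by algebra
      then show "x \<oplus>\<^bsub>?K\<^esub> y \<oplus>\<^bsub>?K\<^esub> z = x \<oplus>\<^bsub>?K\<^esub> (y \<oplus>\<^bsub>?K\<^esub> z)"
        using xy z nz by (simp add: add m_assoc)
    next
      fix x assume "x \<in> carrier ?K"
      then obtain a s where x: "x = ?f a s" "a \<in> carrier R" "s \<in> carrier R" "s \<noteq> \<zero>" using E by metis
      show "\<zero>\<^bsub>?K\<^esub> \<oplus>\<^bsub>?K\<^esub> x = x" using x by (simp add: zero add)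
      show "\<exists>y\<in>carrier ?K. y \<oplus>\<^bsub>?K\<^esub> x = \<zero>\<^bsub>?K\<^esub>"
        using x nz cl by (intro bexI[of _ "?f (\<ominus> a) s"]) (simp_all add: zero add eq l_minus l_neg)
    qed
    show "comm_monoid ?K"
    proof (rule comm_monoidI)
      show "\<one>\<^bsub>?K\<^esub> \<in> carrier ?K" by (simp add: one cl)
    next
      fix x y assume "x \<in> carrier ?K" "y \<in> carrier ?K"
      then obtain a s b t where xy: "x = ?f a s" "a \<in> carrier R" "s \<in> carrier R" "s \<noteq> \<zero>"
        "y = ?f b t" "b \<in> carrier R" "t \<in> carrier R" "t \<noteq> \<zero>" using E by metis
      show "x \<otimes>\<^bsub>?K\<^esub> y \<in> carrier ?K" using xy nz by (simp add: mult cl)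
      show "x \<otimes>\<^bsub>?K\<^esub> y = y \<otimes>\<^bsub>?K\<^esub> x" using xy by (simp add: mult m_comm)
      fix z assume "z \<in> carrier ?K"
      then obtain c r where z: "z = ?f c r" "c \<in> carrier R" "r \<in> carrier R" "r \<noteq> \<zero>" using E by metis
      show "x \<otimes>\<^bsub>?K\<^esub> y \<otimes>\<^bsub>?K\<^esub> z = x \<otimes>\<^bsub>?K\<^esub> (y \<otimes>\<^bsub>?K\<^esub> z)"
        using xy z nz by (simp add: mult m_assoc)
    next
      fix x assume "x \<in> carrier ?K"
      then obtain a s where x: "x = ?f a s" "a \<in> carrier R" "s \<in> carrier R" "s \<noteq> \<zero>" using E by metis
      show "\<one>\<^bsub>?K\<^esub> \<otimes>\<^bsub>?K\<^esub> x = x" using x by (simp add: one mult)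
    qed
  next
    fix x y z assume "x \<in> carrier ?K" "y \<in> carrier ?K" "z \<in> carrier ?K"
    then obtain a s b t c r where xy: "x = ?f a s" "a \<in> carrier R" "s \<in> carrier R" "s \<noteq> \<zero>"
        "y = ?f b t" "b \<in> carrier R" "t \<in> carrier R" "t \<noteq> \<zero>"
        "z = ?f c r" "c \<in> carrier R" "r \<in> carrier R" "r \<noteq> \<zero>" using E by metis
    have "((a \<otimes> t \<oplus> b \<otimes> s) \<otimes> c) \<otimes> ((s \<otimes> r) \<otimes> (t \<otimes> r)) =
        ((a \<otimes> c) \<otimes> (t \<otimes> r) \<oplus> (b \<otimes> c) \<otimes> (s \<otimes> r)) \<otimes> ((s \<otimes> t) \<otimes> r)"
      using xy by algebra
    moreover have "(s \<otimes> t) \<otimes> r \<noteq> \<zero>" "(s \<otimes> r) \<otimes> (t \<otimes> r) \<noteq> \<zero>"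
      using xy by (simp_all add: integral_iff)
    ultimately show "(x \<oplus>\<^bsub>?K\<^esub> y) \<otimes>\<^bsub>?K\<^esub> z = x \<otimes>\<^bsub>?K\<^esub> z \<oplus>\<^bsub>?K\<^esub> y \<otimes>\<^bsub>?K\<^esub> z"
      using xy nz by (simp add: add mult eq)
  qed
  show ?thesis
  proof (rule cring.cring_fieldI2[OF cr])
    show "\<zero>\<^bsub>?K\<^esub> \<noteq> \<one>\<^bsub>?K\<^esub>" by (simp add: zero one eq)
    fix x assume "x \<in> carrier ?K" "x \<noteq> \<zero>\<^bsub>?K\<^esub>"
    moreover from this obtain a s where x: "x = ?f a s" "a \<in> carrier R" "s \<in> carrier R" "s \<noteq> \<zero>"
      using E by metis
    ultimately have "a \<noteq> \<zero>" by (auto simp: zero eq)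
    then show "\<exists>y\<in>carrier ?K. x \<otimes>\<^bsub>?K\<^esub> y = \<one>\<^bsub>?K\<^esub>"
      using x by (intro bexI[of _ "?f s a"]) (simp_all add: mult one eq cl m_comm integral_iff)
  qed
qed

lemma (in domain) to_fraction_hom: "ring_hom_cring R (fraction_field R) (to_fraction R)"
  and to_fraction_inj: "inj_on (to_fraction R) (carrier R)"
proof -
  interpret L: domain_localizing_set R "carrier R - {\<zero>}" by (rule domain_localizing_set_nonzero)
  interpret K: field "fraction_field R" by (rule fraction_field_field)
  have "to_fraction R \<in> Ring.ring_hom R (fraction_field R)"
    unfolding to_fraction_def fraction_field_def
    by (rule ring_hom_memI)
       (simp_all add: L.localization_mult L.localization_add L.localization_one L.loc_frac_carrier)
  then show "ring_hom_cring R (fraction_field R) (to_fraction R)"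
    using is_cring K.is_cring by (simp add: ring_hom_cring_def ring_hom_cring_axioms_def)
  show "inj_on (to_fraction R) (carrier R)"
    by (rule inj_onI) (simp add: to_fraction_def L.loc_frac_eq)
qed

text \<open>The order \<open>d\<close> is the same over the fraction field, where a denominator of
  degree at most \<open>d\<close> can be chosen reduced; the strong Fatou property then places its
  coefficients in \<open>A\<close>. Keeping the bound \<open>d\<close> is essential, as it makes
  denominators over different open sets comparable.\<close>

lemma strong_Fatou_denominator:
  assumes sF: "strong_Fatou_domain A" and f: "f \<in> carrier (ps_ring A)" and d: "recurrence_order A f d"
  obtains Q where "denominator A f d Q" "Q 0 = \<one>\<^bsub>A\<^esub>"
proof -
  let ?K = "fraction_field A" and ?h = "to_fraction A"
  interpret A: domain A using sF by (simp add: strong_Fatou_domain_def)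
  interpret K: field ?K by (rule A.fraction_field_field)
  interpret h: ring_hom_cring A ?K ?h by (rule A.to_fraction_hom)
  note inj = A.to_fraction_inj
  have hf: "?h \<circ> f \<in> carrier (ps_ring ?K)" using f by (rule h.hom_ps_closed)
  have "recurrence_order ?K (?h \<circ> f) d"
    using recurrence_order_hom[OF A.to_fraction_hom inj A.domain_axioms K.domain_axioms f] d by simp
  then obtain Q where Q: "denominator ?K (?h \<circ> f) d Q" "Q 0 = \<one>\<^bsub>?K\<^esub>"
    "coprime_in (UP ?K) ((?h \<circ> f) \<otimes>\<^bsub>ps_ring ?K\<^esub> Q) Q"
    by (rule K.reduced_denominator[OF hf])
  have PU: "(?h \<circ> f) \<otimes>\<^bsub>ps_ring ?K\<^esub> Q \<in> carrier (UP ?K)" and QU: "Q \<in> carrier (UP ?K)"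
    using Q(1) unfolding denominator_def K.up_iff ps_simps(1) by blast+
  have "\<forall>n. Q n \<in> ?h ` carrier A"
    using sF f PU QU Q(2,3) unfolding strong_Fatou_domain_def Let_def by blast
  define q where "q n = inv_into (carrier A) ?h (Q n)" for n
  have q: "q n \<in> carrier A" "?h (q n) = Q n" for n
    using \<open>\<forall>n. Q n \<in> ?h ` carrier A\<close> by (simp_all add: q_def inv_into_into f_inv_into_f)
  have qc: "q \<in> carrier (ps_ring A)" using q by (simp add: ps_simps)
  have hq: "?h \<circ> q = Q" using q by auto
  \<comment> \<open>Elements of \<open>A\<close> with zero image vanish; this carries the degree
    bounds of \<open>Q\<close> and of its numerator back to \<open>A\<close>.\<close>
  have z: "x = \<zero>\<^bsub>A\<^esub>" if "?h x = \<zero>\<^bsub>?K\<^esub>" "x \<in> carrier A" for x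
    using inj_onD[OF inj, of x "\<zero>\<^bsub>A\<^esub>"] that by simp
  have fq: "f \<otimes>\<^bsub>ps_ring A\<^esub> q \<in> carrier (ps_ring A)" by (rule A.ps_m_closed[OF f qc])
  have "?h \<circ> (f \<otimes>\<^bsub>ps_ring A\<^esub> q) = (?h \<circ> f) \<otimes>\<^bsub>ps_ring ?K\<^esub> Q"
    using ring_hom_mult[OF h.ps_hom f qc] by (simp only: hq)
  then have h': "?h ((f \<otimes>\<^bsub>ps_ring A\<^esub> q) n) = ((?h \<circ> f) \<otimes>\<^bsub>ps_ring ?K\<^esub> Q) n" for n
    by (metis comp_apply)
  obtain N where N: "\<And>n. n > N \<Longrightarrow> ((?h \<circ> f) \<otimes>\<^bsub>ps_ring ?K\<^esub> Q) n = \<zero>\<^bsub>?K\<^esub>"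
    using PU by (auto simp: K.up_iff)
  have fqn: "(f \<otimes>\<^bsub>ps_ring A\<^esub> q) n \<in> carrier A" for n using fq by (simp add: ps_simps(1))
  have "(f \<otimes>\<^bsub>ps_ring A\<^esub> q) n = \<zero>\<^bsub>A\<^esub>" if "n > N" for n
    by (rule z[OF _ fqn]) (simp only: h' N[OF that])
  then have "f \<otimes>\<^bsub>ps_ring A\<^esub> q \<in> carrier (UP A)"
    unfolding A.up_iff using fqn by blast
  moreover have "q t = \<zero>\<^bsub>A\<^esub>" if "t > d" for t
    using Q(1) that by (intro z) (simp_all add: q denominator_def)
  ultimately have "denominator A f d q" using qc by (simp add: denominator_def)
  moreover have "q 0 = \<one>\<^bsub>A\<^esub>"
    using inj_onD[OF inj, of "q 0" "\<one>\<^bsub>A\<^esub>"] q Q(2) by simp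
  ultimately show ?thesis using that by blast
qed

section \<open>Prime ideals and the Zariski topology\<close>

text \<open>Krull's argument: an ideal maximal among those that contain \<open>I\<close> and no
  power of \<open>g\<close> is prime. The case \<open>g = \<one>\<close> yields a prime above any
  proper ideal.\<close>

lemma (in cring) prime_avoiding_powers:
  assumes I: "ideal I R" and g: "g \<in> carrier R" "\<And>n::nat. g [^] n \<notin> I"
  obtains p where "primeideal p R" "I \<subseteq> p" "g \<notin> p"
proof -
  let ?F = "{J. ideal J R \<and> I \<subseteq> J \<and> (\<forall>n::nat. g [^] n \<notin> J)}"
  have "\<exists>M\<in>?F. \<forall>Y\<in>?F. M \<subseteq> Y \<longrightarrow> Y = M"
  proof (rule subset_Zorn_nonempty)
    show "?F \<noteq> {}" using I g by auto
    fix Ch assume ne: "Ch \<noteq> {}" and ch: "subset.chain ?F Ch"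
    have "subset.chain {I. ideal I R} Ch"
      using ch unfolding pred_on.chain_def by blast
    then have "ideal (\<Union>Ch) R" using chain_Union_is_ideal[of Ch] ne by simp
    moreover have "Ch \<subseteq> ?F" using ch unfolding pred_on.chain_def by blast
    ultimately show "\<Union>Ch \<in> ?F" using ne by blast
  qed
  then obtain M where M': "M \<in> ?F" and max': "\<forall>Y\<in>?F. M \<subseteq> Y \<longrightarrow> Y = M" ..
  from M' have M: "ideal M R" "I \<subseteq> M" "\<And>n::nat. g [^] n \<notin> M" by auto
  have max: "Y = M" if "ideal Y R" "I \<subseteq> Y" "\<forall>n::nat. g [^] n \<notin> Y" "M \<subseteq> Y" for Y
    using that max'[rule_format, of Y] by simp
  interpret M: ideal M R by fact
  \<comment> \<open>By maximality, adjoining \<open>a\<close> to \<open>M\<close> catches a power of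
    \<open>g\<close>, and the elements of the larger ideal are the \<open>m + r a\<close>.\<close>
  have pow: "\<exists>n::nat. \<exists>m\<in>M. \<exists>r\<in>carrier R. g [^] n = m \<oplus> r \<otimes> a" if a: "a \<in> carrier R" "a \<notin> M" for a
  proof -
    let ?Y = "M <+>\<^bsub>R\<^esub> PIdl a"
    have Y: "x \<in> ?Y \<longleftrightarrow> (\<exists>m\<in>M. \<exists>r\<in>carrier R. x = m \<oplus> r \<otimes> a)" for x
      unfolding set_add_def' cgenideal_def by auto
    have "ideal ?Y R" using M(1) cgenideal_ideal[OF a(1)] by (rule add_ideals)
    moreover have "M \<subseteq> ?Y"
    proof
      fix m assume "m \<in> M"
      then show "m \<in> ?Y" unfolding Y using a(1) M.a_Hcarr
        by (intro bexI[of _ m] bexI[of _ \<zero>]) auto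
    qed
    moreover have "a \<in> ?Y" unfolding Y using a(1) M.zero_closed
      by (intro bexI[of _ \<zero>] bexI[of _ \<one>]) auto
    ultimately have "\<not> (\<forall>n::nat. g [^] n \<notin> ?Y)" using max[of ?Y] M(2) a(2) by blast
    then show ?thesis unfolding Y by blast
  qed
  have "primeideal M R"
  proof (rule primeidealI)
    show "carrier R \<noteq> M" using M(3)[of 0] by auto
    fix a b assume ab: "a \<in> carrier R" "b \<in> carrier R" "a \<otimes> b \<in> M"
    show "a \<in> M \<or> b \<in> M"
    proof (rule ccontr)
      assume "\<not> (a \<in> M \<or> b \<in> M)"
      then obtain n k m m' r r' where
        1: "g [^] (n::nat) = m \<oplus> r \<otimes> a" "m \<in> M" "r \<in> carrier R" and
        2: "g [^] (k::nat) = m' \<oplus> r' \<otimes> b" "m' \<in> M" "r' \<in> carrier R"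
        using pow[of a] pow[of b] ab by blast
      note c = ab(1,2) 1(3) 2(3) M.a_Hcarr[OF 1(2)] M.a_Hcarr[OF 2(2)]
      \<comment> \<open>Multiplying out, every term has a factor \<open>m\<close>, \<open>m'\<close>
        or \<open>a b\<close>, so a power of \<open>g\<close> would lie in \<open>M\<close>.\<close>
      have "g [^] (n + k) = (m \<oplus> r \<otimes> a) \<otimes> (m' \<oplus> r' \<otimes> b)"
        using g(1) 1 2 by (simp flip: nat_pow_mult)
      also have "\<dots> = (m' \<oplus> r' \<otimes> b) \<otimes> m \<oplus> ((r \<otimes> a) \<otimes> m' \<oplus> (r \<otimes> r') \<otimes> (a \<otimes> b))"
        using c by algebra
      also have "\<dots> \<in> M"
        using M.I_l_closed[OF 1(2), of "m' \<oplus> r' \<otimes> b"] M.I_l_closed[OF 2(2), of "r \<otimes> a"]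
          M.I_l_closed[OF ab(3), of "r \<otimes> r'"] c M.a_closed by simp
      finally show False using M(3) by blast
    qed
  qed (use M(1) is_cring in auto)
  moreover have "g \<notin> M" using M(3)[of 1] g(1) by simp
  ultimately show ?thesis using that M(2) by blast
qed

definition basic_open :: "('a, 'm) ring_scheme \<Rightarrow> 'a \<Rightarrow> 'a set set" where
  "basic_open A g = {p. primeideal p A \<and> g \<notin> p}"

context cring begin

lemma basic_open_Int:
  assumes "f \<in> carrier R" "g \<in> carrier R"
  shows "basic_open R f \<inter> basic_open R g = basic_open R (f \<otimes> g)"
proof -
  have "f \<otimes> g \<in> p \<longleftrightarrow> f \<in> p \<or> g \<in> p" if "primeideal p R" for p
  proof -
    interpret p: primeideal p R by fact
    show ?thesis using assms p.I_prime p.I_l_closed p.I_r_closed by blast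
  qed
  then show ?thesis by (auto simp: basic_open_def)
qed

lemma zariski_topology_alt:
  "zariski_topology R = topology_generated_by (basic_open R ` carrier R)"
  unfolding zariski_topology_def
  by (rule arg_cong[of _ _ topology_generated_by]) (auto simp: basic_open_def prime_spectrum_def)

lemma basic_open_one: "basic_open R \<one> = prime_spectrum R"
proof -
  have "\<one> \<notin> p" if "primeideal p R" for p
    using that ideal.one_imp_carrier[of p R] primeideal.I_notcarr[of p R] primeideal.axioms(1)[of p R] by blast
  then show ?thesis by (auto simp: basic_open_def prime_spectrum_def)
qed

text \<open>The generating sets are closed under intersection by \<open>basic_open_Int\<close>, so
  they are a base of the topology and not merely a subbase.\<close>

lemma openin_zariski:
  "openin (zariski_topology R) U \<longleftrightarrow>
    (\<forall>p\<in>U. \<exists>g\<in>carrier R. p \<in> basic_open R g \<and> basic_open R g \<subseteq> U)"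
proof
  assume "openin (zariski_topology R) U"
  then have "generate_topology_on (basic_open R ` carrier R) U"
    by (simp add: zariski_topology_alt openin_topology_generated_by_iff)
  then show "\<forall>p\<in>U. \<exists>g\<in>carrier R. p \<in> basic_open R g \<and> basic_open R g \<subseteq> U"
  proof induction
    case (Int a b)
    show ?case
    proof
      fix p assume "p \<in> a \<inter> b"
      then obtain f g where "f \<in> carrier R" "p \<in> basic_open R f" "basic_open R f \<subseteq> a"
        "g \<in> carrier R" "p \<in> basic_open R g" "basic_open R g \<subseteq> b" using Int.IH by blast
      then show "\<exists>g\<in>carrier R. p \<in> basic_open R g \<and> basic_open R g \<subseteq> a \<inter> b"
        using basic_open_Int[of f g] by (intro bexI[of _ "f \<otimes> g"]) auto
    qed
  qed blast+
next
  assume "\<forall>p\<in>U. \<exists>g\<in>carrier R. p \<in> basic_open R g \<and> basic_open R g \<subseteq> U"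
  then have "U = \<Union>{basic_open R g | g. g \<in> carrier R \<and> basic_open R g \<subseteq> U}" by blast
  moreover have "openin (zariski_topology R) (basic_open R g)" if "g \<in> carrier R" for g
    using that by (auto simp: zariski_topology_alt openin_topology_generated_by_iff
        intro: generate_topology_on.Basis)
  then have "openin (zariski_topology R) (\<Union>{basic_open R g | g. g \<in> carrier R \<and> basic_open R g \<subseteq> U})"
    by (intro openin_Union) auto
  ultimately show "openin (zariski_topology R) U" by (rule ssubst)
qed

lemma openin_basic_open: "g \<in> carrier R \<Longrightarrow> openin (zariski_topology R) (basic_open R g)"
  by (auto simp: openin_zariski)

lemma topspace_zariski: "topspace (zariski_topology R) = prime_spectrum R"
  unfolding zariski_topology_alt topology_generated_by_topspace
  using basic_open_one by (auto simp: basic_open_def prime_spectrum_def)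

lemma openin_zariski_prime: "openin (zariski_topology R) U \<Longrightarrow> p \<in> U \<Longrightarrow> primeideal p R"
  using openin_subset[of "zariski_topology R" U] topspace_zariski by (auto simp: prime_spectrum_def)

end

text \<open>The zero ideal is the generic point of the spectrum: no basic open set of a nonzero
  element misses it.\<close>

lemma (in domain) zero_mem_open:
  assumes "openin (zariski_topology R) U" "U \<noteq> {}"
  shows "{\<zero>} \<in> U"
proof -
  obtain p where "p \<in> U" using assms(2) by blast
  then obtain g where p: "g \<in> carrier R" "p \<in> basic_open R g" "basic_open R g \<subseteq> U"
    using assms(1) unfolding openin_zariski by blast
  then interpret p: primeideal p R by (simp add: basic_open_def)
  have "g \<noteq> \<zero>" using p(2) p.zero_closed by (auto simp: basic_open_def)
  then have "{\<zero>} \<in> basic_open R g" using zeroprimeideal by (simp add: basic_open_def)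
  then show ?thesis using p(3) by blast
qed

section \<open>Isomorphisms of ringed spaces\<close>

lemma open_subspace_simps [simp]:
  "base (open_subspace X U) = subtopology (base X) U"
  "sect (open_subspace X U) = sect X" "restr (open_subspace X U) = restr X"
  by (simp_all add: open_subspace_def)

text \<open>The body of \<open>ringed_space_iso\<close> with its two witnesses as arguments, so that
  the maps themselves can be composed and restricted.\<close>

definition ringed_space_iso_by ::
    "('x, 'a) ringed_space \<Rightarrow> ('y, 'b) ringed_space \<Rightarrow> ('x \<Rightarrow> 'y) \<Rightarrow> ('y set \<Rightarrow> 'b \<Rightarrow> 'a) \<Rightarrow> bool" where
  "ringed_space_iso_by X Y \<phi> \<theta> \<longleftrightarrow> homeomorphic_map (base X) (base Y) \<phi> \<and>
    (\<forall>V. openin (base Y) V \<longrightarrow>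
      \<theta> V \<in> ring_iso (sect Y V) (sect X {x \<in> topspace (base X). \<phi> x \<in> V})) \<and>
    (\<forall>V W. openin (base Y) V \<and> openin (base Y) W \<and> W \<subseteq> V \<longrightarrow>
      (\<forall>s \<in> carrier (sect Y V).
        restr X {x \<in> topspace (base X). \<phi> x \<in> V} {x \<in> topspace (base X). \<phi> x \<in> W} (\<theta> V s) =
        \<theta> W (restr Y V W s)))"

lemma ringed_space_iso_iff: "ringed_space_iso X Y \<longleftrightarrow> (\<exists>\<phi> \<theta>. ringed_space_iso_by X Y \<phi> \<theta>)"
  unfolding ringed_space_iso_def ringed_space_iso_by_def Let_def ..

lemma ringed_space_iso_byD:
  assumes "ringed_space_iso_by X Y \<phi> \<theta>"
  shows "homeomorphic_map (base X) (base Y) \<phi>"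
    and "openin (base Y) V \<Longrightarrow>
      \<theta> V \<in> ring_iso (sect Y V) (sect X {x \<in> topspace (base X). \<phi> x \<in> V})"
    and "openin (base Y) V \<Longrightarrow> openin (base Y) W \<Longrightarrow> W \<subseteq> V \<Longrightarrow> s \<in> carrier (sect Y V) \<Longrightarrow>
      restr X {x \<in> topspace (base X). \<phi> x \<in> V} {x \<in> topspace (base X). \<phi> x \<in> W} (\<theta> V s) =
      \<theta> W (restr Y V W s)"
  using assms unfolding ringed_space_iso_by_def by simp_all

lemma ringed_space_iso_byI:
  assumes "homeomorphic_map (base X) (base Y) \<phi>"
    and "\<And>V. openin (base Y) V \<Longrightarrow>
      \<theta> V \<in> ring_iso (sect Y V) (sect X {x \<in> topspace (base X). \<phi> x \<in> V})"
    and "\<And>V W s. openin (base Y) V \<Longrightarrow> openin (base Y) W \<Longrightarrow> W \<subseteq> V \<Longrightarrow> s \<in> carrier (sect Y V) \<Longrightarrow>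
      restr X {x \<in> topspace (base X). \<phi> x \<in> V} {x \<in> topspace (base X). \<phi> x \<in> W} (\<theta> V s) =
      \<theta> W (restr Y V W s)"
  shows "ringed_space_iso_by X Y \<phi> \<theta>"
  unfolding ringed_space_iso_by_def
  by (intro conjI allI impI ballI assms; (elim conjE)?; assumption)

lemma ringed_space_iso_trans:
  assumes "ringed_space_iso X Y" "ringed_space_iso Y Z"
  shows "ringed_space_iso X Z"
proof -
  obtain \<phi> \<theta> \<phi>' \<theta>' where "ringed_space_iso_by X Y \<phi> \<theta>" "ringed_space_iso_by Y Z \<phi>' \<theta>'"
    using assms unfolding ringed_space_iso_iff by (elim exE)
  note 1 = ringed_space_iso_byD[OF this(1)] and 2 = ringed_space_iso_byD[OF this(2)]
  let ?pre = "\<lambda>V. {y \<in> topspace (base Y). \<phi>' y \<in> V}"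
  have op: "openin (base Y) (?pre V)" if "openin (base Z) V" for V
    using openin_continuous_map_preimage[OF homeomorphic_imp_continuous_map[OF 2(1)] that] .
  have "\<phi> x \<in> topspace (base Y)" if "x \<in> topspace (base X)" for x
    using homeomorphic_imp_surjective_map[OF 1(1)] that by blast
  then have pre: "{x \<in> topspace (base X). (\<phi>' \<circ> \<phi>) x \<in> V} = {x \<in> topspace (base X). \<phi> x \<in> ?pre V}" for V
    by auto
  have "ringed_space_iso_by X Z (\<phi>' \<circ> \<phi>) (\<lambda>V. \<theta> (?pre V) \<circ> \<theta>' V)"
  proof (rule ringed_space_iso_byI)
    show "homeomorphic_map (base X) (base Z) (\<phi>' \<circ> \<phi>)"
      by (rule homeomorphic_map_compose[OF 1(1) 2(1)])
    fix V assume V: "openin (base Z) V"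
    show "\<theta> (?pre V) \<circ> \<theta>' V \<in> ring_iso (sect Z V) (sect X {x \<in> topspace (base X). (\<phi>' \<circ> \<phi>) x \<in> V})"
      unfolding pre by (rule ring_iso_set_trans[OF 2(2)[OF V] 1(2)[OF op[OF V]]])
    fix W s assume W: "openin (base Z) W" "W \<subseteq> V" and s: "s \<in> carrier (sect Z V)"
    have "\<theta>' V s \<in> carrier (sect Y (?pre V))"
      using ring_iso_memE(1)[OF 2(2)[OF V] s] .
    moreover have "?pre W \<subseteq> ?pre V" using W(2) by blast
    ultimately have "restr X {x \<in> topspace (base X). \<phi> x \<in> ?pre V} {x \<in> topspace (base X). \<phi> x \<in> ?pre W}
        (\<theta> (?pre V) (\<theta>' V s)) = \<theta> (?pre W) (restr Y (?pre V) (?pre W) (\<theta>' V s))"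
      by (intro 1(3) op V W)
    also have "\<dots> = \<theta> (?pre W) (\<theta>' W (restr Z V W s))"
      by (simp only: 2(3)[OF V W s])
    finally show "restr X {x \<in> topspace (base X). (\<phi>' \<circ> \<phi>) x \<in> V} {x \<in> topspace (base X). (\<phi>' \<circ> \<phi>) x \<in> W}
        ((\<theta> (?pre V) \<circ> \<theta>' V) s) = (\<theta> (?pre W) \<circ> \<theta>' W) (restr Z V W s)"
      unfolding pre unfolding comp_apply .
  qed
  then show ?thesis unfolding ringed_space_iso_iff by blast
qed

lemma ringed_space_iso_by_restrict:
  assumes "ringed_space_iso_by X Y \<phi> \<theta>" and U: "openin (base Y) U"
  shows "ringed_space_iso_by (open_subspace X {x \<in> topspace (base X). \<phi> x \<in> U}) (open_subspace Y U) \<phi> \<theta>"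
proof -
  note iso = ringed_space_iso_byD[OF assms(1)]
  let ?U = "{x \<in> topspace (base X). \<phi> x \<in> U}"
  have pre: "{x \<in> topspace (base (open_subspace X ?U)). \<phi> x \<in> V} = {x \<in> topspace (base X). \<phi> x \<in> V}"
    if "V \<subseteq> U" for V
    using that by auto
  have op: "openin (subtopology (base Y) U) V \<longleftrightarrow> openin (base Y) V \<and> V \<subseteq> U" for V
    by (rule openin_open_subtopology[OF U])
  show ?thesis
  proof (rule ringed_space_iso_byI)
    have "\<phi> ` (topspace (base X) \<inter> ?U) = topspace (base Y) \<inter> U"
      using homeomorphic_imp_surjective_map[OF iso(1)] by auto
    then show "homeomorphic_map (base (open_subspace X ?U)) (base (open_subspace Y U)) \<phi>"
      using homeomorphic_map_subtopologies[OF iso(1)] by simp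
    fix V assume "openin (base (open_subspace Y U)) V"
    then have V: "openin (base Y) V" "V \<subseteq> U" by (simp_all add: op)
    show "\<theta> V \<in> ring_iso (sect (open_subspace Y U) V)
        (sect (open_subspace X ?U) {x \<in> topspace (base (open_subspace X ?U)). \<phi> x \<in> V})"
      unfolding pre[OF V(2)] using iso(2)[OF V(1)] by simp
    fix W s assume "openin (base (open_subspace Y U)) W" and W: "W \<subseteq> V"
      and s: "s \<in> carrier (sect (open_subspace Y U) V)"
    then have W': "openin (base Y) W" by (simp add: op)
    have "W \<subseteq> U" using W V by blast
    show "restr (open_subspace X ?U) {x \<in> topspace (base (open_subspace X ?U)). \<phi> x \<in> V}
          {x \<in> topspace (base (open_subspace X ?U)). \<phi> x \<in> W} (\<theta> V s) =
        \<theta> W (restr (open_subspace Y U) V W s)"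
      unfolding pre[OF V(2)] pre[OF \<open>W \<subseteq> U\<close>] using iso(3)[OF V(1) W' W] s by simp
  qed
qed

section \<open>Sections over a spectrum\<close>

lemma Spec_simps [simp]:
  "base (Spec A) = zariski_topology A" "carrier (sect (Spec A) U) = Spec_sections A U"
  "s \<otimes>\<^bsub>sect (Spec A) U\<^esub> t = (\<lambda>p\<in>U. s p \<otimes>\<^bsub>localization A (carrier A - p)\<^esub> t p)"
  "s \<oplus>\<^bsub>sect (Spec A) U\<^esub> t = (\<lambda>p\<in>U. s p \<oplus>\<^bsub>localization A (carrier A - p)\<^esub> t p)"
  "\<one>\<^bsub>sect (Spec A) U\<^esub> = (\<lambda>p\<in>U. \<one>\<^bsub>localization A (carrier A - p)\<^esub>)"
  "restr (Spec A) U V s = restrict s V"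
  by (simp_all add: Spec_def)

text \<open>The family of fractions \<open>a / 1\<close>; over the whole spectrum it is the
  canonical map from the ring to its global sections.\<close>

definition sec :: "('a, 'm) ring_scheme \<Rightarrow> 'a set set \<Rightarrow> 'a \<Rightarrow> 'a set \<Rightarrow> ('a \<times> 'a) set" where
  "sec A U a = (\<lambda>p\<in>U. loc_frac A (carrier A - p) a \<one>\<^bsub>A\<^esub>)"

context cring begin

lemma Spec_sections_fraction:
  assumes "openin (zariski_topology R) U" "a \<in> carrier R" "f \<in> carrier R" "U \<subseteq> basic_open R f"
  shows "(\<lambda>p\<in>U. loc_frac R (carrier R - p) a f) \<in> Spec_sections R U"
proof -
  have "loc_frac R (carrier R - p) a f \<in> carrier (localization R (carrier R - p))" if "p \<in> U" for p
  proof -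
    interpret L: localizing_set R "carrier R - p"
      using that assms(4) by (intro localizing_set_prime) (auto simp: basic_open_def)
    show ?thesis using assms that by (intro L.loc_frac_carrier) (auto simp: basic_open_def)
  qed
  then show ?thesis
    unfolding Spec_sections_def using assms by (auto simp: basic_open_def intro!: exI[of _ U])
qed

lemma Spec_sections_local:
  assumes "s \<in> Spec_sections R U" "p \<in> U"
  obtains V a f where "openin (zariski_topology R) V" "p \<in> V" "V \<subseteq> U" "a \<in> carrier R" "f \<in> carrier R"
    "\<forall>q\<in>V. f \<notin> q \<and> s q = loc_frac R (carrier R - q) a f"
proof -
  have "\<exists>V. openin (zariski_topology R) V \<and> p \<in> V \<and> V \<subseteq> U \<and>
      (\<exists>a \<in> carrier R. \<exists>f \<in> carrier R. \<forall>q \<in> V. f \<notin> q \<and> s q = loc_frac R (carrier R - q) a f)"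
    using assms(1)[unfolded Spec_sections_def, THEN CollectD, THEN conjunct2] assms(2) by (rule bspec)
  then obtain V a f where V: "openin (zariski_topology R) V" "p \<in> V" "V \<subseteq> U"
    "a \<in> carrier R" "f \<in> carrier R"
    "\<forall>q \<in> V. f \<notin> q \<and> s q = loc_frac R (carrier R - q) a f" by (elim exE conjE bexE)
  show ?thesis by (rule that[OF V])
qed

lemma one_notin_prime: "primeideal p R \<Longrightarrow> \<one> \<notin> p"
  using basic_open_one by (auto simp: basic_open_def prime_spectrum_def)

lemma sec_Spec_sections:
  assumes "openin (zariski_topology R) U" "a \<in> carrier R"
  shows "sec R U a \<in> Spec_sections R U"
  unfolding sec_def using assms openin_zariski_prime[OF assms(1)] one_notin_prime
  by (intro Spec_sections_fraction) (auto simp: basic_open_def)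

lemma sec_hom:
  assumes U: "openin (zariski_topology R) U" and \<theta>: "\<theta> \<in> ring_iso (sect (Spec R) U) B"
  shows "(\<lambda>a. \<theta> (sec R U a)) \<in> Ring.ring_hom R B"
proof -
  have L: "localizing_set R (carrier R - p)" if "p \<in> U" for p
    using openin_zariski_prime[OF U that] by (rule localizing_set_prime)
  have c: "sec R U a \<in> carrier (sect (Spec R) U)" if "a \<in> carrier R" for a
    using sec_Spec_sections[OF U that] by simp
  show ?thesis
  proof (rule ring_hom_memI)
    fix a assume a: "a \<in> carrier R"
    then show "\<theta> (sec R U a) \<in> carrier B" using ring_iso_memE(1)[OF \<theta> c] by blast
    fix b assume b: "b \<in> carrier R"
    have "sec R U (a \<otimes> b) = sec R U a \<otimes>\<^bsub>sect (Spec R) U\<^esub> sec R U b"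
      using a b localizing_set.one_mem[OF L]
      by (auto simp: sec_def fun_eq_iff localizing_set.localization_mult[OF L])
    then show "\<theta> (sec R U (a \<otimes> b)) = \<theta> (sec R U a) \<otimes>\<^bsub>B\<^esub> \<theta> (sec R U b)"
      using ring_iso_memE(2)[OF \<theta> c[OF a] c[OF b]] by simp
    have "sec R U (a \<oplus> b) = sec R U a \<oplus>\<^bsub>sect (Spec R) U\<^esub> sec R U b"
      using a b localizing_set.one_mem[OF L]
      by (auto simp: sec_def fun_eq_iff localizing_set.localization_add[OF L])
    then show "\<theta> (sec R U (a \<oplus> b)) = \<theta> (sec R U a) \<oplus>\<^bsub>B\<^esub> \<theta> (sec R U b)"
      using ring_iso_memE(3)[OF \<theta> c[OF a] c[OF b]] by simp
  next
    have "sec R U \<one> = \<one>\<^bsub>sect (Spec R) U\<^esub>"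
      by (auto simp: sec_def fun_eq_iff localizing_set.localization_one[OF L])
    then show "\<theta> (sec R U \<one>) = \<one>\<^bsub>B\<^esub>"
      using ring_iso_memE(4)[OF \<theta>] by simp
  qed
qed

text \<open>The annihilator of a nonzero \<open>a\<close> is a proper ideal and lies in some prime
  \<open>p\<close>. There \<open>a / 1\<close> is nonzero, since a denominator killing
  \<open>a\<close> would belong to \<open>p\<close>.\<close>

lemma sec_eq_zero:
  assumes a: "a \<in> carrier R" and "sec R (prime_spectrum R) a = sec R (prime_spectrum R) \<zero>"
  shows "a = \<zero>"
proof (rule ccontr)
  assume "a \<noteq> \<zero>"
  let ?I = "{x \<in> carrier R. x \<otimes> a = \<zero>}"
  have I: "ideal ?I R"
  proof (rule idealI)
    show "subgroup ?I (add_monoid R)"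
      using a by (intro add.subgroupI) (auto simp: l_distr l_minus intro: exI[of _ \<zero>])
    fix x r assume x: "x \<in> ?I" and r: "r \<in> carrier R"
    then have "(r \<otimes> x) \<otimes> a = r \<otimes> (x \<otimes> a)" using a by (simp add: m_assoc)
    then show "r \<otimes> x \<in> ?I" using x r by simp
    then show "x \<otimes> r \<in> ?I" using x r by (simp add: m_comm)
  qed (rule ring_axioms)
  have n: "\<one> [^] n \<notin> ?I" for n :: nat using a \<open>a \<noteq> \<zero>\<close> by simp
  obtain p where p: "primeideal p R" "?I \<subseteq> p" "\<one> \<notin> p"
    by (rule prime_avoiding_powers[OF I one_closed n])
  interpret L: localizing_set R "carrier R - p" using p(1) by (rule localizing_set_prime)
  have "loc_frac R (carrier R - p) a \<one> = loc_frac R (carrier R - p) \<zero> \<one>"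
    using fun_cong[OF assms(2), of p] p(1) by (simp add: sec_def prime_spectrum_def)
  then obtain u where "u \<in> carrier R - p" "u \<otimes> (a \<otimes> \<one>) = u \<otimes> (\<zero> \<otimes> \<one>)"
    using L.loc_frac_eq_iff[of a \<zero> \<one> \<one>] a L.one_mem by auto
  then show False using p(2) a by auto
qed

text \<open>The ring of an affine chart is a domain if the ring of global sections is one, because
  elements of the ring are detected by global sections.\<close>

lemma domain_of_domain_sections:
  assumes \<theta>: "\<theta> \<in> ring_iso (sect (Spec R) (prime_spectrum R)) B" and B: "domain B"
  shows "domain R"
proof -
  interpret B: domain B by fact
  have U: "openin (zariski_topology R) (prime_spectrum R)"
    using openin_topspace[of "zariski_topology R"] by (simp add: topspace_zariski)
  define \<rho> where "\<rho> = (\<lambda>a. \<theta> (sec R (prime_spectrum R) a))"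
  interpret \<rho>: ring_hom_cring R B \<rho>
    using sec_hom[OF U \<theta>] is_cring B.is_cring
    by (simp add: \<rho>_def ring_hom_cring_def ring_hom_cring_axioms_def)
  have inj: "inj_on \<theta> (Spec_sections R (prime_spectrum R))"
    using ring_iso_memE(5)[OF \<theta>] by (simp add: bij_betw_def)
  have z: "a = \<zero>" if a: "a \<in> carrier R" and "\<rho> a = \<zero>\<^bsub>B\<^esub>" for a
  proof -
    have "\<rho> a = \<rho> \<zero>" using that by simp
    then have "\<theta> (sec R (prime_spectrum R) a) = \<theta> (sec R (prime_spectrum R) \<zero>)"
      unfolding \<rho>_def .
    then have "sec R (prime_spectrum R) a = sec R (prime_spectrum R) \<zero>"
      by (rule inj_onD[OF inj _ sec_Spec_sections[OF U a] sec_Spec_sections[OF U zero_closed]])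
    then show ?thesis by (rule sec_eq_zero[OF a])
  qed
  show ?thesis
  proof (intro domain.intro domain_axioms.intro is_cring)
    show "\<one> \<noteq> \<zero>"
    proof
      assume "\<one> = \<zero>"
      then have "\<rho> \<one> = \<rho> \<zero>" by simp
      then show False by simp
    qed
    fix a b assume ab: "a \<otimes> b = \<zero>" "a \<in> carrier R" "b \<in> carrier R"
    have "\<rho> a \<otimes>\<^bsub>B\<^esub> \<rho> b = \<rho> (a \<otimes> b)" using ab(2,3) by simp
    also have "\<dots> = \<zero>\<^bsub>B\<^esub>" unfolding ab(1) by simp
    finally have "\<rho> a = \<zero>\<^bsub>B\<^esub> \<or> \<rho> b = \<zero>\<^bsub>B\<^esub>" using ab by (intro B.integral) auto
    then show "a = \<zero> \<or> b = \<zero>" using z ab by blast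
  qed
qed

end

context domain begin

lemma loc_frac_prime_eq:
  assumes "primeideal p R" "a \<in> carrier R" "b \<in> carrier R" "s \<in> carrier R - p" "t \<in> carrier R - p"
  shows "loc_frac R (carrier R - p) a s = loc_frac R (carrier R - p) b t \<longleftrightarrow> a \<otimes> t = b \<otimes> s"
  using domain_localizing_set.loc_frac_eq[OF domain_localizing_set_prime[OF assms(1)]] assms(2-5) .

text \<open>Over a domain every local ring embeds into the local ring at the zero ideal. Local
  fractions \<open>a / f\<close> and \<open>b / h\<close> that agree there satisfy
  \<open>a h = b f\<close>, which is equality at every other prime too.\<close>

lemma germ_zero_inj:
  assumes U: "openin (zariski_topology R) U" and s: "s \<in> Spec_sections R U" and t: "t \<in> Spec_sections R U"
    and "s {\<zero>} = t {\<zero>}"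
  shows "s = t"
proof
  fix p show "s p = t p"
  proof (cases "p \<in> U")
    case False
    then show ?thesis using s t by (auto simp: Spec_sections_def PiE_def extensional_def)
  next
    case True
    obtain V a f where V: "openin (zariski_topology R) V" "p \<in> V" "V \<subseteq> U" "a \<in> carrier R" "f \<in> carrier R"
      "\<forall>q\<in>V. f \<notin> q \<and> s q = loc_frac R (carrier R - q) a f"
      by (rule Spec_sections_local[OF s True])
    obtain V' b h where V': "openin (zariski_topology R) V'" "p \<in> V'" "V' \<subseteq> U" "b \<in> carrier R" "h \<in> carrier R"
      "\<forall>q\<in>V'. h \<notin> q \<and> t q = loc_frac R (carrier R - q) b h"
      by (rule Spec_sections_local[OF t True])
    have z: "{\<zero>} \<in> V" "{\<zero>} \<in> V'" using V(1,2) V'(1,2) by (auto intro: zero_mem_open)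
    then have "a \<otimes> h = b \<otimes> f"
      using V(4-6) V'(4-6) assms(4) by (subst loc_frac_prime_eq[OF zeroprimeideal, symmetric]) auto
    then show ?thesis
      using V(2,4-6) V'(2,4-6) openin_zariski_prime[OF U True] by (auto simp: loc_frac_prime_eq)
  qed
qed

text \<open>The denominators of a section form an ideal; if it contained no power of \<open>g\<close> it would lie
  in a prime of \<open>basic_open R g\<close>, where the section is a fraction.\<close>

lemma sections_basic_open:
  assumes g: "g \<in> carrier R" "g \<noteq> \<zero>" and s: "s \<in> Spec_sections R (basic_open R g)"
  obtains n :: nat and a where "a \<in> carrier R"
    "s \<otimes>\<^bsub>sect (Spec R) (basic_open R g)\<^esub> sec R (basic_open R g) (g [^] n) = sec R (basic_open R g) a"
proof -
  let ?U = "basic_open R g"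
  have z: "{\<zero>} \<in> ?U" using g zeroprimeideal by (simp add: basic_open_def)
  \<comment> \<open>The germ at the generic point supplies a reference fraction
    \<open>a0 / f0\<close> with which all local fractions are compared.\<close>
  obtain V0 a0 f0 where "openin (zariski_topology R) V0" and V0: "{\<zero>} \<in> V0" and "V0 \<subseteq> ?U"
    and af0: "a0 \<in> carrier R" "f0 \<in> carrier R"
    "\<forall>q\<in>V0. f0 \<notin> q \<and> s q = loc_frac R (carrier R - q) a0 f0"
    by (rule Spec_sections_local[OF s z])
  note V0 = V0 af0
  have f0: "f0 \<noteq> \<zero>" using V0 by auto
  have loc: "\<exists>a\<in>carrier R. \<exists>f\<in>carrier R - p. s p = loc_frac R (carrier R - p) a f \<and> a \<otimes> f0 = a0 \<otimes> f"
    if p: "p \<in> ?U" for p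
  proof -
    obtain V a f where V: "openin (zariski_topology R) V" "p \<in> V" and "V \<subseteq> ?U" and
      af: "a \<in> carrier R" "f \<in> carrier R"
      "\<forall>q\<in>V. f \<notin> q \<and> s q = loc_frac R (carrier R - q) a f"
      by (rule Spec_sections_local[OF s p])
    note V = V af
    have "{\<zero>} \<in> V" using V(1,2) by (auto intro: zero_mem_open)
    then have "a \<otimes> f0 = a0 \<otimes> f"
      using V(3-5) V0 by (subst loc_frac_prime_eq[OF zeroprimeideal, symmetric]) auto
    then show ?thesis using V by blast
  qed
  \<comment> \<open>The elements whose product with \<open>a0 / f0\<close> lies in \<open>R\<close>;
    the equation avoids division by \<open>f0\<close>.\<close>
  let ?I = "{f \<in> carrier R. \<exists>a\<in>carrier R. f \<otimes> a0 = a \<otimes> f0}"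
  have I: "ideal ?I R"
  proof (rule idealI)
    show "subgroup ?I (add_monoid R)"
    proof (rule add.subgroupI)
      show "?I \<noteq> {}" using V0 by (auto intro!: exI[of _ \<zero>] bexI[of _ \<zero>])
      fix x assume "x \<in> ?I"
      then obtain a where a: "x \<in> carrier R" "a \<in> carrier R" "x \<otimes> a0 = a \<otimes> f0" by blast
      then have "(\<ominus> x) \<otimes> a0 = (\<ominus> a) \<otimes> f0" using V0 by (simp add: l_minus)
      then show "\<ominus> x \<in> ?I" using a(1,2) by blast
      fix y assume "y \<in> ?I"
      then obtain b where b: "y \<in> carrier R" "b \<in> carrier R" "y \<otimes> a0 = b \<otimes> f0" by blast
      have "(x \<oplus> y) \<otimes> a0 = (a \<oplus> b) \<otimes> f0" using a b V0 by (simp add: l_distr)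
      then show "x \<oplus> y \<in> ?I" using a(1,2) b(1,2) by blast
    qed auto
    fix x r assume "x \<in> ?I" and r: "r \<in> carrier R"
    then obtain a where a: "x \<in> carrier R" "a \<in> carrier R" "x \<otimes> a0 = a \<otimes> f0" by blast
    have "(r \<otimes> x) \<otimes> a0 = (r \<otimes> a) \<otimes> f0" using a V0 r by (simp add: m_assoc)
    then show "r \<otimes> x \<in> ?I" using a(1,2) r by blast
    then show "x \<otimes> r \<in> ?I" using a(1) r by (simp add: m_comm)
  qed (rule ring_axioms)
  have "\<exists>n::nat. g [^] n \<in> ?I"
  proof (rule ccontr)
    assume "\<not> ?thesis"
    then have "g [^] n \<notin> ?I" for n :: nat by blast
    then obtain p where p: "primeideal p R" "?I \<subseteq> p" "g \<notin> p"
      by (rule prime_avoiding_powers[OF I g(1)])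
    then obtain a f where "a \<in> carrier R" "f \<in> carrier R - p" "a \<otimes> f0 = a0 \<otimes> f"
      using loc[of p] by (auto simp: basic_open_def)
    then have "f \<in> ?I" using V0 by (auto simp: m_comm intro!: bexI[of _ a])
    then show False using p(2) \<open>f \<in> carrier R - p\<close> by blast
  qed
  then obtain n :: nat where "g [^] n \<in> ?I" by (elim exE)
  then obtain a where a: "a \<in> carrier R" "g [^] n \<otimes> a0 = a \<otimes> f0" by blast
  note af = a(1) V0(2,3) nat_pow_closed[OF g(1), of n]
  have "s p \<otimes>\<^bsub>localization R (carrier R - p)\<^esub> loc_frac R (carrier R - p) (g [^] n) \<one> =
      loc_frac R (carrier R - p) a \<one>" if p: "p \<in> ?U" for p
  proof -
    have pp: "primeideal p R" using p by (simp add: basic_open_def)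
    interpret L: localizing_set R "carrier R - p" using pp by (rule localizing_set_prime)
    obtain b f where b: "b \<in> carrier R" "f \<in> carrier R - p" "s p = loc_frac R (carrier R - p) b f"
      "b \<otimes> f0 = a0 \<otimes> f" using loc[OF p] by blast
    have fc: "f \<in> carrier R" using b(2) by simp
    have "f0 \<otimes> (b \<otimes> g [^] n) = (b \<otimes> f0) \<otimes> g [^] n"
      using af b(1) by (simp only: m_ac m_closed)
    also have "\<dots> = (g [^] n \<otimes> a0) \<otimes> f" unfolding b(4) using af fc by (simp only: m_ac m_closed)
    also have "\<dots> = f0 \<otimes> (a \<otimes> f)" unfolding a(2) using af fc by (simp only: m_ac m_closed)
    finally have e: "b \<otimes> g [^] n = a \<otimes> f"
      using m_lcancel[OF f0 af(3), of "b \<otimes> g [^] n" "a \<otimes> f"] af b(1) fc by simp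
    have "s p \<otimes>\<^bsub>localization R (carrier R - p)\<^esub> loc_frac R (carrier R - p) (g [^] n) \<one> =
        loc_frac R (carrier R - p) (b \<otimes> g [^] n) (f \<otimes> \<one>)"
      unfolding b(3) by (rule L.localization_mult[OF b(1) af(4) b(2) L.one_mem])
    also have "\<dots> = loc_frac R (carrier R - p) a \<one>"
      unfolding e using af b(1) b(2) fc L.one_mem
      by (subst loc_frac_prime_eq[OF pp]) (simp_all add: m_assoc)
    finally show ?thesis .
  qed
  then have "s \<otimes>\<^bsub>sect (Spec R) ?U\<^esub> sec R ?U (g [^] n) = sec R ?U a"
    by (auto simp: sec_def fun_eq_iff)
  then show ?thesis using that a(1) by blast
qed

end

section \<open>Basic open subsets of affine schemes are affine\<close>

text \<open>Characterises \<open>B\<close> as \<open>A\<close> with \<open>g\<close> inverted,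
  without constructing it: \<open>g\<close> becomes a unit and every element of \<open>B\<close> is
  of the form \<open>a / g^n\<close>. The ring of sections over a basic open set can then serve as
  \<open>B\<close>, which keeps it on the type that \<open>affine_open\<close> prescribes.\<close>

locale basic_localization = A: domain A + B: domain B + h: ring_hom_cring A B \<rho>
  for A :: "('a, 'm) ring_scheme" and B :: "('b, 'n) ring_scheme" and \<rho> +
  fixes g
  assumes g: "g \<in> carrier A" and inj: "inj_on \<rho> (carrier A)" and unit: "\<rho> g \<in> Units B"
    and fraction: "\<And>x. x \<in> carrier B \<Longrightarrow> \<exists>n::nat. \<exists>a\<in>carrier A. x \<otimes>\<^bsub>B\<^esub> \<rho> (g [^]\<^bsub>A\<^esub> n) = \<rho> a"
begin

lemma pow_closed: "g [^]\<^bsub>A\<^esub> (n::nat) \<in> carrier A"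
  using g by simp

lemma pow_unit: "\<rho> (g [^]\<^bsub>A\<^esub> (n::nat)) \<in> Units B"
  unfolding h.hom_nat_pow'[OF g] using unit by (rule B.Units_pow_closed)

lemma rho_eq_iff: "a \<in> carrier A \<Longrightarrow> b \<in> carrier A \<Longrightarrow> \<rho> a = \<rho> b \<longleftrightarrow> a = b"
  using inj by (auto dest: inj_onD)

lemma pow_notin_prime:
  assumes "primeideal q A" "g \<notin> q" shows "g [^]\<^bsub>A\<^esub> (n::nat) \<notin> q"
proof -
  interpret q: primeideal q A by fact
  show ?thesis
  proof (induction n)
    case 0
    then show ?case using A.one_notin_prime[OF assms(1)] by simp
  next
    case (Suc n)
    then show ?case using q.I_prime[OF pow_closed g] assms(2) by auto
  qed
qed

lemma unit_notin_prime: "primeideal p B \<Longrightarrow> u \<in> Units B \<Longrightarrow> u \<notin> p"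
  using B.one_notin_prime[of p] ideal.I_l_closed[of p B u "inv\<^bsub>B\<^esub> u"]
  by (auto simp: primeideal_def)

lemma common_denominator:
  assumes "x \<in> carrier B" "y \<in> carrier B"
  obtains n :: nat and a b where "a \<in> carrier A" "b \<in> carrier A"
    "x \<otimes>\<^bsub>B\<^esub> \<rho> (g [^]\<^bsub>A\<^esub> n) = \<rho> a" "y \<otimes>\<^bsub>B\<^esub> \<rho> (g [^]\<^bsub>A\<^esub> n) = \<rho> b"
proof -
  obtain n :: nat and a where a: "a \<in> carrier A" "x \<otimes>\<^bsub>B\<^esub> \<rho> (g [^]\<^bsub>A\<^esub> n) = \<rho> a"
    using fraction[OF assms(1)] by blast
  obtain m :: nat and b where b: "b \<in> carrier A" "y \<otimes>\<^bsub>B\<^esub> \<rho> (g [^]\<^bsub>A\<^esub> m) = \<rho> b"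
    using fraction[OF assms(2)] by blast
  let ?G = "\<lambda>n. \<rho> (g [^]\<^bsub>A\<^esub> (n::nat))"
  have c: "?G k \<in> carrier B" for k using pow_closed by (rule h.hom_closed)
  have G: "?G (n + m) = ?G n \<otimes>\<^bsub>B\<^esub> ?G m"
    by (simp only: A.nat_pow_mult[OF g, symmetric] h.hom_mult[OF pow_closed pow_closed])
  have "x \<otimes>\<^bsub>B\<^esub> ?G (n + m) = (x \<otimes>\<^bsub>B\<^esub> ?G n) \<otimes>\<^bsub>B\<^esub> ?G m"
    unfolding G using assms c by (simp only: B.m_assoc)
  also have "\<dots> = \<rho> (a \<otimes>\<^bsub>A\<^esub> g [^]\<^bsub>A\<^esub> m)"
    unfolding a(2) using h.hom_mult[OF a(1) pow_closed] by simp
  finally have 1: "x \<otimes>\<^bsub>B\<^esub> ?G (n + m) = \<rho> (a \<otimes>\<^bsub>A\<^esub> g [^]\<^bsub>A\<^esub> m)" .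
  have "y \<otimes>\<^bsub>B\<^esub> ?G (n + m) = (y \<otimes>\<^bsub>B\<^esub> ?G m) \<otimes>\<^bsub>B\<^esub> ?G n"
    unfolding G using assms c by (simp only: B.m_assoc B.m_comm[OF c c])
  also have "\<dots> = \<rho> (b \<otimes>\<^bsub>A\<^esub> g [^]\<^bsub>A\<^esub> n)"
    unfolding b(2) using h.hom_mult[OF b(1) pow_closed] by simp
  finally have 2: "y \<otimes>\<^bsub>B\<^esub> ?G (n + m) = \<rho> (b \<otimes>\<^bsub>A\<^esub> g [^]\<^bsub>A\<^esub> n)" .
  show ?thesis
    by (rule that[OF _ _ 1 2]) (use a(1) b(1) pow_closed in auto)
qed

text \<open>For a prime \<open>q\<close> avoiding \<open>g\<close> this is the extended ideal
  \<open>q B\<close>. With \<open>contract\<close> it gives the bijection between the primes of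
  \<open>A\<close> avoiding \<open>g\<close> and the primes of \<open>B\<close>.\<close>

definition extend :: "'a set \<Rightarrow> 'b set" where
  "extend q = {x \<in> carrier B. \<exists>n::nat. \<exists>a\<in>q. x \<otimes>\<^bsub>B\<^esub> \<rho> (g [^]\<^bsub>A\<^esub> n) = \<rho> a}"

definition contract :: "'b set \<Rightarrow> 'a set" where
  "contract p = {a \<in> carrier A. \<rho> a \<in> p}"

text \<open>Membership can be tested on any one numerator: two numerators of \<open>x\<close> agree
  up to powers of \<open>g\<close>, and these lie outside the prime \<open>q\<close>.\<close>

lemma extend_iff:
  fixes n :: nat
  assumes q: "primeideal q A" "g \<notin> q" and x: "x \<in> carrier B" "a \<in> carrier A"
    and xa: "x \<otimes>\<^bsub>B\<^esub> \<rho> (g [^]\<^bsub>A\<^esub> n) = \<rho> a"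
  shows "x \<in> extend q \<longleftrightarrow> a \<in> q"
proof
  assume "a \<in> q"
  then show "x \<in> extend q" using x(1) xa unfolding extend_def by blast
next
  interpret q: primeideal q A by fact
  assume "x \<in> extend q"
  then obtain m :: nat and b where b: "b \<in> q" "x \<otimes>\<^bsub>B\<^esub> \<rho> (g [^]\<^bsub>A\<^esub> m) = \<rho> b"
    unfolding extend_def by blast
  have bc: "b \<in> carrier A" using b(1) by (rule q.a_Hcarr)
  have c: "\<rho> (g [^]\<^bsub>A\<^esub> k) \<in> carrier B" for k :: nat using pow_closed by (rule h.hom_closed)
  have "\<rho> (a \<otimes>\<^bsub>A\<^esub> g [^]\<^bsub>A\<^esub> m) = (x \<otimes>\<^bsub>B\<^esub> \<rho> (g [^]\<^bsub>A\<^esub> n)) \<otimes>\<^bsub>B\<^esub> \<rho> (g [^]\<^bsub>A\<^esub> m)"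
    unfolding xa by (rule h.hom_mult[OF x(2) pow_closed])
  also have "\<dots> = (x \<otimes>\<^bsub>B\<^esub> \<rho> (g [^]\<^bsub>A\<^esub> m)) \<otimes>\<^bsub>B\<^esub> \<rho> (g [^]\<^bsub>A\<^esub> n)"
    using x(1) c by (simp only: B.m_assoc B.m_comm[OF c c])
  also have "\<dots> = \<rho> (b \<otimes>\<^bsub>A\<^esub> g [^]\<^bsub>A\<^esub> n)"
    unfolding b(2) by (rule h.hom_mult[OF bc pow_closed, symmetric])
  finally have "a \<otimes>\<^bsub>A\<^esub> g [^]\<^bsub>A\<^esub> m = b \<otimes>\<^bsub>A\<^esub> g [^]\<^bsub>A\<^esub> n"
    by (simp only: rho_eq_iff[OF A.m_closed[OF x(2) pow_closed] A.m_closed[OF bc pow_closed]])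
  then have "a \<otimes>\<^bsub>A\<^esub> g [^]\<^bsub>A\<^esub> m \<in> q" using q.I_r_closed[OF b(1) pow_closed] by simp
  then show "a \<in> q" using q.I_prime[OF x(2) pow_closed] pow_notin_prime[OF q] by blast
qed

lemma rho_extend_iff:
  assumes "primeideal q A" "g \<notin> q" "a \<in> carrier A"
  shows "\<rho> a \<in> extend q \<longleftrightarrow> a \<in> q"
  using extend_iff[OF assms(1,2) _ assms(3), of "\<rho> a" 0] assms(3) by simp

lemma contract_extend:
  assumes "primeideal q A" "g \<notin> q"
  shows "contract (extend q) = q"
proof -
  interpret q: primeideal q A by fact
  show ?thesis using rho_extend_iff[OF assms] q.a_Hcarr by (auto simp: contract_def)
qed

lemma extend_prime:
  assumes q: "primeideal q A" "g \<notin> q"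
  shows "primeideal (extend q) B"
proof -
  interpret q: primeideal q A by fact
  have sub: "extend q \<subseteq> carrier B" by (auto simp: extend_def)
  have c: "\<rho> (g [^]\<^bsub>A\<^esub> k) \<in> carrier B" for k :: nat using pow_closed by (rule h.hom_closed)
  have abs: "y \<otimes>\<^bsub>B\<^esub> x \<in> extend q" if x: "x \<in> extend q" and y: "y \<in> carrier B" for x y
  proof -
    have xc: "x \<in> carrier B" using x sub by blast
    obtain n :: nat and a b where ab: "a \<in> carrier A" "b \<in> carrier A"
      "x \<otimes>\<^bsub>B\<^esub> \<rho> (g [^]\<^bsub>A\<^esub> n) = \<rho> a" "y \<otimes>\<^bsub>B\<^esub> \<rho> (g [^]\<^bsub>A\<^esub> n) = \<rho> b"
      by (rule common_denominator[OF xc y])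
    have "(y \<otimes>\<^bsub>B\<^esub> x) \<otimes>\<^bsub>B\<^esub> \<rho> (g [^]\<^bsub>A\<^esub> (n + n)) =
        (y \<otimes>\<^bsub>B\<^esub> \<rho> (g [^]\<^bsub>A\<^esub> n)) \<otimes>\<^bsub>B\<^esub> (x \<otimes>\<^bsub>B\<^esub> \<rho> (g [^]\<^bsub>A\<^esub> n))"
      unfolding A.nat_pow_mult[OF g, symmetric] h.hom_mult[OF pow_closed pow_closed]
      using xc y c by (simp only: B.m_ac B.m_closed)
    also have "\<dots> = \<rho> (b \<otimes>\<^bsub>A\<^esub> a)"
      unfolding ab(3,4) using ab by simp
    finally have "y \<otimes>\<^bsub>B\<^esub> x \<in> extend q \<longleftrightarrow> b \<otimes>\<^bsub>A\<^esub> a \<in> q"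
      using ab xc y by (intro extend_iff[OF q]) auto
    moreover have "a \<in> q" using extend_iff[OF q xc ab(1,3)] x by simp
    ultimately show ?thesis using q.I_l_closed ab(2) by blast
  qed
  show ?thesis
  proof (rule primeidealI)
    show "ideal (extend q) B"
    proof (rule idealI)
      show "subgroup (extend q) (add_monoid B)"
      proof (rule B.add.subgroupI)
        have "\<rho> \<zero>\<^bsub>A\<^esub> \<in> extend q" using rho_extend_iff[OF q A.zero_closed] q.zero_closed by simp
        then show "extend q \<noteq> {}" by blast
        fix x assume x: "x \<in> extend q"
        have xc: "x \<in> carrier B" using x sub by blast
        then show "\<ominus>\<^bsub>B\<^esub> x \<in> extend q"
          using abs[OF x, of "\<ominus>\<^bsub>B\<^esub> \<one>\<^bsub>B\<^esub>"] by (simp add: B.l_minus)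
        fix y assume y: "y \<in> extend q"
        then have yc: "y \<in> carrier B" using sub by blast
        obtain n :: nat and a b where ab: "a \<in> carrier A" "b \<in> carrier A"
          "x \<otimes>\<^bsub>B\<^esub> \<rho> (g [^]\<^bsub>A\<^esub> n) = \<rho> a" "y \<otimes>\<^bsub>B\<^esub> \<rho> (g [^]\<^bsub>A\<^esub> n) = \<rho> b"
          by (rule common_denominator[OF xc yc])
        have "(x \<oplus>\<^bsub>B\<^esub> y) \<otimes>\<^bsub>B\<^esub> \<rho> (g [^]\<^bsub>A\<^esub> n) = \<rho> (a \<oplus>\<^bsub>A\<^esub> b)"
          using xc yc c ab by (simp add: B.l_distr)
        then have "x \<oplus>\<^bsub>B\<^esub> y \<in> extend q \<longleftrightarrow> a \<oplus>\<^bsub>A\<^esub> b \<in> q"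
          using ab xc yc by (intro extend_iff[OF q]) auto
        moreover have "a \<in> q" "b \<in> q"
          using extend_iff[OF q xc ab(1,3)] extend_iff[OF q yc ab(2,4)] x y by simp_all
        ultimately show "x \<oplus>\<^bsub>B\<^esub> y \<in> extend q" using q.a_closed by blast
      qed (use sub in auto)
      fix x y assume x: "x \<in> extend q" and y: "y \<in> carrier B"
      show "y \<otimes>\<^bsub>B\<^esub> x \<in> extend q" by (rule abs[OF x y])
      then show "x \<otimes>\<^bsub>B\<^esub> y \<in> extend q" using B.m_comm[of x y] x y sub by auto
    qed (rule B.ring_axioms)
    have "\<one>\<^bsub>B\<^esub> \<notin> extend q"
      using rho_extend_iff[OF q A.one_closed] A.one_notin_prime[OF q(1)] by simp
    then show "carrier B \<noteq> extend q" by auto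
    fix x y assume xy: "x \<in> carrier B" "y \<in> carrier B" "x \<otimes>\<^bsub>B\<^esub> y \<in> extend q"
    obtain n :: nat and a b where ab: "a \<in> carrier A" "b \<in> carrier A"
      "x \<otimes>\<^bsub>B\<^esub> \<rho> (g [^]\<^bsub>A\<^esub> n) = \<rho> a" "y \<otimes>\<^bsub>B\<^esub> \<rho> (g [^]\<^bsub>A\<^esub> n) = \<rho> b"
      by (rule common_denominator[OF xy(1,2)])
    have "(x \<otimes>\<^bsub>B\<^esub> y) \<otimes>\<^bsub>B\<^esub> \<rho> (g [^]\<^bsub>A\<^esub> (n + n)) =
        (x \<otimes>\<^bsub>B\<^esub> \<rho> (g [^]\<^bsub>A\<^esub> n)) \<otimes>\<^bsub>B\<^esub> (y \<otimes>\<^bsub>B\<^esub> \<rho> (g [^]\<^bsub>A\<^esub> n))"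
      unfolding A.nat_pow_mult[OF g, symmetric] h.hom_mult[OF pow_closed pow_closed]
      using xy(1,2) c by (simp only: B.m_ac B.m_closed)
    also have "\<dots> = \<rho> (a \<otimes>\<^bsub>A\<^esub> b)"
      unfolding ab(3,4) using ab by simp
    finally have "x \<otimes>\<^bsub>B\<^esub> y \<in> extend q \<longleftrightarrow> a \<otimes>\<^bsub>A\<^esub> b \<in> q"
      using ab xy(1,2) by (intro extend_iff[OF q]) auto
    then have "a \<in> q \<or> b \<in> q" using xy(3) q.I_prime[OF ab(1,2)] by blast
    then show "x \<in> extend q \<or> y \<in> extend q"
      using extend_iff[OF q xy(1) ab(1,3)] extend_iff[OF q xy(2) ab(2,4)] by blast
  qed (rule B.is_cring)
qed

lemma contract_prime:
  assumes p: "primeideal p B"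
  shows "primeideal (contract p) A" "g \<notin> contract p"
proof -
  show "primeideal (contract p) A"
    unfolding contract_def
    by (rule ring_hom_ring.primeideal_vimage[OF
        ring_hom_ringI2[OF A.ring_axioms B.ring_axioms h.homh] A.is_cring p])
  show "g \<notin> contract p" using unit_notin_prime[OF p unit] by (simp add: contract_def)
qed

lemma extend_contract:
  assumes p: "primeideal p B"
  shows "extend (contract p) = p"
proof -
  interpret p: primeideal p B by fact
  have "x \<in> extend (contract p) \<longleftrightarrow> x \<in> p" if x: "x \<in> carrier B" for x
  proof -
    obtain n :: nat and a where a: "a \<in> carrier A" "x \<otimes>\<^bsub>B\<^esub> \<rho> (g [^]\<^bsub>A\<^esub> n) = \<rho> a"
      using fraction[OF x] by blast
    have c: "\<rho> (g [^]\<^bsub>A\<^esub> n) \<in> carrier B" using pow_closed by (rule h.hom_closed)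
    have "x \<in> extend (contract p) \<longleftrightarrow> \<rho> a \<in> p"
      using extend_iff[OF contract_prime[OF p] x a] a(1) by (simp add: contract_def)
    also have "\<dots> \<longleftrightarrow> x \<in> p"
      unfolding a(2)[symmetric]
      using p.I_r_closed[of x, OF _ c] p.I_prime[OF x c] unit_notin_prime[OF p pow_unit] by blast
    finally show ?thesis .
  qed
  then show ?thesis using p.a_Hcarr by (auto simp: extend_def)
qed

section \<open>Homeomorphism between a basic open set and the spectrum of the localisation\<close>

lemma extend_image: "extend ` basic_open A g = prime_spectrum B"
proof
  show "extend ` basic_open A g \<subseteq> prime_spectrum B"
    using extend_prime by (auto simp: basic_open_def prime_spectrum_def)
  show "prime_spectrum B \<subseteq> extend ` basic_open A g"
  proof
    fix p assume "p \<in> prime_spectrum B"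
    then have p: "primeideal p B" by (simp add: prime_spectrum_def)
    then have "contract p \<in> basic_open A g" using contract_prime by (simp add: basic_open_def)
    then show "p \<in> extend ` basic_open A g" using extend_contract[OF p] by (metis imageI)
  qed
qed

lemma extend_inj: "inj_on extend (basic_open A g)"
  by (rule inj_on_inverseI[of _ contract]) (auto simp: basic_open_def contract_extend)

text \<open>If \<open>x = a / g^n\<close>, then \<open>basic_open B x\<close> pulls back to
  \<open>basic_open A (a g)\<close>, because powers of \<open>g\<close> are units in
  \<open>B\<close>.\<close>

lemma open_preimage:
  assumes V: "openin (zariski_topology B) V"
  shows "openin (zariski_topology A) {q \<in> basic_open A g. extend q \<in> V}"
  unfolding A.openin_zariski
proof
  fix q assume "q \<in> {q \<in> basic_open A g. extend q \<in> V}"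
  then have q: "primeideal q A" "g \<notin> q" "extend q \<in> V" by (auto simp: basic_open_def)
  then obtain x where x: "x \<in> carrier B" "extend q \<in> basic_open B x" "basic_open B x \<subseteq> V"
    using V unfolding B.openin_zariski by blast
  obtain n :: nat and a where a: "a \<in> carrier A" "x \<otimes>\<^bsub>B\<^esub> \<rho> (g [^]\<^bsub>A\<^esub> n) = \<rho> a"
    using fraction[OF x(1)] by blast
  have mem: "extend r \<in> basic_open B x \<longleftrightarrow> a \<notin> r" if "r \<in> basic_open A g" for r
    using that extend_iff[OF _ _ x(1) a, of r] extend_prime[of r] by (simp add: basic_open_def)
  have e: "basic_open A (a \<otimes>\<^bsub>A\<^esub> g) = basic_open A a \<inter> basic_open A g"
    using A.basic_open_Int[OF a(1) g] by simp
  have qg: "q \<in> basic_open A g" using q by (simp add: basic_open_def)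
  have "q \<in> basic_open A a" using mem[OF qg] x(2) q(1) by (simp add: basic_open_def)
  moreover have "basic_open A (a \<otimes>\<^bsub>A\<^esub> g) \<subseteq> {q \<in> basic_open A g. extend q \<in> V}"
  proof
    fix r assume "r \<in> basic_open A (a \<otimes>\<^bsub>A\<^esub> g)"
    then have r: "r \<in> basic_open A g" "a \<notin> r" unfolding e by (auto simp: basic_open_def)
    then show "r \<in> {q \<in> basic_open A g. extend q \<in> V}" using mem[OF r(1)] x(3) by blast
  qed
  ultimately show "\<exists>f\<in>carrier A. q \<in> basic_open A f \<and> basic_open A f \<subseteq> {q \<in> basic_open A g. extend q \<in> V}"
    using a(1) g qg by (intro bexI[of _ "a \<otimes>\<^bsub>A\<^esub> g"]) (simp_all add: e)
qed

text \<open>A basic open set of \<open>f\<close> inside \<open>basic_open A g\<close> is carried to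
  that of \<open>\<rho> f\<close>.\<close>

lemma open_image:
  assumes U: "openin (zariski_topology A) U" "U \<subseteq> basic_open A g"
  shows "openin (zariski_topology B) (extend ` U)"
  unfolding B.openin_zariski
proof
  fix p assume "p \<in> extend ` U"
  then obtain q where q: "p = extend q" "q \<in> U" by blast
  then have qg: "primeideal q A" "g \<notin> q" using U(2) by (auto simp: basic_open_def)
  obtain f where f: "f \<in> carrier A" "q \<in> basic_open A f" "basic_open A f \<subseteq> U"
    using U(1) q(2) unfolding A.openin_zariski by blast
  have "p \<in> basic_open B (\<rho> f)"
    using f(1,2) extend_prime[OF qg] rho_extend_iff[OF qg f(1)] by (simp add: basic_open_def q(1))
  moreover have "basic_open B (\<rho> f) \<subseteq> extend ` U"
  proof
    fix p' assume "p' \<in> basic_open B (\<rho> f)"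
    then have p': "primeideal p' B" "\<rho> f \<notin> p'" by (auto simp: basic_open_def)
    then have "contract p' \<in> basic_open A f"
      using contract_prime[OF p'(1)] by (simp add: basic_open_def contract_def)
    then show "p' \<in> extend ` U" using f(3) extend_contract[OF p'(1)] by (metis imageI subsetD)
  qed
  ultimately show "\<exists>x\<in>carrier B. p \<in> basic_open B x \<and> basic_open B x \<subseteq> extend ` U"
    using f(1) by (intro bexI[of _ "\<rho> f"]) auto
qed

lemma topspace_basic_open:
  "topspace (subtopology (zariski_topology A) (basic_open A g)) = basic_open A g"
  by (auto simp: A.topspace_zariski basic_open_def prime_spectrum_def)

lemma extend_homeomorphic:
  "homeomorphic_map (subtopology (zariski_topology A) (basic_open A g)) (zariski_topology B) extend"
proof (rule bijective_open_imp_homeomorphic_map)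
  note op = openin_open_subtopology[OF A.openin_basic_open[OF g]]
  have im: "extend q \<in> prime_spectrum B" if "q \<in> basic_open A g" for q
    using extend_image that by blast
  show "continuous_map (subtopology (zariski_topology A) (basic_open A g)) (zariski_topology B) extend"
    unfolding continuous_map topspace_basic_open B.topspace_zariski op
    using im open_preimage by auto
  show "open_map (subtopology (zariski_topology A) (basic_open A g)) (zariski_topology B) extend"
    unfolding open_map_def op using open_image by blast
qed (simp_all only: topspace_basic_open extend_image extend_inj B.topspace_zariski)

section \<open>Comparison of stalks and of sections\<close>

abbreviation "fracA q a s \<equiv> loc_frac A (carrier A - q) a s"
abbreviation "fracB p x y \<equiv> loc_frac B (carrier B - p) x y"

text \<open>Clearing a common power of \<open>g\<close> rewrites any fraction over \<open>B\<close>
  with numerator and denominator coming from \<open>A\<close>.\<close>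

lemma stalk_rep:
  fixes n :: nat
  assumes q: "primeideal q A" "g \<notin> q"
    and xy: "x \<in> carrier B" "y \<in> carrier B" "x \<otimes>\<^bsub>B\<^esub> \<rho> (g [^]\<^bsub>A\<^esub> n) = \<rho> a" "y \<otimes>\<^bsub>B\<^esub> \<rho> (g [^]\<^bsub>A\<^esub> n) = \<rho> b"
    and ab: "a \<in> carrier A" "b \<in> carrier A" and "y \<notin> extend q"
  shows "b \<notin> q" "fracB (extend q) x y = fracB (extend q) (\<rho> a) (\<rho> b)"
proof -
  show b: "b \<notin> q" using extend_iff[OF q xy(2) ab(2) xy(4)] assms(9) by simp
  then have "\<rho> b \<notin> extend q" using rho_extend_iff[OF q ab(2)] by simp
  moreover have "x \<otimes>\<^bsub>B\<^esub> \<rho> b = \<rho> a \<otimes>\<^bsub>B\<^esub> y"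
    unfolding xy(3,4)[symmetric] using xy(1,2) h.hom_closed[OF pow_closed[of n]]
    by (simp only: B.m_ac B.m_closed)
  ultimately show "fracB (extend q) x y = fracB (extend q) (\<rho> a) (\<rho> b)"
    using xy ab assms(9) by (subst B.loc_frac_prime_eq[OF extend_prime[OF q]]) auto
qed

text \<open>The inverse of the canonical isomorphism from the local ring of \<open>A\<close> at
  \<open>q\<close> to that of \<open>B\<close> at \<open>extend q\<close>. The direction is the one
  \<open>ringed_space_iso\<close> wants on sections, from target to source; independence of the
  chosen fraction is \<open>frac_rho_eq_iff\<close>.\<close>

definition stalk_map :: "'a set \<Rightarrow> ('b \<times> 'b) set \<Rightarrow> ('a \<times> 'a) set" where
  "stalk_map q y = (THE z. \<exists>a\<in>carrier A. \<exists>s\<in>carrier A - q.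
     y = fracB (extend q) (\<rho> a) (\<rho> s) \<and> z = fracA q a s)"

text \<open>Both sides amount to \<open>a t = b s\<close>: fractions over a domain are compared by
  cross multiplication, and \<open>\<rho>\<close> is injective.\<close>

lemma frac_rho_eq_iff:
  assumes q: "primeideal q A" "g \<notin> q" and "a \<in> carrier A" "s \<in> carrier A - q" "b \<in> carrier A" "t \<in> carrier A - q"
  shows "fracB (extend q) (\<rho> a) (\<rho> s) = fracB (extend q) (\<rho> b) (\<rho> t) \<longleftrightarrow> fracA q a s = fracA q b t"
proof -
  have "\<rho> s \<in> carrier B - extend q" "\<rho> t \<in> carrier B - extend q"
    using assms(4,6) rho_extend_iff[OF q] by auto
  then have "fracB (extend q) (\<rho> a) (\<rho> s) = fracB (extend q) (\<rho> b) (\<rho> t) \<longleftrightarrow> \<rho> a \<otimes>\<^bsub>B\<^esub> \<rho> t = \<rho> b \<otimes>\<^bsub>B\<^esub> \<rho> s"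
    using assms(3,5) by (intro B.loc_frac_prime_eq[OF extend_prime[OF q]]) auto
  also have "\<dots> \<longleftrightarrow> \<rho> (a \<otimes>\<^bsub>A\<^esub> t) = \<rho> (b \<otimes>\<^bsub>A\<^esub> s)"
    using assms(3-6) by simp
  also have "\<dots> \<longleftrightarrow> a \<otimes>\<^bsub>A\<^esub> t = b \<otimes>\<^bsub>A\<^esub> s"
    using assms(3-6) by (intro rho_eq_iff) auto
  also have "\<dots> \<longleftrightarrow> fracA q a s = fracA q b t"
    using assms(3-6) by (intro A.loc_frac_prime_eq[OF q(1), symmetric])
  finally show ?thesis .
qed

lemma stalk_map_frac:
  assumes q: "primeideal q A" "g \<notin> q" and as: "a \<in> carrier A" "s \<in> carrier A - q"
  shows "stalk_map q (fracB (extend q) (\<rho> a) (\<rho> s)) = fracA q a s"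
  unfolding stalk_map_def
proof (rule the_equality)
  show "\<exists>a'\<in>carrier A. \<exists>s'\<in>carrier A - q.
      fracB (extend q) (\<rho> a) (\<rho> s) = fracB (extend q) (\<rho> a') (\<rho> s') \<and> fracA q a s = fracA q a' s'"
    using as by blast
  fix z assume "\<exists>a'\<in>carrier A. \<exists>s'\<in>carrier A - q.
      fracB (extend q) (\<rho> a) (\<rho> s) = fracB (extend q) (\<rho> a') (\<rho> s') \<and> z = fracA q a' s'"
  then obtain a' s' where "a' \<in> carrier A" "s' \<in> carrier A - q"
    "fracB (extend q) (\<rho> a) (\<rho> s) = fracB (extend q) (\<rho> a') (\<rho> s')" "z = fracA q a' s'" by (elim bexE conjE)
  then show "z = fracA q a s" using frac_rho_eq_iff[OF q as] by simp
qed

lemma stalk_cases: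
  assumes q: "primeideal q A" "g \<notin> q" and z: "z \<in> carrier (localization B (carrier B - extend q))"
  obtains a s where "a \<in> carrier A" "s \<in> carrier A - q" "z = fracB (extend q) (\<rho> a) (\<rho> s)"
proof -
  interpret L: localizing_set B "carrier B - extend q"
    by (rule B.localizing_set_prime[OF extend_prime[OF q]])
  obtain x y where xy: "x \<in> carrier B" "y \<in> carrier B" "y \<notin> extend q" "z = fracB (extend q) x y"
    using z unfolding L.carrier_localization by blast
  obtain n :: nat and a b where ab: "a \<in> carrier A" "b \<in> carrier A"
    "x \<otimes>\<^bsub>B\<^esub> \<rho> (g [^]\<^bsub>A\<^esub> n) = \<rho> a" "y \<otimes>\<^bsub>B\<^esub> \<rho> (g [^]\<^bsub>A\<^esub> n) = \<rho> b"
    by (rule common_denominator[OF xy(1,2)])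
  note r = stalk_rep[OF q xy(1,2) ab(3,4,1,2) xy(3)]
  show ?thesis by (rule that[of a b]) (use ab r xy(4) in auto)
qed

definition section_map :: "'b set set \<Rightarrow> ('b set \<Rightarrow> ('b \<times> 'b) set) \<Rightarrow> 'a set \<Rightarrow> ('a \<times> 'a) set" where
  "section_map V t = (\<lambda>q\<in>{q \<in> basic_open A g. extend q \<in> V}. stalk_map q (t (extend q)))"

lemma stalk_map_closed:
  assumes q: "primeideal q A" "g \<notin> q" and z: "z \<in> carrier (localization B (carrier B - extend q))"
  shows "stalk_map q z \<in> carrier (localization A (carrier A - q))"
proof -
  interpret L: localizing_set A "carrier A - q" by (rule A.localizing_set_prime[OF q(1)])
  obtain a s where as: "a \<in> carrier A" "s \<in> carrier A - q" "z = fracB (extend q) (\<rho> a) (\<rho> s)"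
    by (rule stalk_cases[OF q z])
  show ?thesis unfolding as(3) stalk_map_frac[OF q as(1,2)] by (rule L.loc_frac_carrier[OF as(1,2)])
qed

lemma stalk_map_inj:
  assumes q: "primeideal q A" "g \<notin> q"
    and z: "z \<in> carrier (localization B (carrier B - extend q))"
    and w: "w \<in> carrier (localization B (carrier B - extend q))"
    and "stalk_map q z = stalk_map q w"
  shows "z = w"
proof -
  obtain a s where as: "a \<in> carrier A" "s \<in> carrier A - q" "z = fracB (extend q) (\<rho> a) (\<rho> s)"
    by (rule stalk_cases[OF q z])
  obtain b t where bt: "b \<in> carrier A" "t \<in> carrier A - q" "w = fracB (extend q) (\<rho> b) (\<rho> t)"
    by (rule stalk_cases[OF q w])
  show ?thesis
    using assms(5) unfolding as(3) bt(3) frac_rho_eq_iff[OF q as(1,2) bt(1,2)]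
      stalk_map_frac[OF q as(1,2)] stalk_map_frac[OF q bt(1,2)] .
qed

lemma stalk_map_hom:
  assumes q: "primeideal q A" "g \<notin> q"
    and z: "z \<in> carrier (localization B (carrier B - extend q))"
    and w: "w \<in> carrier (localization B (carrier B - extend q))"
  shows "stalk_map q (z \<otimes>\<^bsub>localization B (carrier B - extend q)\<^esub> w) =
      stalk_map q z \<otimes>\<^bsub>localization A (carrier A - q)\<^esub> stalk_map q w"
    and "stalk_map q (z \<oplus>\<^bsub>localization B (carrier B - extend q)\<^esub> w) =
      stalk_map q z \<oplus>\<^bsub>localization A (carrier A - q)\<^esub> stalk_map q w"
    and "stalk_map q \<one>\<^bsub>localization B (carrier B - extend q)\<^esub> = \<one>\<^bsub>localization A (carrier A - q)\<^esub>"
proof -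
  interpret LA: localizing_set A "carrier A - q" by (rule A.localizing_set_prime[OF q(1)])
  interpret LB: localizing_set B "carrier B - extend q"
    by (rule B.localizing_set_prime[OF extend_prime[OF q]])
  obtain a s where as: "a \<in> carrier A" "s \<in> carrier A - q" "z = fracB (extend q) (\<rho> a) (\<rho> s)"
    by (rule stalk_cases[OF q z])
  obtain b t where bt: "b \<in> carrier A" "t \<in> carrier A - q" "w = fracB (extend q) (\<rho> b) (\<rho> t)"
    by (rule stalk_cases[OF q w])
  have sc: "s \<in> carrier A" "t \<in> carrier A" using as bt by auto
  have S: "\<rho> s \<in> carrier B - extend q" "\<rho> t \<in> carrier B - extend q"
    using as(2) bt(2) rho_extend_iff[OF q] by auto
  have st: "s \<otimes>\<^bsub>A\<^esub> t \<in> carrier A - q" by (rule LA.mult_mem[OF as(2) bt(2)])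
  have "z \<otimes>\<^bsub>localization B (carrier B - extend q)\<^esub> w = fracB (extend q) (\<rho> (a \<otimes>\<^bsub>A\<^esub> b)) (\<rho> (s \<otimes>\<^bsub>A\<^esub> t))"
    unfolding as(3) bt(3) using as(1) bt(1) sc
    by (simp add: LB.localization_mult[OF h.hom_closed[OF as(1)] h.hom_closed[OF bt(1)] S])
  then show "stalk_map q (z \<otimes>\<^bsub>localization B (carrier B - extend q)\<^esub> w) =
      stalk_map q z \<otimes>\<^bsub>localization A (carrier A - q)\<^esub> stalk_map q w"
    using stalk_map_frac[OF q A.m_closed[OF as(1) bt(1)] st]
    by (simp only: as(3) bt(3) stalk_map_frac[OF q as(1,2)] stalk_map_frac[OF q bt(1,2)]
        LA.localization_mult[OF as(1) bt(1) as(2) bt(2)])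
  have c: "a \<otimes>\<^bsub>A\<^esub> t \<oplus>\<^bsub>A\<^esub> b \<otimes>\<^bsub>A\<^esub> s \<in> carrier A" using as(1) bt(1) sc by simp
  have "z \<oplus>\<^bsub>localization B (carrier B - extend q)\<^esub> w =
      fracB (extend q) (\<rho> (a \<otimes>\<^bsub>A\<^esub> t \<oplus>\<^bsub>A\<^esub> b \<otimes>\<^bsub>A\<^esub> s)) (\<rho> (s \<otimes>\<^bsub>A\<^esub> t))"
    unfolding as(3) bt(3) using as(1) bt(1) sc
    by (simp add: LB.localization_add[OF h.hom_closed[OF as(1)] h.hom_closed[OF bt(1)] S])
  then show "stalk_map q (z \<oplus>\<^bsub>localization B (carrier B - extend q)\<^esub> w) =
      stalk_map q z \<oplus>\<^bsub>localization A (carrier A - q)\<^esub> stalk_map q w"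
    using stalk_map_frac[OF q c st]
    by (simp only: as(3) bt(3) stalk_map_frac[OF q as(1,2)] stalk_map_frac[OF q bt(1,2)]
        LA.localization_add[OF as(1) bt(1) as(2) bt(2)])
  show "stalk_map q \<one>\<^bsub>localization B (carrier B - extend q)\<^esub> = \<one>\<^bsub>localization A (carrier A - q)\<^esub>"
    using stalk_map_frac[OF q A.one_closed LA.one_mem]
    by (simp only: LA.localization_one LB.localization_one h.hom_one)
qed

lemma section_stalk:
  assumes "t \<in> Spec_sections B V" "p \<in> V"
  shows "t p \<in> carrier (localization B (carrier B - p))"
  using assms by (auto simp: Spec_sections_def)

text \<open>Where a section over \<open>B\<close> is the fraction \<open>x / y\<close>, its image is
  \<open>a / b\<close>, the numerators of \<open>x\<close> and \<open>y\<close> over one common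
  power of \<open>g\<close>.\<close>

lemma section_map_closed:
  assumes V: "openin (zariski_topology B) V" and t: "t \<in> Spec_sections B V"
  shows "section_map V t \<in> Spec_sections A {q \<in> basic_open A g. extend q \<in> V}"
proof -
  let ?U = "{q \<in> basic_open A g. extend q \<in> V}"
  have "section_map V t \<in> (\<Pi>\<^sub>E q\<in>?U. carrier (localization A (carrier A - q)))"
    unfolding section_map_def
  proof (rule restrict_PiE_iff[THEN iffD2], rule ballI)
    fix q assume q: "q \<in> ?U"
    then show "stalk_map q (t (extend q)) \<in> carrier (localization A (carrier A - q))"
      using section_stalk[OF t] by (intro stalk_map_closed) (auto simp: basic_open_def)
  qed
  moreover have "\<exists>U. openin (zariski_topology A) U \<and> q \<in> U \<and> U \<subseteq> ?U \<and>
      (\<exists>a\<in>carrier A. \<exists>f\<in>carrier A. \<forall>r\<in>U. f \<notin> r \<and> section_map V t r = fracA r a f)"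
    if q: "q \<in> ?U" for q
  proof -
    have "extend q \<in> V" using q by blast
    obtain V' x y where V': "openin (zariski_topology B) V'" "extend q \<in> V'" "V' \<subseteq> V" and
      xy: "x \<in> carrier B" "y \<in> carrier B" and
      t': "\<forall>p\<in>V'. y \<notin> p \<and> t p = fracB p x y"
      by (rule B.Spec_sections_local[OF t \<open>extend q \<in> V\<close>])
    obtain n :: nat and a b where ab: "a \<in> carrier A" "b \<in> carrier A"
      "x \<otimes>\<^bsub>B\<^esub> \<rho> (g [^]\<^bsub>A\<^esub> n) = \<rho> a" "y \<otimes>\<^bsub>B\<^esub> \<rho> (g [^]\<^bsub>A\<^esub> n) = \<rho> b"
      by (rule common_denominator[OF xy])
    let ?U' = "{q \<in> basic_open A g. extend q \<in> V'}"
    have "b \<notin> r \<and> section_map V t r = fracA r a b" if r: "r \<in> ?U'" for r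
    proof -
      have rp: "primeideal r A" "g \<notin> r" using r by (auto simp: basic_open_def)
      have y: "y \<notin> extend r" "t (extend r) = fracB (extend r) x y" using t' r by auto
      note b = stalk_rep[OF rp xy ab(3,4,1,2) y(1)]
      have "section_map V t r = stalk_map r (t (extend r))"
        using r V'(3) by (auto simp: section_map_def)
      also have "\<dots> = fracA r a b"
        unfolding y(2) b(2) using ab(1,2) b(1) by (intro stalk_map_frac[OF rp]) auto
      finally show ?thesis using b(1) by blast
    qed
    then have "\<forall>r\<in>?U'. b \<notin> r \<and> section_map V t r = fracA r a b" by blast
    moreover have "openin (zariski_topology A) ?U'" by (rule open_preimage[OF V'(1)])
    moreover have "q \<in> ?U'" "?U' \<subseteq> ?U" using q V'(2,3) by auto
    ultimately show ?thesis using ab(1,2) by blast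
  qed
  ultimately show ?thesis unfolding Spec_sections_def by blast
qed

lemma section_map_inj:
  assumes V: "openin (zariski_topology B) V"
  shows "inj_on (section_map V) (Spec_sections B V)"
proof (rule inj_onI)
  fix s t assume s: "s \<in> Spec_sections B V" and t: "t \<in> Spec_sections B V"
    and eq: "section_map V s = section_map V t"
  show "s = t"
  proof
    fix p show "s p = t p"
    proof (cases "p \<in> V")
      case False
      then show ?thesis using s t by (auto simp: Spec_sections_def PiE_def extensional_def)
    next
      case True
      then have p: "primeideal p B" by (rule B.openin_zariski_prime[OF V])
      note q = contract_prime[OF p] and e = extend_contract[OF p]
      have "stalk_map (contract p) (s (extend (contract p))) = stalk_map (contract p) (t (extend (contract p)))"
        using fun_cong[OF eq, of "contract p"] q True by (simp add: section_map_def basic_open_def e)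
      moreover have "s (extend (contract p)) \<in> carrier (localization B (carrier B - extend (contract p)))"
        "t (extend (contract p)) \<in> carrier (localization B (carrier B - extend (contract p)))"
        unfolding e by (rule section_stalk[OF s True], rule section_stalk[OF t True])
      ultimately have "s (extend (contract p)) = t (extend (contract p))"
        by (intro stalk_map_inj[OF q])
      then show ?thesis by (simp only: e)
    qed
  qed
qed

text \<open>The preimage is built stalk by stalk, by inverting \<open>stalk_map\<close>. Where
  \<open>s\<close> is given by \<open>a / f\<close>, the result is given by
  \<open>\<rho> a / \<rho> f\<close>, so it is again locally a fraction.\<close>

lemma section_map_surj:
  assumes V: "openin (zariski_topology B) V"
    and s: "s \<in> Spec_sections A {q \<in> basic_open A g. extend q \<in> V}"
  shows "s \<in> section_map V ` Spec_sections B V"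
proof -
  let ?U = "{q \<in> basic_open A g. extend q \<in> V}"
  define t where "t = (\<lambda>p\<in>V. THE z. z \<in> carrier (localization B (carrier B - p)) \<and>
    stalk_map (contract p) z = s (contract p))"
  have tI: "t (extend q) = fracB (extend q) (\<rho> a) (\<rho> f)"
    if q: "q \<in> ?U" and af: "a \<in> carrier A" "f \<in> carrier A - q" "s q = fracA q a f" for q a f
  proof -
    have qp: "primeideal q A" "g \<notin> q" using q by (auto simp: basic_open_def)
    interpret LB: localizing_set B "carrier B - extend q"
      by (rule B.localizing_set_prime[OF extend_prime[OF qp]])
    have cl: "fracB (extend q) (\<rho> a) (\<rho> f) \<in> carrier (localization B (carrier B - extend q))"
      using af(1,2) rho_extend_iff[OF qp] by (intro LB.loc_frac_carrier) auto
    have "(THE z. z \<in> carrier (localization B (carrier B - extend q)) \<and> stalk_map q z = s q) =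
        fracB (extend q) (\<rho> a) (\<rho> f)"
    proof (rule the_equality)
      show "fracB (extend q) (\<rho> a) (\<rho> f) \<in> carrier (localization B (carrier B - extend q)) \<and>
          stalk_map q (fracB (extend q) (\<rho> a) (\<rho> f)) = s q"
        using cl stalk_map_frac[OF qp af(1,2)] af(3) by simp
      fix z assume z: "z \<in> carrier (localization B (carrier B - extend q)) \<and> stalk_map q z = s q"
      show "z = fracB (extend q) (\<rho> a) (\<rho> f)"
        by (rule stalk_map_inj[OF qp _ cl]) (use z stalk_map_frac[OF qp af(1,2)] af(3) in simp_all)
    qed
    moreover have "extend q \<in> V" using q by blast
    ultimately show ?thesis by (simp add: t_def contract_extend[OF qp])
  qed
  have loc: "\<exists>U a f. openin (zariski_topology A) U \<and> q \<in> U \<and> U \<subseteq> ?U \<and> a \<in> carrier A \<and> f \<in> carrier A \<and>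
      (\<forall>r\<in>U. f \<notin> r \<and> s r = fracA r a f)" if q: "q \<in> ?U" for q
  proof -
    obtain U a f where "openin (zariski_topology A) U" "q \<in> U" "U \<subseteq> ?U" "a \<in> carrier A" "f \<in> carrier A"
      "\<forall>r\<in>U. f \<notin> r \<and> s r = fracA r a f" by (rule A.Spec_sections_local[OF s q])
    then show ?thesis by (intro exI conjI)
  qed
  have ext: "p = extend (contract p)" "contract p \<in> ?U" if p: "p \<in> V" for p
    using extend_contract contract_prime B.openin_zariski_prime[OF V p] p by (auto simp: basic_open_def)
  have "t \<in> Spec_sections B V"
  proof -
    have local: "\<exists>V'. openin (zariski_topology B) V' \<and> p \<in> V' \<and> V' \<subseteq> V \<and>
        (\<exists>x\<in>carrier B. \<exists>y\<in>carrier B. \<forall>p'\<in>V'. y \<notin> p' \<and> t p' = fracB p' x y)" if p: "p \<in> V" for p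
    proof -
      obtain U a f where U: "openin (zariski_topology A) U" "contract p \<in> U" "U \<subseteq> ?U"
        and af: "a \<in> carrier A" "f \<in> carrier A" "\<forall>r\<in>U. f \<notin> r \<and> s r = fracA r a f"
        using loc[OF ext(2)[OF p]] by (elim exE conjE)
      have 1: "\<rho> f \<notin> p' \<and> t p' = fracB p' (\<rho> a) (\<rho> f)" if p': "p' \<in> extend ` U" for p'
      proof -
        obtain r where r: "r \<in> U" "p' = extend r" using p' by blast
        have rU: "r \<in> ?U" "f \<notin> r" "s r = fracA r a f" using r(1) U(3) af(3) by auto
        then have rp: "primeideal r A" "g \<notin> r" by (auto simp: basic_open_def)
        show ?thesis
          unfolding r(2) using tI[OF rU(1) af(1) _ rU(3)] af(2) rU(2) rho_extend_iff[OF rp af(2)] by simp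
      qed
      show ?thesis
      proof (intro exI[of _ "extend ` U"] conjI)
        show "openin (zariski_topology B) (extend ` U)"
          using U(1,3) by (intro open_image) auto
        show "p \<in> extend ` U"
          by (rule image_eqI[where f = extend and x = "contract p", OF ext(1)[OF p] U(2)])
        show "extend ` U \<subseteq> V" using U(3) by blast
        have all: "\<forall>p'\<in>extend ` U. \<rho> f \<notin> p' \<and> t p' = fracB p' (\<rho> a) (\<rho> f)"
          by (rule ballI) (rule 1)
        have ex: "\<exists>y\<in>carrier B. \<forall>p'\<in>extend ` U. y \<notin> p' \<and> t p' = fracB p' (\<rho> a) y"
          by (rule bexI[where x = "\<rho> f"], rule all, rule h.hom_closed[OF af(2)])
        show "\<exists>x\<in>carrier B. \<exists>y\<in>carrier B. \<forall>p'\<in>extend ` U. y \<notin> p' \<and> t p' = fracB p' x y"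
          by (rule bexI[where x = "\<rho> a"], rule ex, rule h.hom_closed[OF af(1)])
      qed
    qed
    have cl: "t p \<in> carrier (localization B (carrier B - p))" if p: "p \<in> V" for p
    proof -
      interpret LB: localizing_set B "carrier B - p"
        by (rule B.localizing_set_prime[OF B.openin_zariski_prime[OF V p]])
      obtain V' x y where "p \<in> V'" and xy: "x \<in> carrier B" "y \<in> carrier B"
        and V': "\<forall>p'\<in>V'. y \<notin> p' \<and> t p' = fracB p' x y"
        using local[OF p] by (elim exE conjE bexE)
      then have y: "y \<notin> p" "t p = fracB p x y" by simp_all
      show ?thesis unfolding y(2) using xy y(1) by (intro LB.loc_frac_carrier) simp_all
    qed
    have PiE: "t \<in> (\<Pi>\<^sub>E p\<in>V. carrier (localization B (carrier B - p)))"
      by (rule PiE_I, rule cl, assumption, simp add: t_def)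
    show ?thesis unfolding Spec_sections_def by (intro CollectI conjI ballI PiE local)
  qed
  moreover have "section_map V t = s"
  proof
    fix q show "section_map V t q = s q"
    proof (cases "q \<in> ?U")
      case False
      then show ?thesis using s by (auto simp: section_map_def Spec_sections_def PiE_def extensional_def)
    next
      case True
      then have qp: "primeideal q A" "g \<notin> q" by (auto simp: basic_open_def)
      obtain U a f where U: "q \<in> U"
        and af: "a \<in> carrier A" "f \<in> carrier A" "\<forall>r\<in>U. f \<notin> r \<and> s r = fracA r a f"
        using loc[OF True] by (elim exE conjE)
      have f: "f \<in> carrier A - q" "s q = fracA q a f" using af U by auto
      have "section_map V t q = stalk_map q (t (extend q))" using True by (simp add: section_map_def)
      also have "\<dots> = s q" unfolding tI[OF True af(1) f] f(2) by (rule stalk_map_frac[OF qp af(1) f(1)])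
      finally show ?thesis .
    qed
  qed
  ultimately show ?thesis by blast
qed

theorem Spec_basic_open_iso: "ringed_space_iso (open_subspace (Spec A) (basic_open A g)) (Spec B)"
proof -
  have pre: "{q \<in> topspace (base (open_subspace (Spec A) (basic_open A g))). extend q \<in> V} =
      {q \<in> basic_open A g. extend q \<in> V}" for V
    using topspace_basic_open by simp
  have "ringed_space_iso_by (open_subspace (Spec A) (basic_open A g)) (Spec B) extend section_map"
  proof (rule ringed_space_iso_byI)
    show "homeomorphic_map (base (open_subspace (Spec A) (basic_open A g))) (base (Spec B)) extend"
      using extend_homeomorphic by simp
  next
    fix V assume "openin (base (Spec B)) V"
    then have V: "openin (zariski_topology B) V" by simp
    let ?U = "{q \<in> basic_open A g. extend q \<in> V}"
    have q: "primeideal q A" "g \<notin> q" "extend q \<in> V" if "q \<in> ?U" for q using that by (auto simp: basic_open_def)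
    have "section_map V \<in> ring_iso (sect (Spec B) V) (sect (Spec A) ?U)"
    proof (rule ring_iso_memI)
      fix s assume s: "s \<in> carrier (sect (Spec B) V)"
      then show "section_map V s \<in> carrier (sect (Spec A) ?U)"
        using section_map_closed[OF V] by simp
      fix t assume t: "t \<in> carrier (sect (Spec B) V)"
      have st: "s (extend q) \<in> carrier (localization B (carrier B - extend q))"
        "t (extend q) \<in> carrier (localization B (carrier B - extend q))" if "q \<in> ?U" for q
        using s t that section_stalk by auto
      show "section_map V (s \<otimes>\<^bsub>sect (Spec B) V\<^esub> t) = section_map V s \<otimes>\<^bsub>sect (Spec A) ?U\<^esub> section_map V t"
        unfolding Spec_simps section_map_def
      proof (rule restrict_ext)
        fix r assume r: "r \<in> ?U"
        note hom = stalk_map_hom(1)[OF q(1,2)[OF r] st[OF r]]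
        show "stalk_map r (restrict (\<lambda>p. s p \<otimes>\<^bsub>localization B (carrier B - p)\<^esub> t p) V (extend r)) =
            restrict (\<lambda>q. stalk_map q (s (extend q))) ?U r \<otimes>\<^bsub>localization A (carrier A - r)\<^esub>
            restrict (\<lambda>q. stalk_map q (t (extend q))) ?U r"
          unfolding restrict_apply'[OF r] restrict_apply'[OF q(3)[OF r]] by (rule hom)
      qed
      show "section_map V (s \<oplus>\<^bsub>sect (Spec B) V\<^esub> t) = section_map V s \<oplus>\<^bsub>sect (Spec A) ?U\<^esub> section_map V t"
        unfolding Spec_simps section_map_def
      proof (rule restrict_ext)
        fix r assume r: "r \<in> ?U"
        note hom = stalk_map_hom(2)[OF q(1,2)[OF r] st[OF r]]
        show "stalk_map r (restrict (\<lambda>p. s p \<oplus>\<^bsub>localization B (carrier B - p)\<^esub> t p) V (extend r)) =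
            restrict (\<lambda>q. stalk_map q (s (extend q))) ?U r \<oplus>\<^bsub>localization A (carrier A - r)\<^esub>
            restrict (\<lambda>q. stalk_map q (t (extend q))) ?U r"
          unfolding restrict_apply'[OF r] restrict_apply'[OF q(3)[OF r]] by (rule hom)
      qed
    next
      have "stalk_map r \<one>\<^bsub>localization B (carrier B - extend r)\<^esub> = \<one>\<^bsub>localization A (carrier A - r)\<^esub>"
        if r: "r \<in> ?U" for r
      proof -
        interpret L: localizing_set B "carrier B - extend r"
          by (rule B.localizing_set_prime[OF extend_prime[OF q(1,2)[OF r]]])
        have "fracB (extend r) \<one>\<^bsub>B\<^esub> \<one>\<^bsub>B\<^esub> \<in> carrier (localization B (carrier B - extend r))"
          by (rule L.loc_frac_carrier[OF B.one_closed L.one_mem])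
        then show ?thesis using stalk_map_hom(3)[OF q(1,2)[OF r]] by blast
      qed
      then show "section_map V \<one>\<^bsub>sect (Spec B) V\<^esub> = \<one>\<^bsub>sect (Spec A) ?U\<^esub>"
        unfolding Spec_simps section_map_def by (intro restrict_ext) simp
    next
      show "bij_betw (section_map V) (carrier (sect (Spec B) V)) (carrier (sect (Spec A) ?U))"
        unfolding bij_betw_def Spec_simps
        using section_map_inj[OF V] section_map_closed[OF V] section_map_surj[OF V] by blast
    qed
    then show "section_map V \<in> ring_iso (sect (Spec B) V) (sect (open_subspace (Spec A) (basic_open A g))
        {q \<in> topspace (base (open_subspace (Spec A) (basic_open A g))). extend q \<in> V})"
      unfolding pre by simp
  next
    fix V W :: "'b set set" and s assume "W \<subseteq> V"
    then show "restr (open_subspace (Spec A) (basic_open A g))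
          {q \<in> topspace (base (open_subspace (Spec A) (basic_open A g))). extend q \<in> V}
          {q \<in> topspace (base (open_subspace (Spec A) (basic_open A g))). extend q \<in> W}
          (section_map V s) = section_map W (restr (Spec B) V W s)"
      unfolding pre by (auto simp: section_map_def fun_eq_iff)
  qed
  then show ?thesis unfolding ringed_space_iso_iff by blast
qed

end

section \<open>Strong Fatou schemes\<close>

lemma (in ring_hom_cring) denominator_hom:
  assumes f: "f \<in> carrier (ps_ring R)" and Q: "denominator R f d Q"
  shows "denominator S (h \<circ> f) d (h \<circ> Q)"
proof -
  have Qc: "Q \<in> carrier (ps_ring R)" using Q by (simp add: denominator_def)
  have e: "(h \<circ> f) \<otimes>\<^bsub>ps_ring S\<^esub> (h \<circ> Q) = h \<circ> (f \<otimes>\<^bsub>ps_ring R\<^esub> Q)"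
    by (rule ring_hom_mult[OF ps_hom f Qc, symmetric])
  obtain N where N: "\<And>n. n > N \<Longrightarrow> (f \<otimes>\<^bsub>ps_ring R\<^esub> Q) n = \<zero>\<^bsub>R\<^esub>"
    using Q by (auto simp: denominator_def R.up_iff)
  have c: "(f \<otimes>\<^bsub>ps_ring R\<^esub> Q) n \<in> carrier R" for n by (rule R.ps_mult_closed_nth[OF f Qc])
  have "h \<circ> (f \<otimes>\<^bsub>ps_ring R\<^esub> Q) \<in> carrier (UP S)"
    unfolding S.up_iff using N c by (intro conjI allI exI[of _ N]) simp_all
  then show ?thesis
    using Q hom_ps_closed[OF Qc] unfolding denominator_def e by simp
qed

lemma (in ring_hom_cring) Wrat_hom:
  assumes "f \<in> Wrat_set R"
  shows "h \<circ> f \<in> Wrat_set S"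
proof -
  obtain P Q where f: "f \<in> witt_set R" and PQ: "P \<in> carrier (UP R)" "Q \<in> carrier (UP R)"
    "P 0 = \<one>\<^bsub>R\<^esub>" "Q 0 = \<one>\<^bsub>R\<^esub>" "f \<otimes>\<^bsub>ps_ring R\<^esub> Q = P"
    using assms by (auto simp: Wrat_set_def)
  have fc: "f \<in> carrier (ps_ring R)" using f by (simp add: witt_set_def)
  have up: "h \<circ> p \<in> carrier (UP S)" if p: "p \<in> carrier (UP R)" for p
  proof -
    obtain N where "\<And>n. n > N \<Longrightarrow> p n = \<zero>\<^bsub>R\<^esub>" using p by (auto simp: R.up_iff)
    then show ?thesis using p unfolding S.up_iff R.up_iff by (intro conjI allI exI[of _ N]) simp_all
  qed
  have "(h \<circ> f) \<otimes>\<^bsub>ps_ring S\<^esub> (h \<circ> Q) = h \<circ> P"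
    using ring_hom_mult[OF ps_hom fc R.carrier_UP_ps[OF PQ(2)]] PQ(5) by simp
  moreover have "h \<circ> f \<in> witt_set S"
    using f hom_ps_closed[OF fc] by (simp add: witt_set_def)
  moreover have "(h \<circ> P) 0 = \<one>\<^bsub>S\<^esub>" "(h \<circ> Q) 0 = \<one>\<^bsub>S\<^esub>" using PQ by simp_all
  ultimately show ?thesis using up[OF PQ(1)] up[OF PQ(2)] unfolding Wrat_set_def by blast
qed

lemma (in cring) Spec_sections_restrict:
  assumes s: "s \<in> Spec_sections R U" and W: "openin (zariski_topology R) W" "W \<subseteq> U"
  shows "restrict s W \<in> Spec_sections R W"
  unfolding Spec_sections_def
proof (intro CollectI conjI ballI)
  show "restrict s W \<in> (\<Pi>\<^sub>E p\<in>W. carrier (localization R (carrier R - p)))"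
    using s W(2) by (auto simp: Spec_sections_def)
  fix p assume p: "p \<in> W"
  then have "p \<in> U" using W(2) by blast
  then obtain V a f where V: "openin (zariski_topology R) V" "p \<in> V" "V \<subseteq> U"
    and af: "a \<in> carrier R" "f \<in> carrier R" "\<forall>q\<in>V. f \<notin> q \<and> s q = loc_frac R (carrier R - q) a f"
    by (rule Spec_sections_local[OF s])
  have all: "\<forall>q\<in>V \<inter> W. f \<notin> q \<and> restrict s W q = loc_frac R (carrier R - q) a f"
    using af(3) by simp
  have ex: "\<exists>a\<in>carrier R. \<exists>f\<in>carrier R. \<forall>q\<in>V \<inter> W. f \<notin> q \<and> restrict s W q = loc_frac R (carrier R - q) a f"
    by (rule bexI[where x = a], rule bexI[where x = f], rule all, rule af(2), rule af(1))
  show "\<exists>V. openin (zariski_topology R) V \<and> p \<in> V \<and> V \<subseteq> W \<and> (\<exists>a\<in>carrier R. \<exists>f\<in>carrier R.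
      \<forall>q\<in>V. f \<notin> q \<and> restrict s W q = loc_frac R (carrier R - q) a f)"
    by (intro exI[where x = "V \<inter> W"] conjI openin_Int[OF V(1) W(1)] IntI[OF V(2) p] Int_lower2 ex)
qed

lemma ring_iso_surj:
  assumes "h \<in> ring_iso R S" "z \<in> carrier S"
  obtains x where "x \<in> carrier R" "h x = z"
proof -
  have "h ` carrier R = carrier S"
    by (rule bij_betw_imp_surj_on[OF ring_iso_memE(5)[OF assms(1)]])
  then have "z \<in> h ` carrier R" using assms(2) by simp
  then show ?thesis using that by blast
qed

lemma ex1_unique: "\<exists>!x. P x \<Longrightarrow> P a \<Longrightarrow> P b \<Longrightarrow> a = b"
  by blast

locale strong_Fatou =
  fixes X :: "('x, 'a) ringed_space"
  assumes strong_Fatou: "strong_Fatou_scheme X"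
begin

section \<open>Consequences of the sheaf axioms\<close>

abbreviation "opn U \<equiv> openin (base X) U"

lemma sheaf: "sheaf_of_rings (base X) (sect X) (restr X)"
  using strong_Fatou
  by (simp add: strong_Fatou_scheme_def integral_scheme_def scheme_def ringed_space_def)

lemma presheaf: "presheaf_of_rings (base X) (sect X) (restr X)"
  using sheaf by (simp add: sheaf_of_rings_def)

lemma sect_cring: "opn U \<Longrightarrow> cring (sect X U)"
  using presheaf by (simp add: presheaf_of_rings_def)

lemma restr_hom: "opn U \<Longrightarrow> opn V \<Longrightarrow> V \<subseteq> U \<Longrightarrow> ring_hom_cring (sect X U) (sect X V) (restr X U V)"
  using presheaf sect_cring
  by (simp add: presheaf_of_rings_def ring_hom_cring_def ring_hom_cring_axioms_def)

lemma restr_id: "opn U \<Longrightarrow> s \<in> carrier (sect X U) \<Longrightarrow> restr X U U s = s"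
  using presheaf by (simp add: presheaf_of_rings_def)

lemma restr_restr:
  "opn U \<Longrightarrow> opn V \<Longrightarrow> opn W \<Longrightarrow> V \<subseteq> U \<Longrightarrow> W \<subseteq> V \<Longrightarrow> s \<in> carrier (sect X U) \<Longrightarrow>
    restr X V W (restr X U V s) = restr X U W s"
  using presheaf by (simp add: presheaf_of_rings_def)

lemma restr_closed:
  assumes "opn U" "opn V" "V \<subseteq> U" "s \<in> carrier (sect X U)"
  shows "restr X U V s \<in> carrier (sect X V)"
  by (rule ring_hom_closed[OF ring_hom_cring.homh[OF restr_hom[OF assms(1-3)]] assms(4)])

lemma restr_one:
  assumes "opn U" "opn V" "V \<subseteq> U"
  shows "restr X U V \<one>\<^bsub>sect X U\<^esub> = \<one>\<^bsub>sect X V\<^esub>"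
  by (rule ring_hom_one[OF ring_hom_cring.homh[OF restr_hom[OF assms]]])

lemma restr_zero:
  assumes "opn U" "opn V" "V \<subseteq> U"
  shows "restr X U V \<zero>\<^bsub>sect X U\<^esub> = \<zero>\<^bsub>sect X V\<^esub>"
proof -
  interpret ring_hom_cring "sect X U" "sect X V" "restr X U V" by (rule restr_hom[OF assms])
  show ?thesis by simp
qed

lemma glue_unique:
  assumes "\<And>V. V \<in> \<U> \<Longrightarrow> opn V" "\<And>V. V \<in> \<U> \<Longrightarrow> s V \<in> carrier (sect X V)"
    and "\<And>V W. V \<in> \<U> \<Longrightarrow> W \<in> \<U> \<Longrightarrow> restr X V (V \<inter> W) (s V) = restr X W (V \<inter> W) (s W)"
  shows "\<exists>!t. t \<in> carrier (sect X (\<Union>\<U>)) \<and> (\<forall>V\<in>\<U>. restr X (\<Union>\<U>) V t = s V)"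
proof -
  have "(\<forall>V\<in>\<U>. opn V \<and> s V \<in> carrier (sect X V)) \<and>
      (\<forall>V\<in>\<U>. \<forall>W\<in>\<U>. restr X V (V \<inter> W) (s V) = restr X W (V \<inter> W) (s W))"
    by (intro conjI ballI assms)
  then show ?thesis
    by (rule sheaf[unfolded sheaf_of_rings_def, THEN conjunct2, THEN spec, THEN spec, THEN mp])
qed

lemma separated:
  assumes \<U>: "\<And>V. V \<in> \<U> \<Longrightarrow> opn V" and s: "s \<in> carrier (sect X (\<Union>\<U>))" and t: "t \<in> carrier (sect X (\<Union>\<U>))"
    and eq: "\<And>V. V \<in> \<U> \<Longrightarrow> restr X (\<Union>\<U>) V s = restr X (\<Union>\<U>) V t"
  shows "s = t"
proof -
  have o: "opn (\<Union>\<U>)" using \<U> by (rule openin_Union)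
  have sub: "V \<in> \<U> \<Longrightarrow> V \<subseteq> \<Union>\<U>" for V by blast
  have "\<exists>!u. u \<in> carrier (sect X (\<Union>\<U>)) \<and> (\<forall>V\<in>\<U>. restr X (\<Union>\<U>) V u = restr X (\<Union>\<U>) V s)"
  proof (rule glue_unique)
    fix V assume V: "V \<in> \<U>"
    show "opn V" using \<U> V .
    show "restr X (\<Union>\<U>) V s \<in> carrier (sect X V)" by (rule restr_closed[OF o \<U>[OF V] sub[OF V] s])
    fix W assume W: "W \<in> \<U>"
    have i: "opn (V \<inter> W)" using \<U>[OF V] \<U>[OF W] by (rule openin_Int)
    show "restr X V (V \<inter> W) (restr X (\<Union>\<U>) V s) = restr X W (V \<inter> W) (restr X (\<Union>\<U>) W s)"
      using restr_restr[OF o \<U>[OF V] i sub[OF V] _ s] restr_restr[OF o \<U>[OF W] i sub[OF W] _ s] by simp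
  qed
  then show ?thesis
  proof (rule ex1_unique)
    show "s \<in> carrier (sect X (\<Union>\<U>)) \<and> (\<forall>V\<in>\<U>. restr X (\<Union>\<U>) V s = restr X (\<Union>\<U>) V s)"
      using s by blast
    show "t \<in> carrier (sect X (\<Union>\<U>)) \<and> (\<forall>V\<in>\<U>. restr X (\<Union>\<U>) V t = restr X (\<Union>\<U>) V s)"
      by (intro conjI ballI t eq[symmetric])
  qed
qed

text \<open>The empty family covers the empty set, so the sheaf condition leaves exactly one section
  there.\<close>

lemma sect_empty: assumes "s \<in> carrier (sect X {})" "t \<in> carrier (sect X {})" shows "s = t"
  using separated[of "{}" s t] assms by simp

lemma sect_domain: "opn U \<Longrightarrow> U \<noteq> {} \<Longrightarrow> domain (sect X U)"
  using strong_Fatou by (simp add: strong_Fatou_scheme_def integral_scheme_def)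

lemma glue:
  assumes "\<And>V. V \<in> \<U> \<Longrightarrow> opn V" "\<And>V. V \<in> \<U> \<Longrightarrow> s V \<in> carrier (sect X V)"
    and "\<And>V W. V \<in> \<U> \<Longrightarrow> W \<in> \<U> \<Longrightarrow> restr X V (V \<inter> W) (s V) = restr X W (V \<inter> W) (s W)"
  obtains t where "t \<in> carrier (sect X (\<Union>\<U>))" "\<forall>V\<in>\<U>. restr X (\<Union>\<U>) V t = s V"
proof -
  have "\<exists>!t. t \<in> carrier (sect X (\<Union>\<U>)) \<and> (\<forall>V\<in>\<U>. restr X (\<Union>\<U>) V t = s V)"
    using assms by (rule glue_unique)
  then obtain t where "t \<in> carrier (sect X (\<Union>\<U>))" "\<forall>V\<in>\<U>. restr X (\<Union>\<U>) V t = s V"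
    by (elim ex1E conjE)
  then show ?thesis by (rule that)
qed

section \<open>Irreducibility of the underlying space\<close>

lemma idempotent_section:
  assumes U: "opn U" and V: "opn V" and "U \<inter> V = {}" "U \<noteq> {}"
  obtains e where "e \<in> carrier (sect X (U \<union> V))" "restr X (U \<union> V) U e = \<one>\<^bsub>sect X U\<^esub>"
    "restr X (U \<union> V) V e = \<zero>\<^bsub>sect X V\<^esub>"
proof -
  interpret U: cring "sect X U" by (rule sect_cring[OF U])
  interpret V: cring "sect X V" by (rule sect_cring[OF V])
  let ?s = "\<lambda>W. if W = U then \<one>\<^bsub>sect X U\<^esub> else \<zero>\<^bsub>sect X V\<^esub>"
  have "V \<noteq> U" using assms(3,4) by blast
  have cl: "?s W \<in> carrier (sect X W)" "opn W" if "W \<in> {U, V}" for W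
    using that U V \<open>V \<noteq> U\<close> by (auto split: if_splits)
  have compat: "restr X W (W \<inter> W') (?s W) = restr X W' (W \<inter> W') (?s W')"
    if W: "W \<in> {U, V}" "W' \<in> {U, V}" for W W'
  proof (cases "W = W'")
    case False
    then have e: "W \<inter> W' = {}" using W assms(3) by auto
    show ?thesis
      unfolding e by (rule sect_empty; rule restr_closed) (use cl[OF W(1)] cl[OF W(2)] in simp_all)
  qed simp
  obtain t where t: "t \<in> carrier (sect X (\<Union>{U, V}))" "\<forall>W\<in>{U, V}. restr X (\<Union>{U, V}) W t = ?s W"
    by (rule glue[of "{U, V}" ?s, OF cl(2) cl(1) compat])
  have e: "\<Union>{U, V} = U \<union> V" by simp
  have "restr X (U \<union> V) U t = \<one>\<^bsub>sect X U\<^esub>" using bspec[OF t(2), of U] unfolding e by simp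
  moreover have "restr X (U \<union> V) V t = \<zero>\<^bsub>sect X V\<^esub>"
    using bspec[OF t(2), of V] \<open>V \<noteq> U\<close> unfolding e by simp
  ultimately show ?thesis using t(1) unfolding e by (intro that)
qed

text \<open>Otherwise the section that is 1 on \<open>U\<close> and 0 on \<open>V\<close> and the
  one with the roles exchanged would be nonzero with product zero, although the sections over the
  union form a domain.\<close>

lemma irreducible:
  assumes U: "opn U" "U \<noteq> {}" and V: "opn V" "V \<noteq> {}"
  shows "U \<inter> V \<noteq> {}"
proof
  assume dis: "U \<inter> V = {}"
  have o: "opn (U \<union> V)" using U(1) V(1) by (rule openin_Un)
  interpret W: domain "sect X (U \<union> V)" using U by (intro sect_domain o) simp
  interpret U: domain "sect X U" by (rule sect_domain[OF U])
  interpret V: domain "sect X V" by (rule sect_domain[OF V])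
  interpret rU: ring_hom_cring "sect X (U \<union> V)" "sect X U" "restr X (U \<union> V) U"
    by (rule restr_hom[OF o U(1)]) simp
  interpret rV: ring_hom_cring "sect X (U \<union> V)" "sect X V" "restr X (U \<union> V) V"
    by (rule restr_hom[OF o V(1)]) simp
  obtain e where e: "e \<in> carrier (sect X (U \<union> V))" "restr X (U \<union> V) U e = \<one>\<^bsub>sect X U\<^esub>"
    "restr X (U \<union> V) V e = \<zero>\<^bsub>sect X V\<^esub>"
    by (rule idempotent_section[OF U(1) V(1) dis U(2)])
  have dis': "V \<inter> U = {}" "V \<union> U = U \<union> V" using dis by auto
  obtain e' where e': "e' \<in> carrier (sect X (U \<union> V))" "restr X (U \<union> V) V e' = \<one>\<^bsub>sect X V\<^esub>"
    "restr X (U \<union> V) U e' = \<zero>\<^bsub>sect X U\<^esub>"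
    by (rule idempotent_section[OF V(1) U(1) dis'(1) V(2), unfolded dis'(2)])
  have "e \<otimes>\<^bsub>sect X (U \<union> V)\<^esub> e' = \<zero>\<^bsub>sect X (U \<union> V)\<^esub>"
  proof (rule separated[of "{U, V}"])
    fix Z assume "Z \<in> {U, V}"
    then show "opn Z" "restr X (\<Union>{U, V}) Z (e \<otimes>\<^bsub>sect X (U \<union> V)\<^esub> e') =
        restr X (\<Union>{U, V}) Z \<zero>\<^bsub>sect X (U \<union> V)\<^esub>"
      using U V e e' by auto
  qed (use e e' in simp_all)
  then have "e = \<zero>\<^bsub>sect X (U \<union> V)\<^esub> \<or> e' = \<zero>\<^bsub>sect X (U \<union> V)\<^esub>"
    using e(1) e'(1) by (rule W.integral)
  then show False using e(2) e'(2) by auto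
qed

section \<open>Affine charts and injectivity of restrictions\<close>

lemma topspace_open: "opn V \<Longrightarrow> topspace (subtopology (base X) V) = V"
  using openin_subset[of "base X" V] by auto

text \<open>\<open>affine_open\<close> only provides a commutative ring \<open>A\<close>; that it is
  a domain is inherited from the sections over \<open>V\<close>.\<close>

lemma chart:
  assumes "affine_open X V" "V \<noteq> {}"
  obtains A :: "'a ring" and \<phi> \<theta> where "domain A"
    "ringed_space_iso_by (open_subspace X V) (Spec A) \<phi> \<theta>" "opn V"
proof -
  obtain A :: "'a ring" where A: "cring A" "ringed_space_iso (open_subspace X V) (Spec A)" and V: "opn V"
    using assms(1) unfolding affine_open_def by (elim exE conjE)
  then obtain \<phi> \<theta> where iso: "ringed_space_iso_by (open_subspace X V) (Spec A) \<phi> \<theta>"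
    unfolding ringed_space_iso_iff by (elim exE)
  interpret A: cring A by (rule A(1))
  note D = ringed_space_iso_byD[OF iso]
  have o: "openin (base (Spec A)) (prime_spectrum A)"
    using openin_topspace[of "zariski_topology A"] by (simp add: A.topspace_zariski)
  have "\<phi> ` V = prime_spectrum A"
    using homeomorphic_imp_surjective_map[OF D(1)] topspace_open[OF V] by (simp add: A.topspace_zariski)
  then have "{x \<in> topspace (base (open_subspace X V)). \<phi> x \<in> prime_spectrum A} = V"
    using topspace_open[OF V] by auto
  then have "\<theta> (prime_spectrum A) \<in> ring_iso (sect (Spec A) (prime_spectrum A)) (sect X V)"
    using D(2)[OF o] by simp
  then have "domain A" by (rule A.domain_of_domain_sections) (rule sect_domain[OF V assms(2)])
  then show ?thesis using iso V by (rule that)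
qed

lemma chart_at:
  assumes "x \<in> topspace (base X)"
  obtains V and A :: "'a ring" and \<phi> \<theta> where "x \<in> V" "opn V" "domain A"
    "ringed_space_iso_by (open_subspace X V) (Spec A) \<phi> \<theta>"
proof -
  obtain V where V: "x \<in> V" "affine_open X V"
    using strong_Fatou assms unfolding strong_Fatou_scheme_def integral_scheme_def scheme_def by blast
  then have "V \<noteq> {}" by blast
  show ?thesis by (rule chart[OF V(2) \<open>V \<noteq> {}\<close>]) (rule that[OF V(1)])
qed

lemma chart_image:
  assumes V: "opn V" and A: "cring A" and iso: "ringed_space_iso_by (open_subspace X V) (Spec A) \<phi> \<theta>"
    and U: "opn U" "U \<subseteq> V"
  shows "openin (zariski_topology A) (\<phi> ` U)"
    and "{x \<in> topspace (base (open_subspace X V)). \<phi> x \<in> \<phi> ` U} = U"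
    and "\<theta> (\<phi> ` U) \<in> ring_iso (sect (Spec A) (\<phi> ` U)) (sect X U)"
proof -
  note D = ringed_space_iso_byD[OF iso]
  have top: "topspace (base (open_subspace X V)) = V" using topspace_open[OF V] by simp
  have "openin (subtopology (base X) V) U" using openin_open_subtopology[OF V] U by simp
  then show o: "openin (zariski_topology A) (\<phi> ` U)"
    using homeomorphic_imp_open_map[OF D(1)] by (simp add: open_map_def)
  have inj: "inj_on \<phi> V" using homeomorphic_imp_injective_map[OF D(1)] unfolding top .
  show e: "{x \<in> topspace (base (open_subspace X V)). \<phi> x \<in> \<phi> ` U} = U"
    unfolding top using inj_on_image_mem_iff[OF inj _ U(2)] U(2) by blast
  have "openin (base (Spec A)) (\<phi> ` U)" using o by simp
  from D(2)[OF this] show "\<theta> (\<phi> ` U) \<in> ring_iso (sect (Spec A) (\<phi> ` U)) (sect X U)"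
    unfolding e by simp
qed

text \<open>Near a point of \<open>U\<close>, choose an affine chart. By irreducibility
  \<open>W\<close> meets it, so the image of \<open>W\<close> contains the generic point, and the
  germ there determines a section. The resulting local equalities give \<open>s = t\<close> by the
  sheaf condition.\<close>

lemma restr_inj:
  assumes U: "opn U" and W: "opn W" "W \<subseteq> U" "W \<noteq> {}"
  shows "inj_on (restr X U W) (carrier (sect X U))"
proof (rule inj_onI)
  fix s t assume s: "s \<in> carrier (sect X U)" and t: "t \<in> carrier (sect X U)"
    and eq: "restr X U W s = restr X U W t"
  have loc: "\<exists>Z. opn Z \<and> x \<in> Z \<and> Z \<subseteq> U \<and> restr X U Z s = restr X U Z t" if x: "x \<in> U" for x
  proof -
    have "x \<in> topspace (base X)" using openin_subset[OF U] x by blast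
    then obtain V and A :: "'a ring" and \<phi> \<theta> where V: "x \<in> V" "opn V" and dA: "domain A"
      and iso: "ringed_space_iso_by (open_subspace X V) (Spec A) \<phi> \<theta>"
      by (rule chart_at)
    interpret A: domain A by fact
    let ?Z = "U \<inter> V" and ?Y = "W \<inter> V"
    have Z: "opn ?Z" "?Z \<subseteq> V" "?Z \<subseteq> U" using U V by auto
    have Y: "opn ?Y" "?Y \<subseteq> V" "?Y \<subseteq> ?Z" "?Y \<subseteq> W" using W V by auto
    have "V \<noteq> {}" using V(1) by blast
    have Yne: "?Y \<noteq> {}" by (rule irreducible[OF W(1,3) V(2) \<open>V \<noteq> {}\<close>])
    note cZ = chart_image[OF V(2) A.is_cring iso Z(1,2)] and cY = chart_image[OF V(2) A.is_cring iso Y(1,2)]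
    have sub: "\<phi> ` ?Y \<subseteq> \<phi> ` ?Z" using Y(3) by (rule image_mono)
    obtain \<sigma> where "\<sigma> \<in> carrier (sect (Spec A) (\<phi> ` ?Z))" and \<sigma>2: "\<theta> (\<phi> ` ?Z) \<sigma> = restr X U ?Z s"
      by (rule ring_iso_surj[OF cZ(3) restr_closed[OF U Z(1,3) s]])
    then have \<sigma>: "\<sigma> \<in> Spec_sections A (\<phi> ` ?Z)" by simp
    obtain \<tau> where "\<tau> \<in> carrier (sect (Spec A) (\<phi> ` ?Z))" and \<tau>2: "\<theta> (\<phi> ` ?Z) \<tau> = restr X U ?Z t"
      by (rule ring_iso_surj[OF cZ(3) restr_closed[OF U Z(1,3) t]])
    then have \<tau>: "\<tau> \<in> Spec_sections A (\<phi> ` ?Z)" by simp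
    have op: "openin (base (Spec A)) (\<phi> ` ?Z)" "openin (base (Spec A)) (\<phi> ` ?Y)"
      using cZ(1) cY(1) by simp_all
    have nat: "\<theta> (\<phi> ` ?Y) (restrict \<upsilon> (\<phi> ` ?Y)) = restr X ?Z ?Y (\<theta> (\<phi> ` ?Z) \<upsilon>)"
      if "\<upsilon> \<in> Spec_sections A (\<phi> ` ?Z)" for \<upsilon>
      using ringed_space_iso_byD(3)[OF iso op sub, of \<upsilon>] that unfolding cZ(2) cY(2) by simp
    have r: "restr X ?Z ?Y (restr X U ?Z z) = restr X W ?Y (restr X U W z)" if z: "z \<in> carrier (sect X U)" for z
      using restr_restr[OF U Z(1) Y(1) Z(3) Y(3) z] restr_restr[OF U W(1) Y(1) W(2) Y(4) z] by simp
    have eq': "\<theta> (\<phi> ` ?Y) (restrict \<sigma> (\<phi> ` ?Y)) = \<theta> (\<phi> ` ?Y) (restrict \<tau> (\<phi> ` ?Y))"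
      unfolding nat[OF \<sigma>] nat[OF \<tau>] \<sigma>2 \<tau>2 r[OF s] r[OF t] eq ..
    have inj: "inj_on (\<theta> (\<phi> ` ?Y)) (Spec_sections A (\<phi> ` ?Y))"
      using bij_betw_imp_inj_on[OF ring_iso_memE(5)[OF cY(3)]] by simp
    have "restrict \<sigma> (\<phi> ` ?Y) = restrict \<tau> (\<phi> ` ?Y)"
      by (rule inj_onD[OF inj eq' A.Spec_sections_restrict[OF \<sigma> cY(1) sub]
            A.Spec_sections_restrict[OF \<tau> cY(1) sub]])
    then have "restrict \<sigma> (\<phi> ` ?Y) {\<zero>\<^bsub>A\<^esub>} = restrict \<tau> (\<phi> ` ?Y) {\<zero>\<^bsub>A\<^esub>}"
      by (rule fun_cong)
    moreover have z0: "{\<zero>\<^bsub>A\<^esub>} \<in> \<phi> ` ?Y" using Yne by (intro A.zero_mem_open[OF cY(1)]) simp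
    ultimately have "\<sigma> {\<zero>\<^bsub>A\<^esub>} = \<tau> {\<zero>\<^bsub>A\<^esub>}" by (simp only: restrict_apply'[OF z0])
    then have "\<sigma> = \<tau>" by (rule A.germ_zero_inj[OF cZ(1) \<sigma> \<tau>])
    then have "restr X U ?Z s = restr X U ?Z t" using \<sigma>2 \<tau>2 by simp
    then show ?thesis using Z x V(1) by (intro exI[of _ ?Z]) simp
  qed
  let ?C = "{Z. opn Z \<and> Z \<subseteq> U \<and> restr X U Z s = restr X U Z t}"
  have cov: "\<Union>?C = U" using loc by blast
  show "s = t"
  proof (rule separated[of ?C])
    show "s \<in> carrier (sect X (\<Union>?C))" "t \<in> carrier (sect X (\<Union>?C))" unfolding cov by (rule s, rule t)
    fix Z assume Z: "Z \<in> ?C"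
    then show "opn Z" by simp
    show "restr X (\<Union>?C) Z s = restr X (\<Union>?C) Z t" unfolding cov using Z by simp
  qed
qed

text \<open>Inside a chart, pass to a basic open set \<open>?D\<close> within the image of
  \<open>U\<close>. Its sections are \<open>A\<close> with \<open>g\<close> inverted, so
  \<open>Spec_basic_open_iso\<close> makes \<open>W\<close> isomorphic to the spectrum of its own
  ring of sections.\<close>

lemma affine_basis:
  assumes U: "opn U" and x: "x \<in> U"
  obtains W where "affine_open X W" "x \<in> W" "W \<subseteq> U" "opn W"
proof -
  have "x \<in> topspace (base X)" using openin_subset[OF U] x by blast
  then obtain V and A :: "'a ring" and \<phi> \<theta> where V: "x \<in> V" "opn V" and dA: "domain A"
    and iso: "ringed_space_iso_by (open_subspace X V) (Spec A) \<phi> \<theta>"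
    by (rule chart_at)
  interpret A: domain A by fact
  have top: "topspace (base (open_subspace X V)) = V" using topspace_open[OF V(2)] by simp
  have UV: "opn (U \<inter> V)" "U \<inter> V \<subseteq> V" using U V by auto
  note c = chart_image[OF V(2) A.is_cring iso UV]
  have "\<phi> x \<in> \<phi> ` (U \<inter> V)" using x V(1) by blast
  then obtain g where g: "g \<in> carrier A" "\<phi> x \<in> basic_open A g" "basic_open A g \<subseteq> \<phi> ` (U \<inter> V)"
    using c(1) unfolding A.openin_zariski by blast
  let ?D = "basic_open A g"
  define W where "W = {y \<in> topspace (base (open_subspace X V)). \<phi> y \<in> ?D}"
  have "W \<subseteq> {y \<in> topspace (base (open_subspace X V)). \<phi> y \<in> \<phi> ` (U \<inter> V)}"
    unfolding W_def using g(3) by blast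
  then have WUV: "W \<subseteq> U \<inter> V" unfolding c(2) .
  have xW: "x \<in> W" unfolding W_def top using V(1) g(2) by blast
  have oD: "openin (zariski_topology A) ?D" "openin (base (Spec A)) ?D"
    using A.openin_basic_open[OF g(1)] by simp_all
  have "openin (base (open_subspace X V)) W"
    unfolding W_def
    by (rule openin_continuous_map_preimage[OF homeomorphic_imp_continuous_map[OF ringed_space_iso_byD(1)[OF iso]] oD(2)])
  then have oW: "opn W" using openin_open_subtopology[OF V(2), of W] by simp
  have "W \<noteq> {}" using xW by blast
  interpret B: domain "sect X W" by (rule sect_domain[OF oW \<open>W \<noteq> {}\<close>])
  have \<theta>: "\<theta> ?D \<in> ring_iso (sect (Spec A) ?D) (sect X W)"
    using ringed_space_iso_byD(2)[OF iso oD(2)] unfolding W_def[symmetric] by simp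
  define \<rho> where "\<rho> = (\<lambda>a. \<theta> ?D (sec A ?D a))"
  have hom: "ring_hom_cring A (sect X W) \<rho>"
    using A.sec_hom[OF oD(1) \<theta>] A.is_cring B.is_cring
    by (simp add: \<rho>_def ring_hom_cring_def ring_hom_cring_axioms_def)
  interpret h: ring_hom_cring A "sect X W" \<rho> by (rule hom)
  \<comment> \<open>The generic point serves twice: it shows that \<open>g\<close> is nonzero, and
    comparing germs there makes \<open>\<rho>\<close> injective.\<close>
  have zD: "{\<zero>\<^bsub>A\<^esub>} \<in> ?D" using g(2) by (intro A.zero_mem_open[OF oD(1)]) blast
  then have g0: "g \<noteq> \<zero>\<^bsub>A\<^esub>" by (simp add: basic_open_def)
  have inj\<theta>: "inj_on (\<theta> ?D) (Spec_sections A ?D)"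
    using ring_iso_memE(5)[OF \<theta>] by (simp add: bij_betw_def)
  have secc: "sec A ?D a \<in> Spec_sections A ?D" if "a \<in> carrier A" for a
    by (rule A.sec_Spec_sections[OF oD(1) that])
  have inj: "inj_on \<rho> (carrier A)"
  proof (rule inj_onI)
    fix a b assume ab: "a \<in> carrier A" "b \<in> carrier A" "\<rho> a = \<rho> b"
    have "sec A ?D a = sec A ?D b"
      by (rule inj_onD[OF inj\<theta> ab(3)[unfolded \<rho>_def] secc[OF ab(1)] secc[OF ab(2)]])
    then have "sec A ?D a {\<zero>\<^bsub>A\<^esub>} = sec A ?D b {\<zero>\<^bsub>A\<^esub>}" by simp
    then have "loc_frac A (carrier A - {\<zero>\<^bsub>A\<^esub>}) a \<one>\<^bsub>A\<^esub> = loc_frac A (carrier A - {\<zero>\<^bsub>A\<^esub>}) b \<one>\<^bsub>A\<^esub>"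
      using zD by (simp add: sec_def)
    then show "a = b" using ab(1,2) by (simp add: A.loc_frac_prime_eq[OF A.zeroprimeideal])
  qed
  have unit: "\<rho> g \<in> Units (sect X W)"
  proof -
    \<comment> \<open>The section \<open>1 / g\<close>, whose image is inverse to
      \<open>\<rho> g\<close>.\<close>
    let ?i = "\<lambda>p\<in>?D. loc_frac A (carrier A - p) \<one>\<^bsub>A\<^esub> g"
    have i: "?i \<in> Spec_sections A ?D" by (rule A.Spec_sections_fraction[OF oD(1) A.one_closed g(1)]) simp
    have "sec A ?D g \<otimes>\<^bsub>sect (Spec A) ?D\<^esub> ?i = \<one>\<^bsub>sect (Spec A) ?D\<^esub>"
      unfolding Spec_simps
    proof (rule restrict_ext)
      fix p assume p: "p \<in> ?D"
      then have pp: "primeideal p A" "g \<notin> p" by (auto simp: basic_open_def)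
      interpret L: localizing_set A "carrier A - p" by (rule A.localizing_set_prime[OF pp(1)])
      have gS: "g \<in> carrier A - p" using g(1) pp(2) by simp
      have "sec A ?D g p \<otimes>\<^bsub>localization A (carrier A - p)\<^esub> ?i p =
          loc_frac A (carrier A - p) (g \<otimes>\<^bsub>A\<^esub> \<one>\<^bsub>A\<^esub>) (\<one>\<^bsub>A\<^esub> \<otimes>\<^bsub>A\<^esub> g)"
        unfolding sec_def restrict_apply'[OF p]
        by (rule L.localization_mult[OF g(1) A.one_closed L.one_mem gS])
      also have "\<dots> = \<one>\<^bsub>localization A (carrier A - p)\<^esub>"
        unfolding L.localization_one using g(1) gS L.one_mem
        by (subst A.loc_frac_prime_eq[OF pp(1)]) simp_all
      finally show "sec A ?D g p \<otimes>\<^bsub>localization A (carrier A - p)\<^esub> ?i p = \<one>\<^bsub>localization A (carrier A - p)\<^esub>" .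
    qed
    then have "\<rho> g \<otimes>\<^bsub>sect X W\<^esub> \<theta> ?D ?i = \<one>\<^bsub>sect X W\<^esub>"
      using ring_iso_memE(2)[OF \<theta>, of "sec A ?D g" ?i] ring_iso_memE(4)[OF \<theta>] secc[OF g(1)] i
      by (simp add: \<rho>_def del: Spec_simps(3,5))
    moreover have "\<theta> ?D ?i \<in> carrier (sect X W)" using ring_iso_memE(1)[OF \<theta>, of ?i] i by simp
    ultimately show ?thesis
      using g(1) by (intro B.unit_factor[of "\<rho> g" "\<theta> ?D ?i"]) simp_all
  qed
  have fraction: "\<exists>n::nat. \<exists>a\<in>carrier A. y \<otimes>\<^bsub>sect X W\<^esub> \<rho> (g [^]\<^bsub>A\<^esub> n) = \<rho> a" if y: "y \<in> carrier (sect X W)" for y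
  proof -
    obtain s where "s \<in> carrier (sect (Spec A) ?D)" and s2: "\<theta> ?D s = y"
      by (rule ring_iso_surj[OF \<theta> y])
    then have s: "s \<in> Spec_sections A ?D" by simp
    obtain n :: nat and a where a: "a \<in> carrier A"
      "s \<otimes>\<^bsub>sect (Spec A) ?D\<^esub> sec A ?D (g [^]\<^bsub>A\<^esub> n) = sec A ?D a"
      by (rule A.sections_basic_open[OF g(1) g0 s])
    have "\<theta> ?D (s \<otimes>\<^bsub>sect (Spec A) ?D\<^esub> sec A ?D (g [^]\<^bsub>A\<^esub> n)) = y \<otimes>\<^bsub>sect X W\<^esub> \<rho> (g [^]\<^bsub>A\<^esub> n)"
      unfolding \<rho>_def s2[symmetric]
      by (rule ring_iso_memE(2)[OF \<theta>]) (use s secc[OF A.nat_pow_closed[OF g(1)]] in simp_all)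
    then have "y \<otimes>\<^bsub>sect X W\<^esub> \<rho> (g [^]\<^bsub>A\<^esub> n) = \<rho> a" unfolding a(2) \<rho>_def ..
    then show ?thesis using a(1) by blast
  qed
  interpret loc: basic_localization A "sect X W" \<rho> g
    by unfold_locales (rule g(1), rule inj, rule unit, rule fraction)
  have "ringed_space_iso (open_subspace (open_subspace X V) W) (open_subspace (Spec A) ?D)"
    unfolding ringed_space_iso_iff W_def using ringed_space_iso_by_restrict[OF iso oD(2)] by blast
  moreover have "open_subspace (open_subspace X V) W = open_subspace X W"
  proof -
    have "V \<inter> W = W" using WUV by blast
    then show ?thesis by (simp add: open_subspace_def subtopology_subtopology)
  qed
  ultimately have "ringed_space_iso (open_subspace X W) (Spec (sect X W))"
    using ringed_space_iso_trans[OF _ loc.Spec_basic_open_iso] by simp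
  then have "affine_open X W" unfolding affine_open_def using oW B.is_cring by blast
  then show ?thesis using xW WUV oW by (intro that) auto
qed

section \<open>Equality of the two subrings\<close>

lemma WJ_imp_Wrat:
  assumes U: "opn U" "U \<noteq> {}" and f: "f \<in> WJ_set (sect X U)"
  shows "f \<in> Wrat_set (sect X U)"
proof -
  interpret U: domain "sect X U" by (rule sect_domain[OF U])
  have fw: "f \<in> witt_set (sect X U)" using f by (simp add: WJ_set_def)
  then have fc: "f \<in> carrier (ps_ring (sect X U))" by (simp add: witt_set_def)
  obtain n where "\<forall>c. ring_det (sect X U) (Suc n) (\<lambda>i j. f (i + c j)) = \<zero>\<^bsub>sect X U\<^esub>"
    using U.WJ_imp_recurrent[OF f] by (elim exE)
  then have "recurrent (sect X U) f n"
    unfolding U.recurrent_iff_minors[OF fc] by (intro exI[of _ 0]) simp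
  then obtain d where d: "recurrence_order (sect X U) f d"
    using recurrent_imp_order by blast
  have order: "recurrence_order (sect X W) (restr X U W \<circ> f) d" if W: "opn W" "W \<subseteq> U" "W \<noteq> {}" for W
    using recurrence_order_hom[OF restr_hom[OF U(1) W(1,2)] restr_inj[OF U(1) W] U.domain_axioms
        sect_domain[OF W(1,3)] fc] d by simp
  let ?C = "{W. affine_open X W \<and> W \<noteq> {} \<and> W \<subseteq> U \<and> opn W}"
  have cov: "\<Union>?C = U"
  proof
    show "U \<subseteq> \<Union>?C"
    proof
      fix x assume "x \<in> U"
      then obtain W where "affine_open X W" "x \<in> W" "W \<subseteq> U" "opn W" by (rule affine_basis[OF U(1)])
      then show "x \<in> \<Union>?C" by blast
    qed
  qed blast
  have oC: "\<And>W. W \<in> ?C \<Longrightarrow> opn W" and subC: "\<And>W. W \<in> ?C \<Longrightarrow> W \<subseteq> U" by auto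
  have fW: "restr X U W \<circ> f \<in> carrier (ps_ring (sect X W))" if "opn W" "W \<subseteq> U" for W
    by (rule ring_hom_cring.hom_ps_closed[OF restr_hom[OF U(1) that] fc])
  have ex: "\<forall>W. \<exists>Q. W \<in> ?C \<longrightarrow> denominator (sect X W) (restr X U W \<circ> f) d Q \<and> Q 0 = \<one>\<^bsub>sect X W\<^esub>"
  proof
    fix W
    show "\<exists>Q. W \<in> ?C \<longrightarrow> denominator (sect X W) (restr X U W \<circ> f) d Q \<and> Q 0 = \<one>\<^bsub>sect X W\<^esub>"
    proof (cases "W \<in> ?C")
      case True
      then have W: "opn W" "W \<subseteq> U" "W \<noteq> {}" by auto
      have "strong_Fatou_domain (sect X W)"
        using True strong_Fatou by (simp add: strong_Fatou_scheme_def)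
      then obtain Q where "denominator (sect X W) (restr X U W \<circ> f) d Q" "Q 0 = \<one>\<^bsub>sect X W\<^esub>"
        by (rule strong_Fatou_denominator[OF _ fW[OF W(1,2)] order[OF W]])
      then show ?thesis by blast
    qed blast
  qed
  obtain Q where Q: "\<And>W. W \<in> ?C \<Longrightarrow> denominator (sect X W) (restr X U W \<circ> f) d (Q W)"
    "\<And>W. W \<in> ?C \<Longrightarrow> Q W 0 = \<one>\<^bsub>sect X W\<^esub>"
    using choice[OF ex] by blast
  have Qc: "Q W t \<in> carrier (sect X W)" if "W \<in> ?C" for W t
    using Q(1)[OF that] by (simp add: denominator_def ps_simps)
  have compat: "restr X W (W \<inter> W') (Q W t) = restr X W' (W \<inter> W') (Q W' t)"
    if W: "W \<in> ?C" and W': "W' \<in> ?C" for W W' t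
  proof -
    have o: "opn W" "opn W'" "opn (W \<inter> W')" using W W' by auto
    show ?thesis
    proof (cases "W \<inter> W' = {}")
      case True
      show ?thesis
        using restr_closed[OF o(1,3) _ Qc[OF W]] restr_closed[OF o(2,3) _ Qc[OF W']]
        unfolding True by (intro sect_empty) simp_all
    next
      case False
      have s: "W \<subseteq> U" "W' \<subseteq> U" "W \<inter> W' \<subseteq> W" "W \<inter> W' \<subseteq> W'" "W \<inter> W' \<subseteq> U" using W W' by auto
      have den: "denominator (sect X (W \<inter> W')) (restr X U (W \<inter> W') \<circ> f) d (restr X V (W \<inter> W') \<circ> Q V)"
        if V: "V \<in> ?C" "W \<inter> W' \<subseteq> V" for V
      proof -
        have "restr X V (W \<inter> W') \<circ> (restr X U V \<circ> f) = restr X U (W \<inter> W') \<circ> f"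
          using restr_restr[OF U(1) oC[OF V(1)] o(3) subC[OF V(1)] V(2)] fc by (auto simp: ps_simps)
        then show ?thesis
          using ring_hom_cring.denominator_hom[OF restr_hom[OF oC[OF V(1)] o(3) V(2)]
              fW[OF oC[OF V(1)] subC[OF V(1)]] Q(1)[OF V(1)]] by simp
      qed
      have one: "(restr X V (W \<inter> W') \<circ> Q V) 0 = \<one>\<^bsub>sect X (W \<inter> W')\<^esub>" if V: "V \<in> ?C" "W \<inter> W' \<subseteq> V" for V
        using restr_one[OF oC[OF V(1)] o(3) V(2)] Q(2)[OF V(1)] by simp
      have "restr X W (W \<inter> W') \<circ> Q W = restr X W' (W \<inter> W') \<circ> Q W'"
      \<comment> \<open>No smaller degree is possible over the overlap either, and both restricted
        denominators have constant term 1.\<close>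
      proof (rule cring.denominator_unique[OF sect_cring[OF o(3)] fW[OF o(3) s(5)] _ den[OF W s(3)] den[OF W' s(4)]])
        show "\<forall>e<d. \<not> recurrent (sect X (W \<inter> W')) (restr X U (W \<inter> W') \<circ> f) e"
          using order[OF o(3) s(5) False] by (simp add: recurrence_order_def)
        show "(restr X W (W \<inter> W') \<circ> Q W) 0 = (restr X W' (W \<inter> W') \<circ> Q W') 0"
          unfolding one[OF W s(3)] one[OF W' s(4)] ..
      qed
      then show ?thesis by (rule comp_eq_dest)
    qed
  qed
  have "\<forall>t. \<exists>q. q \<in> carrier (sect X U) \<and> (\<forall>W\<in>?C. restr X U W q = Q W t)"
  proof
    fix t
    obtain q where q: "q \<in> carrier (sect X (\<Union>?C))" "\<forall>W\<in>?C. restr X (\<Union>?C) W q = Q W t"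
      by (rule glue[of ?C "\<lambda>W. Q W t", OF oC Qc compat])
    then have "q \<in> carrier (sect X U) \<and> (\<forall>W\<in>?C. restr X U W q = Q W t)"
      unfolding cov by (rule conjI)
    then show "\<exists>q. q \<in> carrier (sect X U) \<and> (\<forall>W\<in>?C. restr X U W q = Q W t)" by (rule exI)
  qed
  from choice[OF this] obtain q
    where qq: "\<forall>t. q t \<in> carrier (sect X U) \<and> (\<forall>W\<in>?C. restr X U W (q t) = Q W t)" ..
  have q: "q t \<in> carrier (sect X U)" for t
    using spec[OF qq, of t] by (rule conjunct1)
  have q': "\<forall>W\<in>?C. restr X U W (q t) = Q W t" for t
    using spec[OF qq, of t] by (rule conjunct2)
  note q = q bspec[OF q']
  have sep: "s = s'" if "s \<in> carrier (sect X U)" "s' \<in> carrier (sect X U)"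
    "\<And>W. W \<in> ?C \<Longrightarrow> restr X U W s = restr X U W s'" for s s'
    by (rule separated[of ?C s s', unfolded cov, OF oC that])
  have q0: "q 0 = \<one>\<^bsub>sect X U\<^esub>"
  proof (rule sep)
    fix W assume W: "W \<in> ?C"
    show "restr X U W (q 0) = restr X U W \<one>\<^bsub>sect X U\<^esub>"
      unfolding q(2)[OF W] Q(2)[OF W] restr_one[OF U(1) oC[OF W] subC[OF W]] ..
  qed (rule q(1), rule U.one_closed)
  have qd: "q t = \<zero>\<^bsub>sect X U\<^esub>" if "t > d" for t
  proof (rule sep)
    fix W assume W: "W \<in> ?C"
    have "Q W t = \<zero>\<^bsub>sect X W\<^esub>" using Q(1)[OF W] that by (simp add: denominator_def)
    then show "restr X U W (q t) = restr X U W \<zero>\<^bsub>sect X U\<^esub>"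
      unfolding q(2)[OF W] restr_zero[OF U(1) oC[OF W] subC[OF W]] .
  qed (rule q(1), rule U.zero_closed)
  have qU: "q \<in> carrier (UP (sect X U))" unfolding U.up_iff using q(1) qd by blast
  have qc: "q \<in> carrier (ps_ring (sect X U))" by (rule U.carrier_UP_ps[OF qU])
  \<comment> \<open>The degree of the numerator may vary over the cover, but one member suffices:
    its bound \<open>N\<close> transfers to \<open>U\<close> because restriction to
    \<open>W0\<close> is injective.\<close>
  obtain W0 where W0: "W0 \<in> ?C" using U(2) cov by blast
  have W0': "opn W0" "W0 \<subseteq> U" "W0 \<noteq> {}" using W0 by auto
  interpret h: ring_hom_cring "sect X U" "sect X W0" "restr X U W0" by (rule restr_hom[OF U(1) W0'(1,2)])
  have "restr X U W0 \<circ> q = Q W0" using q(2)[OF W0] by auto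
  then have e: "restr X U W0 \<circ> (f \<otimes>\<^bsub>ps_ring (sect X U)\<^esub> q) =
      (restr X U W0 \<circ> f) \<otimes>\<^bsub>ps_ring (sect X W0)\<^esub> Q W0"
    using ring_hom_mult[OF h.ps_hom fc qc] by simp
  obtain N where N: "\<And>n. n > N \<Longrightarrow> ((restr X U W0 \<circ> f) \<otimes>\<^bsub>ps_ring (sect X W0)\<^esub> Q W0) n = \<zero>\<^bsub>sect X W0\<^esub>"
    using Q(1)[OF W0] by (auto simp: denominator_def h.S.up_iff)
  have fqc: "(f \<otimes>\<^bsub>ps_ring (sect X U)\<^esub> q) n \<in> carrier (sect X U)" for n by (rule U.ps_mult_closed_nth[OF fc qc])
  have "(f \<otimes>\<^bsub>ps_ring (sect X U)\<^esub> q) n = \<zero>\<^bsub>sect X U\<^esub>" if "n > N" for n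
  proof (rule inj_onD[OF restr_inj[OF U(1) W0'] _ fqc U.zero_closed])
    show "restr X U W0 ((f \<otimes>\<^bsub>ps_ring (sect X U)\<^esub> q) n) = restr X U W0 \<zero>\<^bsub>sect X U\<^esub>"
      using fun_cong[OF e, of n] N[OF that] by simp
  qed
  then have PU: "f \<otimes>\<^bsub>ps_ring (sect X U)\<^esub> q \<in> carrier (UP (sect X U))"
    unfolding U.up_iff using fqc by blast
  have "(f \<otimes>\<^bsub>ps_ring (sect X U)\<^esub> q) 0 = \<one>\<^bsub>sect X U\<^esub>"
    using U.ps_mult_0[OF fc qc] q0 fw by (simp add: witt_set_def)
  then show ?thesis using fw PU qU q0 unfolding Wrat_set_def by blast
qed

lemma WJ_eq_Wrat:
  assumes U: "opn U"
  shows "WJ_set (sect X U) = Wrat_set (sect X U)"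
proof
  interpret U: cring "sect X U" by (rule sect_cring[OF U])
  show "Wrat_set (sect X U) \<subseteq> WJ_set (sect X U)" by (rule U.Wrat_subset_WJ)
  show "WJ_set (sect X U) \<subseteq> Wrat_set (sect X U)"
  proof
    fix f assume f: "f \<in> WJ_set (sect X U)"
    show "f \<in> Wrat_set (sect X U)"
    proof (cases "U = {}")
      case False
      then show ?thesis using WJ_imp_Wrat[OF U _ f] by blast
    next
      case True
      interpret P: cring "ps_ring (sect X U)" by (rule U.ps_cring)
      have fw: "f \<in> witt_set (sect X U)" using f by (simp add: WJ_set_def)
      then have fc: "f n \<in> carrier (sect X U)" for n by (simp add: witt_set_def ps_simps)
      \<comment> \<open>Over the empty set the ring of sections is zero, so \<open>f\<close> is a
        polynomial and the denominator 1 serves.\<close>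
      have "f n = \<zero>\<^bsub>sect X U\<^esub>" for n
        using sect_empty fc U.zero_closed unfolding True by blast
      then have "f \<in> carrier (UP (sect X U))" using fc unfolding U.up_iff by blast
      moreover have "\<one>\<^bsub>ps_ring (sect X U)\<^esub> \<in> carrier (UP (sect X U))"
        using U.ps_one_unit_poly by (simp add: U.unit_polys_def)
      moreover have "f \<otimes>\<^bsub>ps_ring (sect X U)\<^esub> \<one>\<^bsub>ps_ring (sect X U)\<^esub> = f"
        using fw by (simp add: witt_set_def)
      moreover have "f 0 = \<one>\<^bsub>sect X U\<^esub>" using fw by (simp add: witt_set_def)
      moreover have "\<one>\<^bsub>ps_ring (sect X U)\<^esub> 0 = \<one>\<^bsub>sect X U\<^esub>" by (simp add: ps_simps)
      ultimately show ?thesis using fw unfolding Wrat_set_def by blast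
    qed
  qed
qed

section \<open>Presheaf structure and gluing of rational elements\<close>

lemma Wrat_simps:
  "carrier (Wrat A) = Wrat_set A" "f \<otimes>\<^bsub>Wrat A\<^esub> f' = witt_mult A f f'"
  "f \<oplus>\<^bsub>Wrat A\<^esub> f' = f \<otimes>\<^bsub>ps_ring A\<^esub> f'" "\<one>\<^bsub>Wrat A\<^esub> = one_minus A \<one>\<^bsub>A\<^esub> 1"
  by (simp_all add: Wrat_def witt_ring_def)

lemma Wrat_set_closed: "f \<in> Wrat_set A \<Longrightarrow> f n \<in> carrier A" "f \<in> Wrat_set A \<Longrightarrow> f \<in> carrier (ps_ring A)"
  by (simp_all add: Wrat_set_def witt_set_def ps_simps)

lemma Wrat_presheaf:
  "presheaf_of_rings (base X) (\<lambda>U. Wrat (sect X U)) (\<lambda>U V f. restr X U V \<circ> f)"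
  unfolding presheaf_of_rings_def
proof (intro conjI allI impI ballI)
  fix U assume U: "opn U"
  show "cring (Wrat (sect X U))" by (rule cring.Wrat_cring[OF sect_cring[OF U]])
  fix s assume "s \<in> carrier (Wrat (sect X U))"
  then have "s n \<in> carrier (sect X U)" for n by (simp add: Wrat_simps Wrat_set_closed)
  then show "restr X U U \<circ> s = s" using restr_id[OF U] by auto
next
  fix U V assume "opn U \<and> opn V \<and> V \<subseteq> U"
  then have UV: "opn U" "opn V" "V \<subseteq> U" by auto
  interpret h: ring_hom_cring "sect X U" "sect X V" "restr X U V" by (rule restr_hom[OF UV])
  show "(\<lambda>f. restr X U V \<circ> f) \<in> Ring.ring_hom (Wrat (sect X U)) (Wrat (sect X V))"
  proof (rule ring_hom_memI)
    fix f assume "f \<in> carrier (Wrat (sect X U))"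
    then have f: "f \<in> Wrat_set (sect X U)" by (simp add: Wrat_simps)
    then show "restr X U V \<circ> f \<in> carrier (Wrat (sect X V))" using h.Wrat_hom by (simp add: Wrat_simps)
    fix f' assume "f' \<in> carrier (Wrat (sect X U))"
    then have f': "f' \<in> Wrat_set (sect X U)" by (simp add: Wrat_simps)
    note c = Wrat_set_closed(2)[OF f] Wrat_set_closed(2)[OF f']
    show "restr X U V \<circ> (f \<otimes>\<^bsub>Wrat (sect X U)\<^esub> f') = (restr X U V \<circ> f) \<otimes>\<^bsub>Wrat (sect X V)\<^esub> (restr X U V \<circ> f')"
      unfolding Wrat_simps by (rule h.hom_witt_mult[OF c])
    show "restr X U V \<circ> (f \<oplus>\<^bsub>Wrat (sect X U)\<^esub> f') = (restr X U V \<circ> f) \<oplus>\<^bsub>Wrat (sect X V)\<^esub> (restr X U V \<circ> f')"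
      unfolding Wrat_simps by (rule ring_hom_mult[OF h.ps_hom c])
  next
    show "restr X U V \<circ> \<one>\<^bsub>Wrat (sect X U)\<^esub> = \<one>\<^bsub>Wrat (sect X V)\<^esub>"
      unfolding Wrat_simps by (simp only: h.hom_one_minus[OF h.R.one_closed] h.hom_one)
  qed
next
  fix U V W s assume "opn U \<and> opn V \<and> opn W \<and> V \<subseteq> U \<and> W \<subseteq> V" and s: "s \<in> carrier (Wrat (sect X U))"
  then have UVW: "opn U" "opn V" "opn W" "V \<subseteq> U" "W \<subseteq> V" by auto
  have "s n \<in> carrier (sect X U)" for n using s by (simp add: Wrat_simps Wrat_set_closed)
  then show "restr X V W \<circ> (restr X U V \<circ> s) = restr X U W \<circ> s"
    using restr_restr[OF UVW] by auto
qed

text \<open>Fractions representing the various \<open>s V\<close> need not match on overlaps, nor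
  need their degrees be bounded. So the series are glued coefficient by coefficient, and the result
  is seen to be rational by way of \<open>WJ_set\<close>.\<close>

lemma Wrat_glue:
  assumes \<U>: "\<And>V. V \<in> \<U> \<Longrightarrow> opn V" and s: "\<And>V. V \<in> \<U> \<Longrightarrow> s V \<in> Wrat_set (sect X V)"
    and compat: "\<And>V W. V \<in> \<U> \<Longrightarrow> W \<in> \<U> \<Longrightarrow> restr X V (V \<inter> W) \<circ> s V = restr X W (V \<inter> W) \<circ> s W"
  shows "\<exists>!t. t \<in> Wrat_set (sect X (\<Union>\<U>)) \<and> (\<forall>V\<in>\<U>. restr X (\<Union>\<U>) V \<circ> t = s V)"
proof -
  let ?U = "\<Union>\<U>"
  have o: "opn ?U" using \<U> by (rule openin_Union)
  have sub: "V \<in> \<U> \<Longrightarrow> V \<subseteq> ?U" for V by blast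
  interpret U: cring "sect X ?U" by (rule sect_cring[OF o])
  have "\<forall>n. \<exists>t. t \<in> carrier (sect X ?U) \<and> (\<forall>V\<in>\<U>. restr X ?U V t = s V n)"
  proof
    fix n
    have cp: "restr X V (V \<inter> W) (s V n) = restr X W (V \<inter> W) (s W n)" if "V \<in> \<U>" "W \<in> \<U>" for V W
      using compat[OF that] by (rule comp_eq_dest)
    obtain t where "t \<in> carrier (sect X ?U)" "\<forall>V\<in>\<U>. restr X ?U V t = s V n"
      by (rule glue[of \<U> "\<lambda>V. s V n", OF \<U> Wrat_set_closed(1)[OF s] cp])
    then have "t \<in> carrier (sect X ?U) \<and> (\<forall>V\<in>\<U>. restr X ?U V t = s V n)" by (rule conjI)
    then show "\<exists>t. t \<in> carrier (sect X ?U) \<and> (\<forall>V\<in>\<U>. restr X ?U V t = s V n)" by (rule exI)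
  qed
  from choice[OF this] obtain t
    where tt: "\<forall>n. t n \<in> carrier (sect X ?U) \<and> (\<forall>V\<in>\<U>. restr X ?U V (t n) = s V n)" ..
  have t: "t n \<in> carrier (sect X ?U)" for n
    using spec[OF tt, of n] by (rule conjunct1)
  have t': "\<forall>V\<in>\<U>. restr X ?U V (t n) = s V n" for n
    using spec[OF tt, of n] by (rule conjunct2)
  note t = t bspec[OF t']
  have tV: "restr X ?U V \<circ> t = s V" if "V \<in> \<U>" for V using t(2)[OF that] by auto
  have t0: "t 0 = \<one>\<^bsub>sect X ?U\<^esub>"
  proof (rule separated[of \<U>])
    fix V assume V: "V \<in> \<U>"
    show "opn V" by (rule \<U>[OF V])
    have "s V 0 = \<one>\<^bsub>sect X V\<^esub>" using s[OF V] by (simp add: Wrat_set_def witt_set_def)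
    then show "restr X ?U V (t 0) = restr X ?U V \<one>\<^bsub>sect X ?U\<^esub>"
      using t(2)[OF V] restr_one[OF o \<U>[OF V] sub[OF V]] by simp
  qed (use t(1) in simp_all)
  have tw: "t \<in> witt_set (sect X ?U)" using t(1) t0 by (simp add: witt_set_def ps_simps)
  have "t \<in> WJ_set (sect X ?U)"
  proof (cases "?U = {}")
    case True
    have z: "x = \<zero>\<^bsub>sect X ?U\<^esub>" if "x \<in> carrier (sect X ?U)" for x
      using that U.zero_closed unfolding True by (rule sect_empty)
    \<comment> \<open>In the zero ring every minor vanishes; 2 is the smallest size that
      \<open>WJ_set\<close> admits.\<close>
    have "minors_vanish (sect X ?U) (1 + 1) (hankel t)"
      unfolding minors_vanish_def hankel_def by (intro allI impI z U.ring_det_closed t(1))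
    then show ?thesis
      unfolding WJ_set_def by (intro CollectI conjI tw exI[of _ "1::nat"]) simp_all
  next
    case False
    then obtain V where V: "V \<in> \<U>" "V \<noteq> {}" by blast
    have "restr X ?U V \<circ> t \<in> WJ_set (sect X V)"
      using s[OF V(1)] WJ_eq_Wrat[OF \<U>[OF V(1)]] tV[OF V(1)] by simp
    then show ?thesis
      by (rule ring_hom_cring.WJ_hom_inj[OF restr_hom[OF o \<U>[OF V(1)] sub[OF V(1)]]
            restr_inj[OF o \<U>[OF V(1)] sub[OF V(1)] V(2)] tw])
  qed
  then have tr: "t \<in> Wrat_set (sect X ?U)" using WJ_eq_Wrat[OF o] by simp
  show ?thesis
  proof (rule ex1I[of _ t])
    show "t \<in> Wrat_set (sect X ?U) \<and> (\<forall>V\<in>\<U>. restr X ?U V \<circ> t = s V)" using tr tV by blast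
    fix t' assume t': "t' \<in> Wrat_set (sect X ?U) \<and> (\<forall>V\<in>\<U>. restr X ?U V \<circ> t' = s V)"
    show "t' = t"
    proof
      fix n show "t' n = t n"
      proof (rule separated[of \<U>])
        fix V assume V: "V \<in> \<U>"
        show "opn V" by (rule \<U>[OF V])
        have "restr X ?U V \<circ> t' = s V" using t' V by blast
        then have "restr X ?U V (t' n) = s V n" by (rule comp_eq_dest_lhs)
        then show "restr X ?U V (t' n) = restr X ?U V (t n)" using t(2)[OF V] by simp
      qed (use t' t(1) Wrat_set_closed(1) in blast)+
    qed
  qed
qed

end

theorem theorem3p3:
  fixes X :: "('x, 'a) ringed_space"
  assumes "strong_Fatou_scheme X"
  shows "sheaf_of_rings (base X) (\<lambda>U. Wrat (sect X U)) (\<lambda>U V f. restr X U V \<circ> f) \<and>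
         (\<forall>U. openin (base X) U \<longrightarrow> Wrat (sect X U) = WJ (sect X U))"
proof -
  interpret strong_Fatou X using assms by (rule strong_Fatou.intro)
  have glue: "\<exists>!t. t \<in> carrier (Wrat (sect X (\<Union>\<U>))) \<and> (\<forall>V\<in>\<U>. restr X (\<Union>\<U>) V \<circ> t = s V)"
    if op: "\<forall>V\<in>\<U>. openin (base X) V \<and> s V \<in> carrier (Wrat (sect X V))"
      and compat: "\<forall>V\<in>\<U>. \<forall>W\<in>\<U>. restr X V (V \<inter> W) \<circ> s V = restr X W (V \<inter> W) \<circ> s W" for \<U> s
    unfolding Wrat_simps
  proof (rule Wrat_glue)
    fix V assume V: "V \<in> \<U>"
    show "openin (base X) V" "s V \<in> Wrat_set (sect X V)"
      using bspec[OF op V] by (simp_all add: Wrat_simps)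
    fix W assume W: "W \<in> \<U>"
    show "restr X V (V \<inter> W) \<circ> s V = restr X W (V \<inter> W) \<circ> s W"
      by (rule bspec[OF bspec[OF compat V] W])
  qed
  have "sheaf_of_rings (base X) (\<lambda>U. Wrat (sect X U)) (\<lambda>U V f. restr X U V \<circ> f)"
    unfolding sheaf_of_rings_def
    by (intro conjI allI impI Wrat_presheaf glue; elim conjE; assumption)
  moreover have "Wrat (sect X U) = WJ (sect X U)" if "openin (base X) U" for U
    using WJ_eq_Wrat[OF that] by (simp add: Wrat_def WJ_def)
  ultimately show ?thesis by blast
qed

end
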